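(* Let $\Omega$ be an exterior domain in $\mathbb R^N$, and let $$q<N\quad\text{and}\quad 1<q<p<s\le q_*:=\frac{q(N-1)}{N-q}.$$ Then any nonnegative solution $u$ of the differential inequality $$-\Delta_p u-\Delta_q u\ge u^{s-1}\quad\text{in }\Omega$$ is the trivial solution $u\equiv 0$.
   Context: For $r>1$, $\Delta_r u=\operatorname{div}(|\nabla u|^{r-2}\nabla u)$. An exterior domain is a domain (connected open set) $\Omega\subset\mathbb R^N$ with $\Omega\supset\{x:|x|>R\}$ for some $R>0$. A nonnegative solution of $-\Delta_p u-\Delta_q u\ge u^{s-1}$ in $\Omega$ is a function $u\in C(\Omega)\cap W^{1,p}_{loc}(\Omega)$, $u\ge0$, such that $$\int_\Omega |\nabla u|^{p-2}\nabla u\cdot\nabla\varphi\,dx+\int_\Omega |\nabla u|^{q-2}\nabla u\cdot\nabla\varphi\,dx\ge \int_\Omega u^{s-1}\varphi\,dx\quad\text{for all }\varphi\in C^1_c(\Omega),\ \varphi\ge 0.$$ *)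

theory Defs
  imports "HOL-Analysis.Analysis"
begin

definition exterior_domain :: "'a::euclidean_space set \<Rightarrow> bool" where
  "exterior_domain \<Omega> \<longleftrightarrow> open \<Omega> \<and> connected \<Omega> \<and> (\<exists>R>0. {x. norm x > R} \<subseteq> \<Omega>)"

definition grad :: "('a::euclidean_space \<Rightarrow> real) \<Rightarrow> 'a \<Rightarrow> 'a" where
  "grad f x = (THE D. GDERIV f x :> D)"

lemma grad_eq: "grad f x = D" if "GDERIV f x :> D"
  unfolding grad_def
proof (rule the_equality)
  show "GDERIV f x :> D" by (fact that)
next
  fix E assume "GDERIV f x :> E"
  then have "(\<lambda>h. inner h E) = (\<lambda>h. inner h D)"
    using that unfolding gderiv_def by (rule has_derivative_unique)
  then have "inner h E = inner h D" for h by (rule fun_cong)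
  then show "E = D" by (metis vector_eq_ldot)
qed

text \<open>
  Elements of \<open>C\<^sup>1\<^sub>c(\<Omega>)\<close> are represented by their extension by zero to the whole space, which
  is again continuously differentiable because the support is a compact subset of \<open>\<Omega>\<close>.
\<close>

definition C1_c :: "'a::euclidean_space set \<Rightarrow> ('a \<Rightarrow> real) set" where
  "C1_c \<Omega> = {\<phi>. (\<forall>x. GDERIV \<phi> x :> grad \<phi> x) \<and> continuous_on UNIV (grad \<phi>) \<and>
     compact (closure {x. \<phi> x \<noteq> 0}) \<and> closure {x. \<phi> x \<noteq> 0} \<subseteq> \<Omega>}"

definition Lp_loc :: "real \<Rightarrow> 'a::euclidean_space set \<Rightarrow> ('a \<Rightarrow> 'b::euclidean_space) set" where
  "Lp_loc p \<Omega> = {f. f \<in> borel_measurable (lebesgue_on \<Omega>) \<and>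
     (\<forall>K. compact K \<and> K \<subseteq> \<Omega> \<longrightarrow> integrable (lebesgue_on K) (\<lambda>x. norm (f x) powr p))}"

definition weak_gradient ::
  "'a::euclidean_space set \<Rightarrow> ('a \<Rightarrow> real) \<Rightarrow> ('a \<Rightarrow> 'a) \<Rightarrow> bool" where
  "weak_gradient \<Omega> u g \<longleftrightarrow> u \<in> Lp_loc 1 \<Omega> \<and> g \<in> Lp_loc 1 \<Omega> \<and>
     (\<forall>\<phi>\<in>C1_c \<Omega>. \<forall>i\<in>Basis.
        (\<integral>x. u x * (grad \<phi> x \<bullet> i) \<partial>lebesgue_on \<Omega>) = - (\<integral>x. (g x \<bullet> i) * \<phi> x \<partial>lebesgue_on \<Omega>))"

definition W1p_loc :: "real \<Rightarrow> 'a::euclidean_space set \<Rightarrow> ('a \<Rightarrow> real) set" where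
  "W1p_loc p \<Omega> = {u \<in> Lp_loc p \<Omega>. \<exists>g\<in>Lp_loc p \<Omega>. weak_gradient \<Omega> u g}"

text \<open>
  The vector field \<open>|v|\<^bsup>r-2\<^esup>v\<close> whose divergence is the \<open>r\<close>-Laplacian. For \<open>v = 0\<close> it is \<open>0\<close>
  also when \<open>1 < r < 2\<close>, which is the usual convention.
\<close>

definition laplace_flux :: "real \<Rightarrow> 'a::euclidean_space \<Rightarrow> 'a" where
  "laplace_flux r v = (norm v powr (r - 2)) *\<^sub>R v"

text \<open>
  The function \<open>g\<close> below is the weak gradient of \<open>u\<close>. It is unique up to null sets, so the
  inequality does not depend on its choice. Values of \<open>u\<close> outside \<open>\<Omega>\<close> are irrelevant. For
  \<open>1 < q \<le> p\<close> and \<open>s > 1\<close>, all integrals converge absolutely, by local integrability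
  of \<open>|g|\<^bsup>p\<^esup>\<close>, continuity of \<open>u\<close> and compactness of the support of \<open>\<phi>\<close>.
\<close>

definition nonneg_solution ::
  "real \<Rightarrow> real \<Rightarrow> real \<Rightarrow> 'a::euclidean_space set \<Rightarrow> ('a \<Rightarrow> real) \<Rightarrow> bool" where
  "nonneg_solution p q s \<Omega> u \<longleftrightarrow>
     continuous_on \<Omega> u \<and> u \<in> W1p_loc p \<Omega> \<and> (\<forall>x\<in>\<Omega>. u x \<ge> 0) \<and>
     (\<exists>g\<in>Lp_loc p \<Omega>. weak_gradient \<Omega> u g \<and>
        (\<forall>\<phi>\<in>C1_c \<Omega>. (\<forall>x. \<phi> x \<ge> 0) \<longrightarrow>
           (\<integral>x. laplace_flux p (g x) \<bullet> grad \<phi> x \<partial>lebesgue_on \<Omega>)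
             + (\<integral>x. laplace_flux q (g x) \<bullet> grad \<phi> x \<partial>lebesgue_on \<Omega>)
           \<ge> (\<integral>x. u x powr (s - 1) * \<phi> x \<partial>lebesgue_on \<Omega>)))"

end

theory Submission
  imports Defs
begin

text \<open>
  The proof rests on a comparison principle with radial barriers. Let \<open>N\<close> be the dimension, let
  \<open>A(\<xi>) = |\<xi>|\<^bsup>p-2\<^esup>\<xi> + |\<xi>|\<^bsup>q-2\<^esup>\<xi>\<close> be the flux, and put \<open>\<gamma> = (N - q)/(q - 1)\<close>.

  A barrier is prescribed through its flux. For a field \<open>-W(|x - c|\<^sup>2) (x - c)\<close> with \<open>W \<ge> 0\<close> there is a
  radial function \<open>v\<close> with \<open>A(\<nabla>v)\<close> equal to this field: its slope is obtained by inverting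
  \<open>t \<mapsto> t\<^bsup>p-1\<^esup> + t\<^bsup>q-1\<^esup>\<close>. Moreover \<open>-\<Delta>\<^sub>p v - \<Delta>\<^sub>q v = N W + 2 \<tau> W'\<close> at \<open>\<tau> = |x - c|\<^sup>2\<close>. If this is smaller than
  \<open>u\<^bsup>s-1\<^esup>\<close> in a bounded domain and \<open>v \<le> u\<close> on its boundary, then \<open>v \<le> u\<close> inside
  (\<open>comparison_principle\<close>, \<open>radial_comparison\<close>). Four choices of \<open>W\<close> prove the theorem.

  \<^item> \<open>W = K \<tau>\<^bsup>-N\<^esup>\<close> gives a strong maximum principle: a solution that is positive somewhere is
    positive in the whole domain, because positivity at a point spreads to every ball around it
    (\<open>positivity_spreads\<close>, \<open>positive_everywhere\<close>).
  \<^item> \<open>W = K \<tau>\<^bsup>-N/2\<^esup> (1 + 1/\<tau>)\<close>, close to the fundamental solution, gives \<open>u \<ge> c |x|\<^bsup>-\<gamma>\<^esup>\<close> near infinity.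
    For \<open>s \<le> q(N - 1)/(N - q)\<close> this makes \<open>u\<^bsup>s-1\<^esup>\<close> at least a multiple of \<open>|x|\<^bsup>-N\<^esup>\<close>.
  \<^item> With a source of that size \<open>W = K \<tau>\<^bsup>-N/2\<^esup> (1 + ln \<tau>)\<close> is admissible too and improves the bound to
    \<open>u \<ge> c |x|\<^bsup>-\<gamma>\<^esup> (1 + ln |x|\<^sup>2)\<^bsup>1/(q-1)\<^esup>\<close> (\<open>exterior_lower_bound\<close>).
  \<^item> \<open>W = A (r\<^sup>2 + \<tau>)\<^bsup>-N\<^esup>\<close>, centred far out, shows that the minimum \<open>m\<close> of \<open>u\<close> over a ball of
    radius \<open>r\<close> satisfies \<open>c m\<^bsup>s-1\<^esup> r \<le> (m/r)\<^bsup>p-1\<^esup> + (m/r)\<^bsup>q-1\<^esup>\<close> (\<open>ball_minimum_estimate\<close>).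

  The last two statements contradict each other for large \<open>r\<close>. Indeed \<open>m\<close> exceeds any given
  multiple of \<open>r\<^bsup>-\<gamma>\<^esup>\<close>, and since \<open>\<gamma> (s - q) \<le> q\<close> this makes both \<open>m\<^bsup>s-q\<^esup> r\<^sup>q\<close> and \<open>m\<^bsup>s-p\<^esup> r\<^sup>p\<close> as large as
  desired, whereas the ball estimate bounds their smaller one.

  The comparison principle has to cope with a solution that is merely continuous with a weak
  gradient, while test functions are \<open>C\<^sup>1\<close>. Its test function is the squared positive part of
  \<open>v - \<delta> - w\<close>, where \<open>w\<close> is a mollification of \<open>u\<close>. The error caused by \<open>\<nabla>w \<noteq> g\<close> is controlled by
  continuity of translations in \<open>L\<^sup>p\<close> (\<open>C1_approximation\<close>).
\<close>

section \<open>Continuity of translations\<close>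

lemma nn_integral_lborel_translate:
  fixes f :: "'a::euclidean_space \<Rightarrow> ennreal"
  assumes [measurable]: "f \<in> borel_measurable borel"
  shows "(\<integral>\<^sup>+x. f (x - y) \<partial>lborel) = (\<integral>\<^sup>+x. f x \<partial>lborel)"
proof -
  have "(\<integral>\<^sup>+x. f x \<partial>lborel) = (\<integral>\<^sup>+x. f x \<partial>(distr lborel borel ((+) (- y))))"
    by (simp add: lborel_distr_plus)
  also have "\<dots> = (\<integral>\<^sup>+x. f (- y + x) \<partial>lborel)"
    by (rule nn_integral_distr) auto
  finally show ?thesis by simp
qed

lemma integrable_lborel_translate:
  fixes f :: "'a::euclidean_space \<Rightarrow> 'b::{banach,second_countable_topology}"
  assumes "integrable lborel f"
  shows "integrable lborel (\<lambda>x. f (x - y))"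
proof -
  have "integrable (distr lborel borel ((+) (- y))) f"
    using assms by (simp add: lborel_distr_plus)
  then have "integrable lborel (\<lambda>x. f (- y + x))"
    using assms by (subst (asm) integrable_distr_eq) auto
  then show ?thesis by simp
qed

lemma integral_lborel_translate:
  fixes f :: "'a::euclidean_space \<Rightarrow> 'b::{banach,second_countable_topology}"
  assumes [measurable]: "f \<in> borel_measurable borel"
  shows "(\<integral>x. f (x - y) \<partial>lborel) = (\<integral>x. f x \<partial>lborel)"
proof -
  have "(\<integral>x. f x \<partial>lborel) = (\<integral>x. f x \<partial>(distr lborel borel ((+) (- y))))"
    by (simp add: lborel_distr_plus)
  also have "\<dots> = (\<integral>x. f (- y + x) \<partial>lborel)"
    by (rule integral_distr) auto
  finally show ?thesis by simp
qed

lemma lmeasurable_inner_compact: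
  fixes A :: "'a::euclidean_space set" and e :: real
  assumes A: "A \<in> lmeasurable" and e: "e > 0"
  obtains K where "compact K" "K \<subseteq> A" "A - K \<in> lmeasurable" "emeasure lebesgue (A - K) < ennreal e"
proof -
  have As: "A \<in> sets lebesgue" using A by (simp add: fmeasurable_def)
  obtain C where C: "closed C" "C \<subseteq> A" "A - C \<in> lmeasurable" "emeasure lebesgue (A - C) < ennreal (e/2)"
    using sets_lebesgue_inner_closed[OF As, of "e/2"] e by auto
  have "(\<lambda>n. emeasure lebesgue (A - cball 0 (real n))) \<longlonglongrightarrow> emeasure lebesgue (\<Inter>n. A - cball 0 (real n))"
  proof (rule Lim_emeasure_decseq)
    show "range (\<lambda>n. A - cball 0 (real n)) \<subseteq> sets lebesgue" using As by auto
    show "decseq (\<lambda>n. A - cball 0 (real n))" by (auto simp: decseq_def)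
    fix n show "emeasure lebesgue (A - cball 0 (real n)) \<noteq> \<infinity>"
      unfolding infinity_ennreal_def by (intro fmeasurableD2 fmeasurable.Diff A) simp
  qed
  also have "(\<Inter>n. A - cball 0 (real n)) = {}"
    by (auto simp: real_arch_simple)
  finally have "\<forall>\<^sub>F n in sequentially. emeasure lebesgue (A - cball 0 (real n)) < ennreal (e/2)"
    using e by (intro order_tendstoD(2)) auto
  then obtain n where n: "emeasure lebesgue (A - cball 0 (real n)) < ennreal (e/2)"
    by (auto simp: eventually_sequentially)
  show thesis
  proof
    show "compact (C \<inter> cball 0 (real n))" using C by (simp add: closed_Int_compact)
    then have "C \<inter> cball 0 (real n) \<in> lmeasurable" by (rule lmeasurable_compact)
    with A show "A - (C \<inter> cball 0 (real n)) \<in> lmeasurable" by (rule fmeasurable.Diff)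
    have "emeasure lebesgue (A - (C \<inter> cball 0 (real n)))
      \<le> emeasure lebesgue (A - C) + emeasure lebesgue (A - cball 0 (real n))"
      using C(3) sets.Diff[OF As, of "cball 0 (real n)"]
      by (intro order_trans[OF emeasure_mono emeasure_subadditive] sets.Un) (auto simp: fmeasurable_def)
    also have "\<dots> < ennreal (e/2) + ennreal (e/2)" using C(4) n by (rule add_strict_mono)
    finally show "emeasure lebesgue (A - (C \<inter> cball 0 (real n))) < ennreal e"
      using e by (simp flip: ennreal_plus)
  qed (use C in auto)
qed

text \<open>
  Inner and outer regularity squeeze the set between a compact \<open>K\<close> and an open \<open>T\<close> of almost the
  same measure. A translation shorter than the distance from \<open>K\<close> to the complement of \<open>T\<close>
  changes the indicator only at points that lie in \<open>T - K\<close> or are moved into it.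
\<close>

lemma L1_translation_indicator:
  fixes A :: "'a::euclidean_space set" and c :: "'b::euclidean_space"
  assumes A: "A \<in> sets borel" "emeasure lborel A < \<infinity>" and e: "e > 0"
  shows "\<exists>d>0. \<forall>y. norm y < d \<longrightarrow>
    (\<integral>\<^sup>+x. norm (indicator A (x - y) *\<^sub>R c - indicator A x *\<^sub>R c) \<partial>lborel) < ennreal e"
proof -
  define e' where "e' = e / (4 * (norm c + 1))"
  have e': "e' > 0" unfolding e'_def using e by (simp add: add_nonneg_pos)
  have Am: "A \<in> lmeasurable"
    using A by (simp add: fmeasurable_def)
  obtain T where T: "open T" "A \<subseteq> T" "T - A \<in> lmeasurable" "emeasure lebesgue (T - A) < ennreal e'"
    using sets_lebesgue_outer_open[of A e'] A e' by (auto simp: sets_completionI_sets)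
  obtain K where K: "compact K" "K \<subseteq> A" "A - K \<in> lmeasurable" "emeasure lebesgue (A - K) < ennreal e'"
    using lmeasurable_inner_compact[OF Am e'] by blast
  obtain d where d: "d > 0" "(\<Union>x\<in>K. cball x d) \<subseteq> T"
    using compact_subset_open_imp_cball_epsilon_subset[OF K(1) T(1)] K(2) T(2) by blast
  have KT: "x \<in> K \<Longrightarrow> norm z \<le> d \<Longrightarrow> x + z \<in> T" for x z
    using d by (force simp: dist_norm)
  have Kb: "K \<in> sets borel" "T \<in> sets borel"
    using K(1) T(1) by (auto intro: borel_compact borel_open)
  define B where "B = T - K"
  have Bb: "B \<in> sets borel" using Kb by (simp add: B_def)
  have "emeasure lebesgue B \<le> emeasure lebesgue (T - A) + emeasure lebesgue (A - K)"
    using K T by (intro order_trans[OF emeasure_mono emeasure_subadditive]) (auto simp: B_def fmeasurable_def)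
  also have "\<dots> < ennreal e' + ennreal e'"
    using T(4) K(4) by (rule add_strict_mono)
  finally have B2: "emeasure lborel B < ennreal (2 * e')"
    using Bb e' by (simp add: emeasure_completion flip: ennreal_plus)
  show ?thesis
  proof (intro exI[of _ d] conjI allI impI)
    fix y :: 'a assume y: "norm y < d"
    \<comment> \<open>a point where the two indicators differ lies in \<open>B\<close> or is moved into \<open>B\<close>\<close>
    have pt: "ennreal (norm (indicator A (x - y) *\<^sub>R c - indicator A x *\<^sub>R c))
       \<le> ennreal (norm c) * (indicator B x + indicator B (x - y))" for x
    proof (cases "x \<in> A \<longleftrightarrow> x - y \<in> A")
      case True
      then show ?thesis by (auto simp: indicator_def)
    next
      case False
      have "x \<in> B \<or> x - y \<in> B"
      proof (cases "x \<in> A")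
        case True
        then have "x - y \<notin> A" "x \<in> T" using False T by auto
        moreover have "x \<in> K \<Longrightarrow> x - y \<in> T" using KT[of x "-y"] y by simp
        ultimately show ?thesis using K(2) by (auto simp: B_def)
      next
        case F: False
        then have *: "x - y \<in> A" "x - y \<in> T" using False T by auto
        moreover have "x - y \<in> K \<Longrightarrow> x \<in> T" using KT[of "x-y" "y"] y by simp
        ultimately show ?thesis using K(2) F by (auto simp: B_def)
      qed
      then have "ennreal (norm c) * 1 \<le> ennreal (norm c) * (indicator B x + indicator B (x - y))"
        by (intro mult_left_mono) (auto simp: indicator_def)
      moreover have "norm (indicator A (x - y) *\<^sub>R c - indicator A x *\<^sub>R c) = norm c"
        using False by (auto simp: indicator_def)
      ultimately show ?thesis by simp
    qed
    have "(\<integral>\<^sup>+x. norm (indicator A (x - y) *\<^sub>R c - indicator A x *\<^sub>R c) \<partial>lborel)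
      \<le> (\<integral>\<^sup>+x. ennreal (norm c) * (indicator B x + indicator B (x - y)) \<partial>lborel)"
      by (intro nn_integral_mono pt)
    also have "\<dots> = ennreal (norm c) * (emeasure lborel B + emeasure lborel B)"
    proof -
      have ib: "(indicator B :: 'a \<Rightarrow> ennreal) \<in> borel_measurable borel" using Bb by simp
      have m: "(\<lambda>x. indicator B (x - y) :: ennreal) \<in> borel_measurable lborel"
        using measurable_compose[OF _ ib, of "\<lambda>x. x - y" lborel] by simp
      have "(\<integral>\<^sup>+x. indicator B x + indicator B (x - y) \<partial>lborel) = emeasure lborel B + emeasure lborel B"
        using Bb m nn_integral_lborel_translate[OF ib, of y] by (subst nn_integral_add) auto
      then show ?thesis
        using ib m Bb by (subst nn_integral_cmult) auto
    qed
    also have "\<dots> \<le> ennreal (norm c) * (ennreal (2*e') + ennreal (2*e'))"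
      using B2 by (intro mult_left_mono add_mono) auto
    also have "\<dots> = ennreal (norm c * (4 * e'))"
    proof -
      have "ennreal (2*e') + ennreal (2*e') = ennreal (4 * e')"
        using e' by (subst ennreal_plus[symmetric]) auto
      then show ?thesis by (simp only: ennreal_mult'[OF norm_ge_zero])
    qed
    also have "\<dots> < ennreal e"
    proof -
      have "norm c * (4 * e') = e * (norm c / (norm c + 1))"
      proof -
        have "norm c + 1 \<noteq> 0" using norm_ge_zero[of c] by linarith
        then show ?thesis unfolding e'_def by (simp add: field_simps)
      qed
      also have "\<dots> < e * 1" using e by (intro mult_strict_left_mono) (auto simp: divide_simps add_nonneg_pos)
      finally show ?thesis using e by (intro ennreal_lessI) auto
    qed
    finally show "(\<integral>\<^sup>+x. norm (indicator A (x - y) *\<^sub>R c - indicator A x *\<^sub>R c) \<partial>lborel) < ennreal e" .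
  qed (use d in auto)
qed

text \<open>
  Indicators approximate integrable functions in \<open>L\<^sup>1\<close>. Translation preserves the \<open>L\<^sup>1\<close> norm, so the
  error of the approximation enters twice, once before and once after the shift.
\<close>

lemma L1_translation_continuous:
  fixes f :: "'a::euclidean_space \<Rightarrow> 'b::euclidean_space"
  assumes "integrable lborel f" and "e > 0"
  shows "\<exists>d>0. \<forall>y. norm y < d \<longrightarrow> (\<integral>\<^sup>+x. norm (f (x - y) - f x) \<partial>lborel) < ennreal e"
  using assms
proof (induction f arbitrary: e rule: integrable_induct)
  case (base A c)
  then show ?case using L1_translation_indicator[of A e c] by simp
next
  case (add f g)
  from add.IH(1)[of "e/2"] add.prems obtain d1 where d1: "d1 > 0"
    "\<And>y. norm y < d1 \<Longrightarrow> (\<integral>\<^sup>+x. norm (f (x - y) - f x) \<partial>lborel) < ennreal (e/2)" by auto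
  from add.IH(2)[of "e/2"] add.prems obtain d2 where d2: "d2 > 0"
    "\<And>y. norm y < d2 \<Longrightarrow> (\<integral>\<^sup>+x. norm (g (x - y) - g x) \<partial>lborel) < ennreal (e/2)" by auto
  have [measurable]: "f \<in> borel_measurable borel" "g \<in> borel_measurable borel"
    using add.hyps by auto
  show ?case
  proof (intro exI[of _ "min d1 d2"] conjI allI impI)
    fix y :: 'a assume y: "norm y < min d1 d2"
    have "(\<integral>\<^sup>+x. norm (f (x - y) + g (x - y) - (f x + g x)) \<partial>lborel)
      \<le> (\<integral>\<^sup>+x. norm (f (x - y) - f x) + norm (g (x - y) - g x) \<partial>lborel)"
      by (intro nn_integral_mono ennreal_leI order_trans[OF _ norm_triangle_ineq])
         (simp add: algebra_simps)
    also have "\<dots> = (\<integral>\<^sup>+x. norm (f (x - y) - f x) \<partial>lborel) + (\<integral>\<^sup>+x. norm (g (x - y) - g x) \<partial>lborel)"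
      by (subst nn_integral_add[symmetric]) (auto)
    also have "\<dots> < ennreal (e/2) + ennreal (e/2)"
      using d1(2)[of y] d2(2)[of y] y by (intro add_strict_mono) auto
    finally show "(\<integral>\<^sup>+x. norm (f (x - y) + g (x - y) - (f x + g x)) \<partial>lborel) < ennreal e"
      using add.prems by (simp flip: ennreal_plus)
  qed (use d1 d2 in auto)
next
  case (lim f s)
  have [measurable]: "f \<in> borel_measurable borel" "\<And>i. s i \<in> borel_measurable borel"
    using lim.hyps by auto
  have "(\<lambda>i. \<integral>\<^sup>+x. norm (f x - s i x) \<partial>lborel) \<longlonglongrightarrow> 0"
  proof (rule nn_integral_dominated_convergence_norm[where w = "\<lambda>x. 2 * norm (f x)"])
    show "AE x in lborel. norm (s j x) \<le> 2 * norm (f x)" for j using lim.hyps(3) by auto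
    show "(\<integral>\<^sup>+x. ennreal (2 * norm (f x)) \<partial>lborel) < \<infinity>"
      using lim.hyps(4) by (simp add: ennreal_mult' nn_integral_cmult ennreal_mult_less_top integrable_iff_bounded)
    show "AE x in lborel. (\<lambda>i. s i x) \<longlonglongrightarrow> f x" using lim.hyps(2) by auto
  qed auto
  then have "\<forall>\<^sub>F i in sequentially. (\<integral>\<^sup>+x. norm (f x - s i x) \<partial>lborel) < ennreal (e/3)"
    using lim.prems by (intro order_tendstoD(2)) auto
  then obtain i where i: "(\<integral>\<^sup>+x. norm (f x - s i x) \<partial>lborel) < ennreal (e/3)"
    by (auto simp: eventually_sequentially)
  from lim.IH[of "e/3" i] lim.prems obtain d where d: "d > 0"
    "\<And>y. norm y < d \<Longrightarrow> (\<integral>\<^sup>+x. norm (s i (x - y) - s i x) \<partial>lborel) < ennreal (e/3)" by auto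
  show ?case
  proof (intro exI[of _ d] conjI allI impI)
    fix y :: 'a assume y: "norm y < d"
    have "(\<integral>\<^sup>+x. norm (f (x - y) - f x) \<partial>lborel)
      \<le> (\<integral>\<^sup>+x. (ennreal (norm (f (x - y) - s i (x - y))) + ennreal (norm (s i (x - y) - s i x))) + ennreal (norm (f x - s i x)) \<partial>lborel)"
    proof (intro nn_integral_mono)
      fix x
      have "norm (f (x - y) - f x) \<le> norm (f (x - y) - s i (x - y)) + norm (s i (x - y) - s i x) + norm (f x - s i x)"
        by norm
      then show "ennreal (norm (f (x - y) - f x)) \<le> ennreal (norm (f (x - y) - s i (x - y))) + ennreal (norm (s i (x - y) - s i x)) + ennreal (norm (f x - s i x))"
        by (simp flip: ennreal_plus)
    qed
    also have "\<dots> = (\<integral>\<^sup>+x. norm (f (x - y) - s i (x - y)) \<partial>lborel) + (\<integral>\<^sup>+x. norm (s i (x - y) - s i x) \<partial>lborel)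
        + (\<integral>\<^sup>+x. norm (f x - s i x) \<partial>lborel)"
      by (simp add: nn_integral_add)
    also have "(\<integral>\<^sup>+x. norm (f (x - y) - s i (x - y)) \<partial>lborel) = (\<integral>\<^sup>+x. norm (f x - s i x) \<partial>lborel)"
      by (rule nn_integral_lborel_translate[of "\<lambda>x. ennreal (norm (f x - s i x))"]) simp
    also have "(\<integral>\<^sup>+x. norm (f x - s i x) \<partial>lborel) + (\<integral>\<^sup>+x. norm (s i (x - y) - s i x) \<partial>lborel)
        + (\<integral>\<^sup>+x. norm (f x - s i x) \<partial>lborel) < ennreal (e/3) + ennreal (e/3) + ennreal (e/3)"
      using i d(2)[OF y] by (intro add_strict_mono)
    finally show "(\<integral>\<^sup>+x. norm (f (x - y) - f x) \<partial>lborel) < ennreal e"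
      using lim.prems by (simp flip: ennreal_plus)
  qed (use d in auto)
qed

lemma powr_superadditive:
  fixes a b p :: real
  assumes "0 \<le> b" "b \<le> a" "1 \<le> p"
  shows "(a - b) powr p \<le> a powr p - b powr p"
proof (cases "a = 0 \<or> a = b \<or> b = 0")
  case True
  then show ?thesis using assms by auto
next
  case False
  then have ab: "0 < b" "b < a" "0 < a" using assms by auto
  have e: "x powr p = a powr (p - 1) * (x * (x / a) powr (p - 1))" if "0 < x" for x
    using that ab by (simp add: powr_divide flip: powr_mult_base) (simp add: powr_diff powr_minus field_simps)
  have l: "(x / a) powr (p - 1) \<le> 1" if "0 < x" "x \<le> a" for x
    using that ab assms by (intro powr_le1) auto
  have "(a - b) powr p + b powr p = a powr (p - 1) * ((a-b) * ((a-b) / a) powr (p - 1) + b * (b / a) powr (p - 1))"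
    using e[of "a-b"] e[of b] ab by (simp add: distrib_left)
  also have "\<dots> \<le> a powr (p - 1) * ((a - b) * 1 + b * 1)"
    using ab by (intro mult_left_mono add_mono l) auto
  also have "\<dots> = a powr p" using ab by (simp add: powr_diff)
  finally show ?thesis by simp
qed

text \<open>
  The signed power of an \<open>L\<^sup>p\<close> function is integrable. This inequality therefore carries continuity
  of translations from \<open>L\<^sup>1\<close> over to \<open>L\<^sup>p\<close>.
\<close>

lemma abs_diff_powr_le_signed_powr:
  fixes a b p :: real
  assumes "1 \<le> p"
  shows "\<bar>a - b\<bar> powr p \<le> 2 powr p * \<bar>sgn a * \<bar>a\<bar> powr p - sgn b * \<bar>b\<bar> powr p\<bar>"
proof -
  have opp: "\<bar>a + b\<bar> powr p \<le> 2 powr p * (a powr p + b powr p)" if "0 \<le> a" "0 \<le> b" for a b :: real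
  proof -
    have "\<bar>a + b\<bar> powr p \<le> (2 * max a b) powr p"
      using that assms by (intro powr_mono2) auto
    also have "\<dots> = 2 powr p * max a b powr p" using that by (simp add: powr_mult)
    also have "\<dots> \<le> 2 powr p * (a powr p + b powr p)"
      using that by (intro mult_left_mono) (auto simp: max_def)
    finally show ?thesis .
  qed
  have same: "\<bar>a - b\<bar> powr p \<le> 2 powr p * \<bar>a powr p - b powr p\<bar>" if "0 \<le> a" "0 \<le> b" for a b :: real
  proof -
    have "\<bar>a - b\<bar> powr p \<le> \<bar>a powr p - b powr p\<bar>"
      using powr_superadditive[of b a p] powr_superadditive[of a b p] that assms
      by (cases "a \<le> b") (auto simp: abs_if)
    also have "\<dots> \<le> 2 powr p * \<bar>a powr p - b powr p\<bar>"
      using assms by (simp add: ge_one_powr_ge_zero mult_le_cancel_right1)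
    finally show ?thesis .
  qed
  have sg: "sgn a * \<bar>a\<bar> powr p = (if 0 \<le> a then a powr p else - ((-a) powr p))" for a :: real
    by (auto simp: sgn_if)
  consider "0 \<le> a" "0 \<le> b" | "0 \<le> a" "b < 0" | "a < 0" "0 \<le> b" | "a < 0" "b < 0" by linarith
  then show ?thesis
  proof cases
    case 1 then show ?thesis using same[of a b] unfolding sg by simp
  next
    case 2 then show ?thesis using opp[of a "-b"] unfolding sg by simp
  next
    case 3 then show ?thesis using opp[of "-a" b] unfolding sg by (simp add: abs_minus_commute add.commute)
  next
    case 4 then show ?thesis using same[of "-a" "-b"] unfolding sg by (simp add: abs_minus_commute)
  qed
qed

text \<open>
  In the application \<open>X = 1 + |g|\<close>, and \<open>X\<^bsup>p-1\<^esup>\<close> bounds the flux of \<open>g\<close>, which is only integrable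
  to the power dual to \<open>p\<close>. Young's inequality separates the weight from the difference, and the
  signed powers of the components of \<open>f\<close> reduce the remaining \<open>L\<^sup>p\<close> term to \<open>L\<^sup>1\<close>.
\<close>

lemma Lp_weighted_translation_continuous:
  fixes f :: "'a::euclidean_space \<Rightarrow> 'b::euclidean_space" and X :: "'a \<Rightarrow> real"
  assumes f[measurable]: "f \<in> borel_measurable borel" and fp: "integrable lborel (\<lambda>x. norm (f x) powr p)"
    and X[measurable]: "X \<in> borel_measurable borel" and X0: "\<And>x. 0 \<le> X x"
    and Xp: "integrable lborel (\<lambda>x. X x powr p)"
    and p: "1 \<le> p" and e: "e > 0"
  shows "\<exists>d>0. \<forall>y. norm y < d \<longrightarrow>
    (\<integral>\<^sup>+x. X x powr (p - 1) * norm (f (x - y) - f x) \<partial>lborel) < ennreal e"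
proof -
  define N where "N = real DIM('b)"
  have N: "N \<ge> 1" by (simp add: N_def Suc_leI)
  define G where "G x = (\<Sum>i\<in>Basis. (sgn (f x \<bullet> i) * \<bar>f x \<bullet> i\<bar> powr p) *\<^sub>R i)" for x
  have [measurable]: "G \<in> borel_measurable borel" unfolding G_def by measurable
  have Gi: "G x \<bullet> i = sgn (f x \<bullet> i) * \<bar>f x \<bullet> i\<bar> powr p" if "i \<in> Basis" for x i
    unfolding G_def using that by (simp add: inner_sum_left inner_Basis if_distrib cong: if_cong)
  have Gint: "integrable lborel G"
  proof (rule Bochner_Integration.integrable_bound)
    show "integrable lborel (\<lambda>x. N * norm (f x) powr p)" using fp by simp
    show "AE x in lborel. norm (G x) \<le> norm (N * norm (f x) powr p)"
    proof (rule AE_I2)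
      fix x
      have "norm (G x) \<le> (\<Sum>i\<in>Basis. \<bar>G x \<bullet> i\<bar>)" by (rule norm_le_l1)
      also have "\<dots> \<le> (\<Sum>i\<in>(Basis::'b set). norm (f x) powr p)"
      proof (rule sum_mono)
        fix i :: 'b assume i: "i \<in> Basis"
        have "\<bar>G x \<bullet> i\<bar> \<le> \<bar>f x \<bullet> i\<bar> powr p" by (simp add: Gi[OF i] abs_mult abs_sgn_eq)
        also have "\<dots> \<le> norm (f x) powr p" using i p by (intro powr_mono2) (auto simp: Basis_le_norm)
        finally show "\<bar>G x \<bullet> i\<bar> \<le> norm (f x) powr p" .
      qed
      finally show "norm (G x) \<le> norm (N * norm (f x) powr p)" using N by (simp add: N_def)
    qed
  qed simp
  define M where "M = (\<integral>x. X x powr p \<partial>lborel)"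
  have M: "M \<ge> 0" unfolding M_def by simp
  \<comment> \<open>\<open>M + 1\<close> instead of \<open>M\<close> guards against \<open>M = 0\<close>\<close>
  define \<delta> where "\<delta> = e / (2 * N * (M + 1))"
  have \<delta>: "\<delta> > 0" using e N M by (simp add: \<delta>_def)
  define C where "C = N * \<delta> powr (1 - p) * 2 powr p"
  have C: "C > 0" using N \<delta> by (simp add: C_def)
  obtain d where d: "d > 0" "\<And>y. norm y < d \<Longrightarrow> (\<integral>\<^sup>+x. norm (G (x - y) - G x) \<partial>lborel) < ennreal (e / (2 * C))"
    using L1_translation_continuous[OF Gint, of "e / (2*C)"] e C by auto
  \<comment> \<open>distinguish whether \<open>t \<le> \<delta> X\<close> or not\<close>
  have young: "X x powr (p - 1) * t \<le> \<delta> * X x powr p + \<delta> powr (1 - p) * t powr p" if t: "0 \<le> t" for x t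
  proof (cases "t \<le> \<delta> * X x")
    case True
    have "X x powr (p - 1) * t \<le> X x powr (p - 1) * (\<delta> * X x)"
      using True by (intro mult_left_mono) auto
    also have "\<dots> = \<delta> * X x powr p"
      using powr_mult_base[OF X0, of x "p - 1"] by (simp add: mult_ac)
    finally show ?thesis by (simp add: add_increasing2)
  next
    case False
    then have t0: "t > 0" using mult_nonneg_nonneg[of \<delta> "X x"] X0[of x] \<delta> by linarith
    have "X x \<le> t / \<delta>" using False \<delta> by (simp add: field_simps)
    then have "X x powr (p - 1) * t \<le> (t / \<delta>) powr (p - 1) * t"
      using X0 p t by (intro mult_right_mono powr_mono2) auto
    also have "\<dots> = \<delta> powr (1 - p) * t powr p"
      using t0 \<delta> by (simp add: powr_divide powr_diff powr_minus_divide field_simps)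
    finally show ?thesis using \<delta> by (simp add: add_increasing)
  qed
  have pt: "X x powr (p - 1) * norm (f (x - y) - f x) \<le> N * \<delta> * X x powr p + C * norm (G (x - y) - G x)" for x y
  proof -
    have "X x powr (p - 1) * norm (f (x - y) - f x)
        \<le> X x powr (p - 1) * (\<Sum>i\<in>Basis. \<bar>(f (x - y) - f x) \<bullet> i\<bar>)"
      by (intro mult_left_mono norm_le_l1) auto
    also have "\<dots> \<le> (\<Sum>i\<in>(Basis::'b set). \<delta> * X x powr p + \<delta> powr (1 - p) * (2 powr p * norm (G (x - y) - G x)))"
      unfolding sum_distrib_left
    proof (rule sum_mono)
      fix i :: 'b assume i: "i \<in> Basis"
      have "\<bar>(f (x - y) - f x) \<bullet> i\<bar> powr p \<le> 2 powr p * \<bar>(G (x - y) - G x) \<bullet> i\<bar>"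
        using abs_diff_powr_le_signed_powr[OF p, of "f (x-y) \<bullet> i" "f x \<bullet> i"]
        by (simp add: inner_diff_left Gi[OF i])
      also have "\<dots> \<le> 2 powr p * norm (G (x - y) - G x)"
        using i by (intro mult_left_mono Basis_le_norm) auto
      finally have "\<delta> powr (1 - p) * \<bar>(f (x - y) - f x) \<bullet> i\<bar> powr p \<le> \<delta> powr (1 - p) * (2 powr p * norm (G (x - y) - G x))"
        by (intro mult_left_mono) auto
      then show "X x powr (p - 1) * \<bar>(f (x - y) - f x) \<bullet> i\<bar> \<le> \<delta> * X x powr p + \<delta> powr (1 - p) * (2 powr p * norm (G (x - y) - G x))"
        using young[of "\<bar>(f (x - y) - f x) \<bullet> i\<bar>" x] by linarith
    qed
    also have "\<dots> = N * \<delta> * X x powr p + C * norm (G (x - y) - G x)"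
      by (simp add: N_def C_def algebra_simps)
    finally show ?thesis .
  qed
  show ?thesis
  proof (intro exI[of _ d] conjI allI impI)
    fix y :: 'a assume y: "norm y < d"
    have "(\<integral>\<^sup>+x. X x powr (p - 1) * norm (f (x - y) - f x) \<partial>lborel)
      \<le> (\<integral>\<^sup>+x. ennreal (N * \<delta>) * ennreal (X x powr p) + ennreal C * ennreal (norm (G (x - y) - G x)) \<partial>lborel)"
    proof (rule nn_integral_mono)
      fix x
      have "ennreal (N * \<delta>) * ennreal (X x powr p) + ennreal C * ennreal (norm (G (x - y) - G x))
         = ennreal (N * \<delta> * X x powr p + C * norm (G (x - y) - G x))"
        using N \<delta> C by (simp add: ennreal_mult)
      then show "ennreal (X x powr (p - 1) * norm (f (x - y) - f x)) \<le> ennreal (N * \<delta>) * ennreal (X x powr p) + ennreal C * ennreal (norm (G (x - y) - G x))"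
        using pt[of x y] by (simp only: ennreal_leI)
    qed
    also have "\<dots> = ennreal (N * \<delta>) * (\<integral>\<^sup>+x. X x powr p \<partial>lborel) + ennreal C * (\<integral>\<^sup>+x. norm (G (x - y) - G x) \<partial>lborel)"
      by (simp add: nn_integral_add nn_integral_cmult)
    also have "(\<integral>\<^sup>+x. X x powr p \<partial>lborel) = ennreal M"
      unfolding M_def using Xp by (intro nn_integral_eq_integral) auto
    also have "ennreal (N * \<delta>) * ennreal M + ennreal C * (\<integral>\<^sup>+x. norm (G (x - y) - G x) \<partial>lborel)
       < ennreal (e/2) + ennreal (e/2)"
    proof (rule add_strict_mono)
      have "N * \<delta> * M = e / 2 * (M / (M + 1))" using N by (simp add: \<delta>_def)
      also have "\<dots> < e / 2 * 1" using e M by (intro mult_strict_left_mono) auto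
      finally show "ennreal (N * \<delta>) * ennreal M < ennreal (e/2)"
        using N \<delta> M e by (simp add: ennreal_less_iff flip: ennreal_mult)
      have "ennreal C * (\<integral>\<^sup>+x. norm (G (x - y) - G x) \<partial>lborel) < ennreal C * ennreal (e / (2*C))"
        using d(2)[OF y] C by (intro ennreal_mult_strict_left_mono) auto
      also have "\<dots> = ennreal (e/2)" using C e by (simp flip: ennreal_mult)
      finally show "ennreal C * (\<integral>\<^sup>+x. norm (G (x - y) - G x) \<partial>lborel) < ennreal (e/2)" .
    qed
    finally show "(\<integral>\<^sup>+x. X x powr (p - 1) * norm (f (x - y) - f x) \<partial>lborel) < ennreal e"
      using e by (simp flip: ennreal_plus)
  qed (use d in auto)
qed

section \<open>Convolution with a bump\<close>

text \<open>
  The squared positive part is \<open>C\<^sup>1\<close> with a remainder that is quadratic uniformly in \<open>t\<close>. It serves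
  twice: as the profile of the mollification kernel, and as the truncation in the test function
  of the comparison principle.
\<close>

lemma sq_pos_part_taylor:
  fixes t d :: real
  shows "\<bar>(max 0 (t + d))\<^sup>2 - (max 0 t)\<^sup>2 - 2 * max 0 t * d\<bar> \<le> d\<^sup>2"
proof -
  consider "0 \<le> t" "0 \<le> t + d" | "0 \<le> t" "t + d < 0" | "t < 0" "0 \<le> t + d" | "t < 0" "t + d < 0" by linarith
  then show ?thesis
  proof cases
    case 1 then show ?thesis by (simp add: power2_eq_square algebra_simps)
  next
    case 2
    have "0 \<le> t * (- (t + d))" using 2 by (intro mult_nonneg_nonneg) auto
    moreover have "0 \<le> (t + d)\<^sup>2" by simp
    moreover have "0 \<le> t * (-d)" using 2 by (intro mult_nonneg_nonneg) auto
    ultimately show ?thesis using 2 by (simp add: power2_eq_square algebra_simps abs_if)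
  next
    case 3
    then have "(t + d)\<^sup>2 \<le> d\<^sup>2" by (intro power_mono) auto
    then show ?thesis using 3 by simp
  qed auto
qed

lemma GDERIV_quadratic_remainder:
  fixes f :: "'a::euclidean_space \<Rightarrow> real"
  assumes "r > 0" and "\<And>h. norm h \<le> r \<Longrightarrow> \<bar>f (x + h) - f x - h \<bullet> D\<bar> \<le> C * (norm h)\<^sup>2"
  shows "GDERIV f x :> D"
  unfolding gderiv_def has_derivative_at
proof
  show "bounded_linear (\<lambda>h. h \<bullet> D)" by (rule bounded_linear_inner_left)
  have "(\<lambda>h. norm (f (x + h) - f x - h \<bullet> D) / norm h) \<midarrow>0\<rightarrow> 0"
  proof (rule Lim_null_comparison[where g = "\<lambda>h. C * norm h"])
    show "\<forall>\<^sub>F h in at 0. norm (norm (f (x + h) - f x - h \<bullet> D) / norm h) \<le> C * norm h"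
      unfolding eventually_at
    proof (intro exI[of _ r] conjI ballI impI)
      fix h :: 'a assume "h \<noteq> 0 \<and> dist h 0 < r"
      then show "norm (norm (f (x + h) - f x - h \<bullet> D) / norm h) \<le> C * norm h"
        using assms(2)[of h] by (simp add: field_simps power2_eq_square)
    qed (use assms in auto)
    show "((\<lambda>h. C * norm h) \<longlongrightarrow> 0) (at 0)" by (intro tendsto_eq_intros) auto
  qed
  then show "(\<lambda>h. norm (f (x + h) - f x - h \<bullet> D) / norm h) \<midarrow>0\<rightarrow> 0" .
qed

text \<open>
  A mollification kernel supported in the ball of radius \<open>r\<close>, without normalisation. It is no more than
  \<open>C\<^sup>1\<close>, which is the regularity of the test functions.
\<close>

definition bump :: "real \<Rightarrow> 'a::euclidean_space \<Rightarrow> real" where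
  "bump r y = (max 0 (r\<^sup>2 - (norm y)\<^sup>2))\<^sup>2"

definition bump_grad :: "real \<Rightarrow> 'a::euclidean_space \<Rightarrow> 'a" where
  "bump_grad r y = (- 4 * max 0 (r\<^sup>2 - (norm y)\<^sup>2)) *\<^sub>R y"

lemma bump_nonneg: "0 \<le> bump r y"
  by (simp add: bump_def)

lemma bump_eq_0: "bump r y = 0" if "r \<le> norm y" "0 \<le> r"
  using that by (simp add: bump_def power_mono max_def)

lemma bump_grad_eq_0: "bump_grad r y = 0" if "r \<le> norm y" "0 \<le> r"
  using that by (simp add: bump_grad_def power_mono max_def)

lemma bump_le: "bump r y \<le> r ^ 4"
proof -
  have "(max 0 (r\<^sup>2 - (norm y)\<^sup>2))\<^sup>2 \<le> (r\<^sup>2)\<^sup>2" by (intro power_mono) auto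
  then show ?thesis by (simp add: bump_def)
qed

lemma continuous_on_bump [continuous_intros]: "continuous_on S (bump r)"
  unfolding bump_def by (intro continuous_intros)

lemma continuous_on_bump_grad [continuous_intros]: "continuous_on S (bump_grad r)"
  unfolding bump_grad_def by (intro continuous_intros)

lemma borel_measurable_bump [measurable]: "bump r \<in> borel_measurable borel"
  "bump_grad r \<in> borel_measurable borel"
  by (intro borel_measurable_continuous_onI continuous_intros)+

lemma norm_bump_grad_le: "norm (bump_grad r y) \<le> 4 * r\<^sup>2 * r" if "0 \<le> r"
proof (cases "r \<le> norm y")
  case True then show ?thesis using that by (simp add: bump_grad_eq_0)
next
  case False
  have "norm (bump_grad r y) = 4 * (max 0 (r\<^sup>2 - (norm y)\<^sup>2) * norm y)" by (simp add: bump_grad_def)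
  also have "\<dots> \<le> 4 * (r\<^sup>2 * r)" using False by (intro mult_left_mono mult_mono) auto
  finally show ?thesis by simp
qed

text \<open>
  With \<open>a = r\<^sup>2 - |z|\<^sup>2\<close>, passing from \<open>z\<close> to \<open>z + h\<close> adds \<open>d = - (2 h \<bullet> z + |h|\<^sup>2)\<close> to \<open>a\<close>. The bound is
  uniform in \<open>z\<close>, so that it can be integrated against any integrable function.
\<close>

lemma bump_taylor:
  fixes z h :: "'a::euclidean_space"
  assumes r: "0 \<le> r" and h: "norm h \<le> 1"
  shows "\<bar>bump r (z + h) - bump r z - h \<bullet> bump_grad r z\<bar> \<le> ((2 * r + 3)\<^sup>2 + 2 * r\<^sup>2) * (norm h)\<^sup>2"
proof (cases "norm z \<le> r + 1")
  case False
  then have "norm (z + h) \<ge> r" using norm_diff_ineq[of z h] h by linarith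
  then show ?thesis using False r by (simp add: bump_eq_0 bump_grad_eq_0)
next
  case True
  define a where "a = r\<^sup>2 - (norm z)\<^sup>2"
  define d where "d = - (2 * (h \<bullet> z) + (norm h)\<^sup>2)"
  have ad: "r\<^sup>2 - (norm (z + h))\<^sup>2 = a + d"
    by (simp add: a_def d_def power2_norm_eq_inner inner_add_left inner_add_right inner_commute)
  have g: "h \<bullet> bump_grad r z = 2 * max 0 a * d + 2 * max 0 a * (norm h)\<^sup>2"
    unfolding bump_grad_def a_def[symmetric] d_def by (simp add: algebra_simps)
  have "\<bar>d\<bar> \<le> (2 * r + 3) * norm h"
  proof -
    have "\<bar>d\<bar> \<le> 2 * (norm h * norm z) + (norm h)\<^sup>2"
      using Cauchy_Schwarz_ineq2[of h z] zero_le_power2[of "norm h"] unfolding d_def by linarith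
    also have "\<dots> \<le> 2 * (norm h * (r + 1)) + norm h * 1"
      unfolding power2_eq_square using True h by (intro add_mono mult_left_mono) auto
    finally show ?thesis by (simp add: algebra_simps)
  qed
  then have "\<bar>d\<bar>\<^sup>2 \<le> ((2 * r + 3) * norm h)\<^sup>2" by (intro power_mono) auto
  then have d2: "d\<^sup>2 \<le> (2 * r + 3)\<^sup>2 * (norm h)\<^sup>2" by (simp add: power_mult_distrib)
  have "\<bar>2 * max 0 a * (norm h)\<^sup>2\<bar> \<le> 2 * r\<^sup>2 * (norm h)\<^sup>2"
    unfolding a_def by (auto simp: abs_mult intro!: mult_right_mono)
  then show ?thesis
    using sq_pos_part_taylor[of a d] d2 unfolding bump_def ad a_def[symmetric] g
    unfolding distrib_right by linarith
qed

lemma GDERIV_bump: "GDERIV (bump r) z :> bump_grad r z" if "0 \<le> r"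
  using GDERIV_quadratic_remainder[of 1 "bump r" z, OF _ bump_taylor[OF that]] by simp

lemma lborel_distr_reflect: "distr lborel borel (\<lambda>y. x - y) = (lborel :: 'a::euclidean_space measure)"
proof -
  have "lborel = density (distr lborel borel (\<lambda>y. x + (-1) *\<^sub>R y)) (\<lambda>_. ennreal (\<bar>-1\<bar> ^ DIM('a)))"
    by (rule lborel_affine) simp
  then show ?thesis by (simp add: density_1)
qed

lemma integral_lborel_reflect:
  fixes f :: "'a::euclidean_space \<Rightarrow> 'b::{banach,second_countable_topology}"
  assumes [measurable]: "f \<in> borel_measurable borel"
  shows "(\<integral>y. f (x - y) \<partial>lborel) = (\<integral>y. f y \<partial>lborel)"
proof -
  have "(\<integral>y. f y \<partial>lborel) = (\<integral>y. f y \<partial>(distr lborel borel (\<lambda>y. x - y)))"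
    unfolding lborel_distr_reflect ..
  also have "\<dots> = (\<integral>y. f (x - y) \<partial>lborel)"
    by (rule integral_distr) auto
  finally show ?thesis by simp
qed

lemma integrable_lborel_reflect:
  fixes f :: "'a::euclidean_space \<Rightarrow> 'b::{banach,second_countable_topology}"
  assumes "integrable lborel f"
  shows "integrable lborel (\<lambda>y. f (x - y))"
proof -
  have "integrable (distr lborel borel (\<lambda>y. x - y)) f"
    using assms by (simp add: lborel_distr_reflect)
  then show ?thesis
    using assms by (subst (asm) integrable_distr_eq) auto
qed

lemma integrable_bump: "integrable lborel (bump r :: 'a::euclidean_space \<Rightarrow> real)" if "0 \<le> r"
proof (rule Bochner_Integration.integrable_bound)
  show "integrable lborel (\<lambda>x::'a. indicator (cball 0 r) x * r ^ 4 :: real)"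
    by (intro integrable_mult_left integrable_real_indicator) (use emeasure_bounded_finite[of "cball (0::'a) r"] in auto)
  show "AE x in lborel. norm (bump r (x::'a)) \<le> norm (indicator (cball 0 r) x * r ^ 4 :: real)"
  proof (rule AE_I2)
    fix x :: 'a show "norm (bump r x) \<le> norm (indicator (cball 0 r) x * r ^ 4 :: real)"
      using bump_le[of r x] bump_eq_0[of r x] that bump_nonneg[of r x]
      by (cases "norm x \<le> r") auto
  qed
qed simp

lemma integral_bump_pos: "0 < (\<integral>x. bump r x \<partial>(lborel :: 'a::euclidean_space measure))" if "0 < r"
proof -
  have "r\<^sup>2 - (norm x)\<^sup>2 \<ge> r\<^sup>2 * (3/4)" if x: "x \<in> ball 0 (r/2)" for x :: 'a
  proof -
    have "(norm x)\<^sup>2 \<le> (r/2)\<^sup>2" using x by (intro power_mono) auto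
    then show ?thesis by (simp add: power_divide)
  qed
  then have "bump r x \<ge> (r\<^sup>2 * (3/4))\<^sup>2" if x: "x \<in> ball 0 (r/2)" for x :: 'a
    unfolding bump_def using x by (intro power_mono) (auto simp: le_max_iff_disj)
  then have le: "indicator (ball 0 (r/2)) x * (r\<^sup>2 * (3/4))\<^sup>2 \<le> bump r x" for x :: 'a
    using bump_nonneg[of r x] by (cases "x \<in> ball 0 (r/2)") auto
  have "0 < measure lborel (ball (0::'a) (r/2)) * (r\<^sup>2 * (3/4))\<^sup>2"
    using that by (intro mult_pos_pos) (auto simp: content_ball_pos)
  also have "\<dots> = (\<integral>x. indicator (ball 0 (r/2)) x * (r\<^sup>2 * (3/4))\<^sup>2 \<partial>(lborel :: 'a measure))"
    by simp
  also have "\<dots> \<le> (\<integral>x. bump r x \<partial>(lborel :: 'a measure))"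
    using that le by (intro integral_mono integrable_bump integrable_mult_left integrable_real_indicator)
      (use emeasure_bounded_finite[of "ball (0::'a) (r/2)"] in auto)
  finally show ?thesis .
qed

lemma integrable_mult_bounded:
  fixes U :: "'a \<Rightarrow> real" and k :: "'a \<Rightarrow> 'b::{banach,second_countable_topology,real_normed_vector}"
  assumes U: "integrable M U" and [measurable]: "k \<in> borel_measurable M" and b: "\<And>x. norm (k x) \<le> B"
  shows "integrable M (\<lambda>x. U x *\<^sub>R k x)"
proof (rule Bochner_Integration.integrable_bound)
  show "integrable M (\<lambda>x. U x * B)" using U by simp
  show "AE x in M. norm (U x *\<^sub>R k x) \<le> norm (U x * B)"
    using b by (intro AE_I2) (auto simp: abs_mult intro!: mult_left_mono order_trans[OF b])
qed (use U in auto)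

lemma GDERIV_convolution_bump:
  fixes U :: "'a::euclidean_space \<Rightarrow> real"
  assumes U: "integrable lborel U" and r: "0 \<le> r"
  shows "GDERIV (\<lambda>x. \<integral>z. U z * bump r (x - z) \<partial>lborel) x :> (\<integral>z. U z *\<^sub>R bump_grad r (x - z) \<partial>lborel)"
proof (rule GDERIV_quadratic_remainder[where r = 1 and C = "((2 * r + 3)\<^sup>2 + 2 * r\<^sup>2) * (\<integral>z. \<bar>U z\<bar> \<partial>lborel)"])
  fix h :: 'a assume h: "norm h \<le> 1"
  have i1: "integrable lborel (\<lambda>z. U z * bump r (y - z))" for y
    using integrable_mult_bounded[OF U, of "\<lambda>z. bump r (y - z)" "r^4", OF _ _] bump_le[of r "y - z" for z] bump_nonneg[of r "y - z" for z] by (auto simp: real_scaleR_def)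
  have i2: "integrable lborel (\<lambda>z. U z *\<^sub>R bump_grad r (x - z))"
    by (rule integrable_mult_bounded[OF U _ norm_bump_grad_le[OF r]]) simp
  then have i3: "integrable lborel (\<lambda>z. h \<bullet> (U z *\<^sub>R bump_grad r (x - z)))"
    by (rule integrable_inner_right[rotated]) 
  have "(\<integral>z. U z * bump r (x + h - z) \<partial>lborel) - (\<integral>z. U z * bump r (x - z) \<partial>lborel)
      - h \<bullet> (\<integral>z. U z *\<^sub>R bump_grad r (x - z) \<partial>lborel)
    = (\<integral>z. U z * bump r (x + h - z) - U z * bump r (x - z) - h \<bullet> (U z *\<^sub>R bump_grad r (x - z)) \<partial>lborel)"
    using i1 i2 i3 integral_inner_right[of h lborel "\<lambda>z. U z *\<^sub>R bump_grad r (x - z)"] by simp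
  also have "\<dots> = (\<integral>z. U z * (bump r ((x - z) + h) - bump r (x - z) - h \<bullet> bump_grad r (x - z)) \<partial>lborel)"
    by (simp add: algebra_simps)
  also have "\<bar>\<dots>\<bar> \<le> (\<integral>z. \<bar>U z\<bar> * (((2 * r + 3)\<^sup>2 + 2 * r\<^sup>2) * (norm h)\<^sup>2) \<partial>lborel)"
    using bump_taylor[OF r h] U
    by (intro order_trans[OF integral_abs_bound] integral_mono')
       (auto simp: abs_mult intro!: mult_left_mono)
  finally show "\<bar>(\<integral>z. U z * bump r (x + h - z) \<partial>lborel) - (\<integral>z. U z * bump r (x - z) \<partial>lborel)
      - h \<bullet> (\<integral>z. U z *\<^sub>R bump_grad r (x - z) \<partial>lborel)\<bar> \<le> ((2 * r + 3)\<^sup>2 + 2 * r\<^sup>2) * (\<integral>z. \<bar>U z\<bar> \<partial>lborel) * (norm h)\<^sup>2"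
    by (simp add: mult_ac)
qed simp

lemma continuous_convolution_bump_grad:
  fixes U :: "'a::euclidean_space \<Rightarrow> real"
  assumes U: "integrable lborel U" and r: "0 \<le> r"
  shows "continuous_on S (\<lambda>x. \<integral>z. U z *\<^sub>R bump_grad r (x - z) \<partial>lborel)"
proof (rule continuous_on_subset[OF _ subset_UNIV], rule continuous_at_imp_continuous_on, rule ballI)
  fix x :: 'a
  have [measurable]: "U \<in> borel_measurable borel" using U by auto
  show "isCont (\<lambda>x. \<integral>z. U z *\<^sub>R bump_grad r (x - z) \<partial>lborel) x"
    unfolding continuous_at_sequentially o_def
  proof (intro allI impI)
    fix X assume X: "X \<longlonglongrightarrow> x"
    show "(\<lambda>n. \<integral>z. U z *\<^sub>R bump_grad r (X n - z) \<partial>lborel) \<longlonglongrightarrow> (\<integral>z. U z *\<^sub>R bump_grad r (x - z) \<partial>lborel)"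
    proof (rule integral_dominated_convergence[where w = "\<lambda>z. \<bar>U z\<bar> * (4 * r\<^sup>2 * r)"])
      show "AE z in lborel. (\<lambda>n. U z *\<^sub>R bump_grad r (X n - z)) \<longlonglongrightarrow> U z *\<^sub>R bump_grad r (x - z)"
      proof (intro AE_I2 tendsto_intros)
        fix z
        have "isCont (bump_grad r) (x - z)" using continuous_on_bump_grad[of "UNIV :: 'a set" r] by (simp add: continuous_on_eq_continuous_at)
        then show "(\<lambda>n. bump_grad r (X n - z)) \<longlonglongrightarrow> bump_grad r (x - z)"
          by (rule isCont_tendsto_compose) (intro tendsto_intros X)
      qed
      show "AE z in lborel. norm (U z *\<^sub>R bump_grad r (X n - z)) \<le> \<bar>U z\<bar> * (4 * r\<^sup>2 * r)" for n
        using norm_bump_grad_le[OF r] by (intro AE_I2) (auto intro!: mult_left_mono)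
    qed (use U in auto)
  qed
qed

section \<open>Supersolutions and their smooth approximation\<close>

definition pq_flux :: "real \<Rightarrow> real \<Rightarrow> 'a::euclidean_space \<Rightarrow> 'a" where
  "pq_flux p q v = laplace_flux p v + laplace_flux q v"

lemma norm_laplace_flux: "norm (laplace_flux r v) = norm v powr (r - 1)"
  using powr_mult_base[OF norm_ge_zero, of v "r - 2"] by (simp add: laplace_flux_def mult.commute)

text \<open>
  By the Cauchy-Schwarz inequality the product is at least
  \<open>(|a|\<^bsup>r-1\<^esup> - |b|\<^bsup>r-1\<^esup>) (|a| - |b|)\<close>, whose factors have the same sign.
\<close>

lemma laplace_flux_monotone:
  assumes "1 < r"
  shows "0 \<le> (laplace_flux r a - laplace_flux r b) \<bullet> (a - b)"
proof -
  define A B where "A = norm a" and "B = norm b"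
  have AB: "0 \<le> A" "0 \<le> B" by (simp_all add: A_def B_def)
  have e: "x powr (r - 2) * (x * x) = x powr (r - 1) * x" "x powr (r - 2) * x = x powr (r - 1)"
    if "0 \<le> x" for x :: real
    using powr_mult_base[OF that, of "r - 2"] by (simp_all add: mult_ac)
  have "(laplace_flux r a - laplace_flux r b) \<bullet> (a - b)
     = A powr (r - 2) * (A * A) + B powr (r - 2) * (B * B) - (A powr (r - 2) + B powr (r - 2)) * (a \<bullet> b)"
    by (simp add: laplace_flux_def A_def B_def algebra_simps dot_square_norm power2_eq_square inner_commute)
  also have "\<dots> \<ge> A powr (r - 2) * (A * A) + B powr (r - 2) * (B * B) - (A powr (r - 2) + B powr (r - 2)) * (A * B)"
    using Cauchy_Schwarz_ineq2[of a b] unfolding A_def B_def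
    by (intro diff_left_mono mult_left_mono) auto
  also have "A powr (r - 2) * (A * A) + B powr (r - 2) * (B * B) - (A powr (r - 2) + B powr (r - 2)) * (A * B)
     = (A powr (r - 1) - B powr (r - 1)) * (A - B)"
    using e[OF AB(1)] e[OF AB(2)] by (simp add: algebra_simps)
  finally have "(A powr (r - 1) - B powr (r - 1)) * (A - B) \<le> (laplace_flux r a - laplace_flux r b) \<bullet> (a - b)" .
  moreover have "0 \<le> (A powr (r - 1) - B powr (r - 1)) * (A - B)"
    using powr_mono2[of "r-1" A B] powr_mono2[of "r-1" B A] AB assms
    by (cases "A \<le> B") (auto intro: mult_nonneg_nonneg mult_nonpos_nonpos)
  ultimately show ?thesis by linarith
qed

lemma pq_flux_monotone:
  assumes "1 < p" "1 < q"
  shows "0 \<le> (pq_flux p q a - pq_flux p q b) \<bullet> (a - b)"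
  using laplace_flux_monotone[OF assms(1), of a b] laplace_flux_monotone[OF assms(2), of a b]
  by (simp add: pq_flux_def algebra_simps)

lemma norm_pq_flux_le:
  assumes "1 < q" "q < p"
  shows "norm (pq_flux p q v) \<le> 2 * (1 + norm v) powr (p - 1)"
proof -
  have "norm (pq_flux p q v) \<le> norm v powr (p - 1) + norm v powr (q - 1)"
    unfolding pq_flux_def by (rule norm_triangle_le) (simp add: norm_laplace_flux)
  also have "\<dots> \<le> (1 + norm v) powr (p - 1) + (1 + norm v) powr (q - 1)"
    using assms by (intro add_mono powr_mono2) auto
  also have "(1 + norm v) powr (q - 1) \<le> (1 + norm v) powr (p - 1)"
    using assms by (intro powr_mono) auto
  finally show ?thesis by simp
qed

lemma borel_measurable_pq_flux [measurable]: "pq_flux p q \<in> borel_measurable borel"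
  unfolding pq_flux_def laplace_flux_def by measurable

lemma C1_cI:
  assumes "\<And>x. GDERIV \<phi> x :> D x" "continuous_on UNIV D" "compact C" "C \<subseteq> \<Omega>" "\<And>x. x \<notin> C \<Longrightarrow> \<phi> x = 0"
  shows "\<phi> \<in> C1_c \<Omega>" and "grad \<phi> = D"
proof -
  show e: "grad \<phi> = D" using assms(1) by (intro ext grad_eq)
  have "closure {x. \<phi> x \<noteq> 0} \<subseteq> C"
    using assms(3,5) by (intro closure_minimal compact_imp_closed) auto
  moreover from this have "compact (closure {x. \<phi> x \<noteq> 0})"
    using assms(3) by (meson compact_closure compact_imp_bounded bounded_subset closure_subset order_trans)
  ultimately show "\<phi> \<in> C1_c \<Omega>"
    using assms(1,2,4) by (simp add: C1_c_def e)
qed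

lemma integrable_on_compact:
  fixes f :: "'a::euclidean_space \<Rightarrow> real"
  assumes K: "compact K" and f: "continuous_on K f"
  shows "integrable lborel (\<lambda>x. indicator K x * f x)"
  using borel_integrable_compact[OF K f] by (simp add: indicator_times_eq_if(1)[symmetric] mult.commute cong: if_cong)

lemma integrable_one_plus_norm_powr:
  fixes g :: "'a::euclidean_space \<Rightarrow> 'b::euclidean_space"
  assumes g [measurable]: "g \<in> borel_measurable borel" and K: "compact K" and p: "0 < p"
    and gp: "integrable lborel (\<lambda>x. indicator K x * norm (g x) powr p)"
  shows "integrable lborel (\<lambda>x. indicator K x * (1 + norm (g x)) powr p)"
proof (rule Bochner_Integration.integrable_bound)
  show "integrable lborel (\<lambda>x. indicator K x * 2 powr p + 2 powr p * (indicator K x * norm (g x) powr p))"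
    by (intro Bochner_Integration.integrable_add integrable_mult_right[OF gp] integrable_on_compact K) auto
  have "K \<in> sets borel" using K by (auto intro: borel_compact)
  then show "(\<lambda>x. indicator K x * (1 + norm (g x)) powr p) \<in> borel_measurable lborel" by simp
  show "AE x in lborel. norm (indicator K x * (1 + norm (g x)) powr p)
      \<le> norm (indicator K x * 2 powr p + 2 powr p * (indicator K x * norm (g x) powr p))"
  proof (rule AE_I2)
    fix x
    have "(1 + norm (g x)) powr p \<le> (2 * max 1 (norm (g x))) powr p"
      using p by (intro powr_mono2) auto
    also have "\<dots> = 2 powr p * max 1 (norm (g x)) powr p" by (rule powr_mult)
    also have "\<dots> \<le> 2 powr p * (1 + norm (g x) powr p)"
      by (intro mult_left_mono) (auto simp: max_def)
    finally show "norm (indicator K x * (1 + norm (g x)) powr p)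
      \<le> norm (indicator K x * 2 powr p + 2 powr p * (indicator K x * norm (g x) powr p))"
      by (cases "x \<in> K") (auto simp: algebra_simps)
  qed
qed

text \<open>
  The form in which solutions are studied: \<open>u\<close> is extended by zero, and \<open>g\<close> is a Borel measurable
  representative of its weak gradient. All integrals then run over the whole space with respect to
  \<open>lborel\<close>, where translations and Tonelli's theorem apply directly.
\<close>

locale pq_supersolution =
  fixes \<Omega> :: "'a::euclidean_space set" and p q s :: real and u :: "'a \<Rightarrow> real" and g :: "'a \<Rightarrow> 'a"
  assumes open_Omega: "open \<Omega>"
    and q_gt_1: "1 < q" and q_less_p: "q < p" and p_less_s: "p < s"
    and u_cont: "continuous_on \<Omega> u" and u_nonneg: "\<And>x. 0 \<le> u x" and u_outside: "\<And>x. x \<notin> \<Omega> \<Longrightarrow> u x = 0"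
    and g_meas [measurable]: "g \<in> borel_measurable borel"
    and g_powr: "\<And>K. compact K \<Longrightarrow> K \<subseteq> \<Omega> \<Longrightarrow> integrable lborel (\<lambda>x. indicator K x * norm (g x) powr p)"
    and weak_grad: "\<And>\<phi> i. \<phi> \<in> C1_c \<Omega> \<Longrightarrow> i \<in> Basis \<Longrightarrow>
       (\<integral>x. u x * (grad \<phi> x \<bullet> i) \<partial>lborel) = - (\<integral>x. (g x \<bullet> i) * \<phi> x \<partial>lborel)"
    and supersolution: "\<And>\<phi>. \<phi> \<in> C1_c \<Omega> \<Longrightarrow> (\<And>x. 0 \<le> \<phi> x) \<Longrightarrow>
       (\<integral>x. u x powr (s - 1) * \<phi> x \<partial>lborel) \<le> (\<integral>x. pq_flux p q (g x) \<bullet> grad \<phi> x \<partial>lborel)"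
begin

lemma u_meas [measurable]: "u \<in> borel_measurable borel"
proof -
  have "(\<lambda>x. if x \<in> \<Omega> then u x else 0) \<in> borel_measurable borel"
    using u_cont open_Omega by (intro borel_measurable_continuous_on_if) auto
  also have "(\<lambda>x. if x \<in> \<Omega> then u x else 0) = u" using u_outside by auto
  finally show ?thesis .
qed

lemma weight_integrable:
  assumes K: "compact K" "K \<subseteq> \<Omega>"
  shows "integrable lborel (\<lambda>x. indicator K x * (1 + norm (g x)) powr p)"
  using integrable_one_plus_norm_powr[OF g_meas K(1) _ g_powr[OF K]] q_gt_1 q_less_p by simp

text \<open>
  The function \<open>z \<mapsto> bump r (x - z)\<close> is itself a test function once its support lies in \<open>\<Omega>\<close>; inserting it
  into the definition of the weak gradient moves the derivative from the kernel to \<open>u\<close>.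
\<close>

lemma mollified_gradient:
  assumes r: "0 < r" and x: "cball x r \<subseteq> \<Omega>" and i: "i \<in> Basis"
  shows "(\<integral>z. u z * (bump_grad r (x - z) \<bullet> i) \<partial>lborel) = (\<integral>z. (g z \<bullet> i) * bump r (x - z) \<partial>lborel)"
proof -
  have D: "GDERIV (\<lambda>z. bump r (x - z)) z :> - bump_grad r (x - z)" for z
  proof -
    have "(bump r has_derivative (\<lambda>h. h \<bullet> bump_grad r (x - z))) (at (x - z))"
      using GDERIV_bump[of r "x - z"] r by (simp add: gderiv_def)
    moreover have "((\<lambda>z. x - z) has_derivative (\<lambda>h. - h)) (at z)" by (auto intro!: derivative_eq_intros)
    ultimately have "((\<lambda>z. bump r (x - z)) has_derivative (\<lambda>h. (- h) \<bullet> bump_grad r (x - z))) (at z)"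
      by (rule has_derivative_compose[rotated])
    then show ?thesis by (simp add: gderiv_def)
  qed
  have z0: "z \<notin> cball x r \<Longrightarrow> bump r (x - z) = 0" for z
    using r by (intro bump_eq_0) (auto simp: dist_norm)
  have "(\<lambda>z. bump r (x - z)) \<in> C1_c \<Omega>" and g: "grad (\<lambda>z. bump r (x - z)) = (\<lambda>z. - bump_grad r (x - z))"
    by (intro C1_cI[OF D _ compact_cball x z0] continuous_intros continuous_on_compose2[OF continuous_on_bump_grad[of UNIV]]; simp)+
  then have "(\<integral>z. u z * (- bump_grad r (x - z) \<bullet> i) \<partial>lborel) = - (\<integral>z. (g z \<bullet> i) * bump r (x - z) \<partial>lborel)"
    using weak_grad[OF _ i] by metis
  then show ?thesis by simp
qed

text \<open>
  A test function built from \<open>u\<close> must be \<open>C\<^sup>1\<close>, so \<open>u\<close> is replaced by its convolution \<open>w\<close> with a bump.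
  The error that matters is that of the gradient, weighted with the bound \<open>(1 + |g|)\<^bsup>p-1\<^esup>\<close> for the
  flux. At \<open>x\<close> it is at most an average over small \<open>y\<close> of \<open>|g(x - y) - g(x)|\<close>; by Tonelli's theorem
  its weighted integral is an average of integrals that are small by continuity of translations.
\<close>

lemma C1_approximation:
  assumes K: "compact K" "K \<subseteq> \<Omega>" and e: "e > 0"
  obtains w w' where "\<And>x. GDERIV w x :> w' x" "continuous_on UNIV w'"
    "\<And>x. x \<in> K \<Longrightarrow> \<bar>w x - u x\<bar> < e"
    "integrable lborel (\<lambda>x. indicator K x * ((1 + norm (g x)) powr (p - 1) * norm (w' x - g x)))"
    "(\<integral>x. indicator K x * ((1 + norm (g x)) powr (p - 1) * norm (w' x - g x)) \<partial>lborel) < e"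
proof -
  obtain d where d: "d > 0" "(\<Union>x\<in>K. cball x d) \<subseteq> \<Omega>"
    using compact_subset_open_imp_cball_epsilon_subset[OF K(1) open_Omega K(2)] by blast
  define K2 where "K2 = {x + y | x y. x \<in> K \<and> y \<in> cball 0 d}"
  have K2c: "compact K2" unfolding K2_def using K by (intro compact_sums) auto
  have K2I: "z \<in> K2" if "x \<in> K" "norm (z - x) \<le> d" for x z
    unfolding K2_def using that by (intro CollectI exI[of _ x] exI[of _ "z - x"]) auto
  have K2s: "K2 \<subseteq> \<Omega>" using d(2) unfolding K2_def by (force simp: dist_norm)
  have Kb [measurable]: "K \<in> sets borel" "K2 \<in> sets borel" using K(1) K2c by (auto intro: borel_compact)
  have KK2: "K \<subseteq> K2" using K2I[of x x for x] d by auto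
  define gK where "gK x = indicator K2 x *\<^sub>R g x" for x
  define U where "U x = indicator K2 x * u x" for x
  define X where "X x = indicator K x * (1 + norm (g x))" for x
  have [measurable]: "gK \<in> borel_measurable borel" "X \<in> borel_measurable borel" "U \<in> borel_measurable borel"
    unfolding gK_def X_def U_def by measurable
  have Uint: "integrable lborel U"
    unfolding U_def using K2c K2s u_cont by (intro integrable_on_compact) (auto intro: continuous_on_subset)
  have gKint: "integrable lborel (\<lambda>x. norm (gK x) powr p)"
    by (rule Bochner_Integration.integrable_cong[OF refl, THEN iffD1, OF _ g_powr[OF K2c K2s]])
       (auto simp: gK_def indicator_def)
  have Xint: "integrable lborel (\<lambda>x. X x powr p)"
    by (rule Bochner_Integration.integrable_cong[OF refl, THEN iffD1, OF _ weight_integrable[OF K]])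
       (auto simp: X_def indicator_def)
  have p1: "1 \<le> p" using q_gt_1 q_less_p by simp
  have gK1: "integrable lborel gK"
  proof (rule Bochner_Integration.integrable_bound[OF weight_integrable[OF K2c K2s]])
    show "AE x in lborel. norm (gK x) \<le> norm (indicator K2 x * (1 + norm (g x)) powr p)"
    proof (rule AE_I2)
      fix x
      have "norm (g x) \<le> (1 + norm (g x)) powr 1" by simp
      also have "\<dots> \<le> (1 + norm (g x)) powr p" using p1 by (intro powr_mono) auto
      finally show "norm (gK x) \<le> norm (indicator K2 x * (1 + norm (g x)) powr p)"
        by (auto simp: gK_def indicator_def)
    qed
  qed simp
  obtain r1 where r1: "r1 > 0" "\<And>y. norm y < r1 \<Longrightarrow>
      (\<integral>\<^sup>+x. X x powr (p - 1) * norm (gK (x - y) - gK x) \<partial>lborel) < ennreal (e/2)"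
    using Lp_weighted_translation_continuous[OF _ gKint _ _ Xint p1, of "e/2"] e
    by (auto simp: X_def)
  have "uniformly_continuous_on K2 u"
    using K2c K2s u_cont by (intro compact_uniformly_continuous) (auto intro: continuous_on_subset)
  then obtain r2 where r2: "r2 > 0" "\<And>x z. x \<in> K2 \<Longrightarrow> z \<in> K2 \<Longrightarrow> dist z x < r2 \<Longrightarrow> dist (u z) (u x) < e/2"
    unfolding uniformly_continuous_on_def using e by (metis half_gt_zero)
  define r where "r = min d (min r1 r2)"
  have r: "r > 0" "r \<le> d" "r \<le> r1" "r \<le> r2" using d r1 r2 by (auto simp: r_def)
  define c where "c = (\<integral>y. bump r y \<partial>(lborel :: 'a measure))"
  have c: "c > 0" unfolding c_def by (rule integral_bump_pos[OF r(1)])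
  have bint: "integrable lborel (bump r :: 'a \<Rightarrow> real)" using r by (intro integrable_bump) auto
  define w where "w x = (1 / c) * (\<integral>z. U z * bump r (x - z) \<partial>lborel)" for x
  define w' where "w' x = (1 / c) *\<^sub>R (\<integral>z. U z *\<^sub>R bump_grad r (x - z) \<partial>lborel)" for x
  have Dw: "GDERIV w x :> w' x" for x
    unfolding w_def w'_def using GDERIV_mult[OF GDERIV_const[of "1/c"] GDERIV_convolution_bump[OF Uint, of r x]] r by simp
  have Cw: "continuous_on UNIV w'"
    unfolding w'_def using Uint r by (intro continuous_intros continuous_convolution_bump_grad) auto
  have [measurable]: "w' \<in> borel_measurable borel" using Cw by (rule borel_measurable_continuous_onI)
  have close: "\<bar>w x - u x\<bar> < e" if x: "x \<in> K" for x
  proof -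
    have i1: "integrable lborel (\<lambda>y. U (x - y) * bump r y)"
    proof -
      obtain B where B: "\<And>z. z \<in> K2 \<Longrightarrow> \<bar>u z\<bar> \<le> B"
        using compact_imp_bounded[OF compact_continuous_image[OF continuous_on_subset[OF u_cont K2s] K2c]]
        by (auto simp: bounded_iff)
      have "integrable lborel (\<lambda>z. bump r z *\<^sub>R U (x - z))"
      proof (rule Bochner_Integration.integrable_bound)
        show "integrable lborel (\<lambda>z::'a. bump r z * \<bar>B\<bar>)" using bint by simp
        show "AE z in lborel. norm (bump r z *\<^sub>R U (x - z)) \<le> norm (bump r z * \<bar>B\<bar>)"
        proof (rule AE_I2)
          fix z
          have "\<bar>U (x - z)\<bar> \<le> \<bar>B\<bar>" using B[of "x - z"] by (auto simp: U_def indicator_def)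
          then show "norm (bump r z *\<^sub>R U (x - z)) \<le> norm (bump r z * \<bar>B\<bar>)"
            by (auto simp: abs_mult bump_nonneg intro!: mult_left_mono)
        qed
      qed simp
      then show ?thesis by (simp add: mult.commute)
    qed
    have "(\<integral>z. U z * bump r (x - z) \<partial>lborel) = (\<integral>y. U (x - y) * bump r y \<partial>lborel)"
      using integral_lborel_reflect[of "\<lambda>y. U (x - y) * bump r y" x] by simp
    then have "w x - u x = (1 / c) * (\<integral>y. (U (x - y) - u x) * bump r y \<partial>lborel)"
      using i1 bint c by (simp add: w_def algebra_simps c_def[symmetric])
    also have "\<bar>\<dots>\<bar> \<le> (1 / c) * (\<integral>y. e / 2 * bump r y \<partial>(lborel :: 'a measure))"
    proof -
      have "\<bar>\<integral>y. (U (x - y) - u x) * bump r y \<partial>lborel\<bar> \<le> (\<integral>y. e / 2 * bump r y \<partial>(lborel :: 'a measure))"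
      proof (rule order_trans[OF integral_abs_bound], rule integral_mono')
        fix y :: 'a
        show "\<bar>(U (x - y) - u x) * bump r y\<bar> \<le> e / 2 * bump r y"
        proof (cases "norm y < r")
          case True
          then have "x - y \<in> K2" "x \<in> K2" using K2I[OF x, of "x - y"] K2I[OF x, of x] r d by auto
          then have "\<bar>U (x - y) - u x\<bar> \<le> e / 2"
            using r2(2)[of x "x - y"] True r by (auto simp: U_def dist_norm)
          then show ?thesis
            using mult_right_mono[OF \<open>\<bar>U (x - y) - u x\<bar> \<le> e / 2\<close> bump_nonneg[of r y]]
            by (simp only: abs_mult abs_of_nonneg[OF bump_nonneg])
        next
          case False then show ?thesis using r by (simp add: bump_eq_0)
        qed
      qed (use bint e in \<open>auto simp: bump_nonneg\<close>)
      from mult_left_mono[OF this, of "1 / c"] show ?thesis using c by (simp add: abs_mult)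
    qed
    also have "\<dots> = e / 2" using c by (simp add: c_def[symmetric])
    finally show ?thesis using e by simp
  qed
  have diff: "w' x - gK x = (1 / c) *\<^sub>R (\<integral>y. bump r y *\<^sub>R (gK (x - y) - gK x) \<partial>lborel)"
    and diffi: "integrable lborel (\<lambda>y. bump r y *\<^sub>R (gK (x - y) - gK x))" if x: "x \<in> K" for x
  proof -
    have b4: "\<bar>bump r y\<bar> \<le> r ^ 4" for y :: 'a using bump_le[of r y] bump_nonneg[of r y] by simp
    have i1: "integrable lborel (\<lambda>y. bump r y *\<^sub>R gK (x - y))"
    proof -
      have "integrable lborel (\<lambda>y. gK (x - y))" by (rule integrable_lborel_reflect[OF gK1])
      then have "integrable lborel (\<lambda>y. r ^ 4 *\<^sub>R gK (x - y))" by simp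
      then show ?thesis
      proof (rule Bochner_Integration.integrable_bound)
        show "AE y in lborel. norm (bump r y *\<^sub>R gK (x - y)) \<le> norm (r ^ 4 *\<^sub>R gK (x - y))"
        proof (rule AE_I2)
          fix y
          show "norm (bump r y *\<^sub>R gK (x - y)) \<le> norm (r ^ 4 *\<^sub>R gK (x - y))"
            using mult_right_mono[OF b4[of y] norm_ge_zero[of "gK (x - y)"]] by simp
        qed
      qed simp
    qed
    have i2: "integrable lborel (\<lambda>y::'a. bump r y *\<^sub>R gK x)" using bint by simp
    show "integrable lborel (\<lambda>y. bump r y *\<^sub>R (gK (x - y) - gK x))"
      using i1 i2 by (simp add: scaleR_diff_right)
    have cb: "cball x r \<subseteq> \<Omega>" "cball x r \<subseteq> K2"
      using d(2) x r K2I[OF x] by (force simp: dist_norm norm_minus_commute)+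
    have iU: "integrable lborel (\<lambda>z. U z *\<^sub>R bump_grad r (x - z))"
      using r by (intro integrable_mult_bounded[OF Uint _ norm_bump_grad_le]) auto
    have "(\<integral>z. U z *\<^sub>R bump_grad r (x - z) \<partial>lborel) = (\<integral>y. bump r y *\<^sub>R gK (x - y) \<partial>lborel)"
    proof (rule euclidean_eqI)
      fix i :: 'a assume i: "i \<in> Basis"
      have "(\<integral>z. U z *\<^sub>R bump_grad r (x - z) \<partial>lborel) \<bullet> i = (\<integral>z. U z * (bump_grad r (x - z) \<bullet> i) \<partial>lborel)"
        using integral_inner_left[of i lborel "\<lambda>z. U z *\<^sub>R bump_grad r (x - z)"] iU by simp
      also have "\<dots> = (\<integral>z. u z * (bump_grad r (x - z) \<bullet> i) \<partial>lborel)"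
      proof (intro Bochner_Integration.integral_cong refl)
        fix z show "U z * (bump_grad r (x - z) \<bullet> i) = u z * (bump_grad r (x - z) \<bullet> i)"
          using cb(2) bump_grad_eq_0[of r "x - z"] r by (cases "z \<in> cball x r") (auto simp: U_def indicator_def dist_norm)
      qed
      also have "\<dots> = (\<integral>z. (g z \<bullet> i) * bump r (x - z) \<partial>lborel)"
        by (rule mollified_gradient[OF r(1) cb(1) i])
      also have "\<dots> = (\<integral>z. (gK z \<bullet> i) * bump r (x - z) \<partial>lborel)"
      proof (intro Bochner_Integration.integral_cong refl)
        fix z show "(g z \<bullet> i) * bump r (x - z) = (gK z \<bullet> i) * bump r (x - z)"
          using cb(2) bump_eq_0[of r "x - z"] r by (cases "z \<in> cball x r") (auto simp: gK_def indicator_def dist_norm)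
      qed
      also have "\<dots> = (\<integral>y. (bump r y *\<^sub>R gK (x - y)) \<bullet> i \<partial>lborel)"
        using integral_lborel_reflect[of "\<lambda>y. (gK (x - y) \<bullet> i) * bump r y" x] by (simp add: mult.commute)
      also have "\<dots> = (\<integral>y. bump r y *\<^sub>R gK (x - y) \<partial>lborel) \<bullet> i"
        using i1 by (intro integral_inner_left)
      finally show "(\<integral>z. U z *\<^sub>R bump_grad r (x - z) \<partial>lborel) \<bullet> i = (\<integral>y. bump r y *\<^sub>R gK (x - y) \<partial>lborel) \<bullet> i" .
    qed
    then show "w' x - gK x = (1 / c) *\<^sub>R (\<integral>y. bump r y *\<^sub>R (gK (x - y) - gK x) \<partial>lborel)"
      using i1 i2 c bint by (simp add: scaleR_diff_right w'_def c_def[symmetric])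
  qed
  have nn: "(\<integral>\<^sup>+x. indicator K x * ((1 + norm (g x)) powr (p - 1) * norm (w' x - g x)) \<partial>lborel) \<le> ennreal (e/2)"
  proof -
    have "(\<integral>\<^sup>+x. indicator K x * ((1 + norm (g x)) powr (p - 1) * norm (w' x - g x)) \<partial>lborel)
       \<le> (\<integral>\<^sup>+x. (\<integral>\<^sup>+y. ennreal (X x powr (p - 1) * (1 / c) * norm (gK (x - y) - gK x) * bump r y) \<partial>lborel) \<partial>lborel)"
    proof (rule nn_integral_mono)
      fix x
      show "ennreal (indicator K x * ((1 + norm (g x)) powr (p - 1) * norm (w' x - g x)))
        \<le> (\<integral>\<^sup>+y. ennreal (X x powr (p - 1) * (1 / c) * norm (gK (x - y) - gK x) * bump r y) \<partial>lborel)"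
      proof (cases "x \<in> K")
        case False then show ?thesis by simp
      next
        case x: True
        then have gg: "gK x = g x" using KK2 by (auto simp: gK_def)
        have "ennreal (norm (w' x - g x)) \<le> ennreal (1 / c) * (\<integral>\<^sup>+y. norm (bump r y *\<^sub>R (gK (x - y) - gK x)) \<partial>lborel)"
        proof -
          have "norm (w' x - g x) = 1 / c * norm (\<integral>y. bump r y *\<^sub>R (gK (x - y) - gK x) \<partial>lborel)"
            using diff[OF x] c gg by simp
          then show ?thesis
            using integral_norm_bound_ennreal[OF diffi[OF x]] c by (simp add: ennreal_mult mult_left_mono del: times_divide_eq_left)
        qed
        then have "ennreal (X x powr (p - 1)) * ennreal (norm (w' x - g x))
          \<le> ennreal (X x powr (p - 1)) * (ennreal (1 / c) * (\<integral>\<^sup>+y. norm (bump r y *\<^sub>R (gK (x - y) - gK x)) \<partial>lborel))"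
          by (intro mult_left_mono) auto
        also have "\<dots> = (\<integral>\<^sup>+y. ennreal (X x powr (p - 1)) * (ennreal (1 / c) * norm (bump r y *\<^sub>R (gK (x - y) - gK x))) \<partial>lborel)"
          by (simp add: nn_integral_cmult)
        also have "\<dots> = (\<integral>\<^sup>+y. ennreal (X x powr (p - 1) * (1 / c) * norm (gK (x - y) - gK x) * bump r y) \<partial>lborel)"
          using c by (intro nn_integral_cong) (simp add: ennreal_mult[symmetric] bump_nonneg mult_ac)
        finally show ?thesis using x by (simp add: X_def ennreal_mult)
      qed
    qed
    also have "\<dots> = (\<integral>\<^sup>+y. (\<integral>\<^sup>+x. ennreal (X x powr (p - 1) * (1 / c) * norm (gK (x - y) - gK x) * bump r y) \<partial>lborel) \<partial>lborel)"
      by (rule lborel_pair.Fubini'[symmetric]) simp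
    also have "\<dots> \<le> (\<integral>\<^sup>+y. ennreal (1 / c * bump r y) * ennreal (e/2) \<partial>(lborel :: 'a measure))"
    proof (rule nn_integral_mono)
      fix y :: 'a
      have "(\<integral>\<^sup>+x. ennreal (X x powr (p - 1) * (1 / c) * norm (gK (x - y) - gK x) * bump r y) \<partial>lborel)
        = (\<integral>\<^sup>+x. ennreal (1 / c * bump r y) * ennreal (X x powr (p - 1) * norm (gK (x - y) - gK x)) \<partial>lborel)"
        using c by (intro nn_integral_cong) (simp add: ennreal_mult[symmetric] bump_nonneg mult_ac)
      also have "\<dots> = ennreal (1 / c * bump r y) * (\<integral>\<^sup>+x. ennreal (X x powr (p - 1) * norm (gK (x - y) - gK x)) \<partial>lborel)"
        by (simp add: nn_integral_cmult)
      also have "\<dots> \<le> ennreal (1 / c * bump r y) * ennreal (e/2)"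
      proof (cases "norm y < r")
        case True then show ?thesis using r1(2)[of y] r by (intro mult_left_mono) auto
      next
        case False then show ?thesis using r by (simp add: bump_eq_0)
      qed
      finally show "(\<integral>\<^sup>+x. ennreal (X x powr (p - 1) * (1 / c) * norm (gK (x - y) - gK x) * bump r y) \<partial>lborel)
         \<le> ennreal (1 / c * bump r y) * ennreal (e/2)" .
    qed
    also have "\<dots> = (\<integral>\<^sup>+y. ennreal (1 / c * bump r y) \<partial>(lborel :: 'a measure)) * ennreal (e/2)"
      by (simp add: nn_integral_multc)
    also have "(\<integral>\<^sup>+y. ennreal (1 / c * bump r y) \<partial>(lborel :: 'a measure)) = ennreal (\<integral>y. 1 / c * bump r y \<partial>(lborel :: 'a measure))"
      using bint c by (intro nn_integral_eq_integral) (auto simp: bump_nonneg)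
    also have "(\<integral>y. 1 / c * bump r y \<partial>(lborel :: 'a measure)) = 1" using c by (simp add: c_def[symmetric])
    finally show ?thesis by simp
  qed
  show thesis
  proof (rule that[OF Dw Cw close])
    show int: "integrable lborel (\<lambda>x. indicator K x * ((1 + norm (g x)) powr (p - 1) * norm (w' x - g x)))"
      using nn by (intro integrableI_nonneg) (auto intro: le_less_trans)
    have "(\<integral>x. indicator K x * ((1 + norm (g x)) powr (p - 1) * norm (w' x - g x)) \<partial>lborel) \<le> e / 2"
      using nn nn_integral_eq_integral[OF int] e by auto
    then show "(\<integral>x. indicator K x * ((1 + norm (g x)) powr (p - 1) * norm (w' x - g x)) \<partial>lborel) < e" using e by simp
  qed
qed

end

section \<open>Integration by parts and comparison\<close>

lemma continuous_on_extend_zero: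
  fixes f :: "'a::euclidean_space \<Rightarrow> 'b::real_normed_vector"
  assumes "open D" "continuous_on D f" "closed C" "C \<subseteq> D" "\<And>x. x \<notin> C \<Longrightarrow> f x = 0"
  shows "continuous_on UNIV f"
proof -
  have "continuous_on (- C) f" using assms(5) by (subst continuous_on_cong[OF refl, of _ _ "\<lambda>_. 0"]) auto
  then have "continuous_on (D \<union> - C) f" using assms by (intro continuous_on_open_Un) auto
  moreover have "D \<union> - C = UNIV" using assms by auto
  ultimately show ?thesis by simp
qed

lemma integrable_compact_support:
  fixes f :: "'a::euclidean_space \<Rightarrow> 'b::{banach,second_countable_topology}"
  assumes "open D" "continuous_on D f" "compact C" "C \<subseteq> D" "\<And>x. x \<notin> C \<Longrightarrow> f x = 0"
  shows "integrable lborel f"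
proof -
  have "integrable lborel (\<lambda>x. indicator C x *\<^sub>R f x)"
    using assms by (intro borel_integrable_compact) (auto intro: continuous_on_subset)
  also have "(\<lambda>x. indicator C x *\<^sub>R f x) = f" using assms(5) by (auto simp: indicator_def)
  finally show ?thesis .
qed

lemma GDERIV_zero_outside:
  assumes "GDERIV f x :> D" "open S" "x \<in> S" "\<And>y. y \<in> S \<Longrightarrow> f y = 0"
  shows "D = 0"
proof -
  have "(f has_derivative (\<lambda>h. 0)) (at x)"
    by (rule has_derivative_transform_within_open[OF has_derivative_const assms(2,3)]) (simp add: assms(4))
  then have "(\<lambda>h. h \<bullet> D) = (\<lambda>h. 0)"
    using assms(1) unfolding gderiv_def by (rule has_derivative_unique[rotated])
  then have "D \<bullet> D = 0" by metis
  then show ?thesis by simp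
qed

text \<open>
  The difference quotients in direction \<open>i\<close> have integral zero by translation invariance. They are
  bounded by a Lipschitz constant and live in a fixed ball, so dominated convergence applies.
\<close>

lemma integral_gradient_compact_support:
  fixes \<psi> :: "'a::euclidean_space \<Rightarrow> real"
  assumes D: "\<And>x. GDERIV \<psi> x :> D x" and cD: "continuous_on UNIV D"
    and K: "compact K" and z: "\<And>x. x \<notin> K \<Longrightarrow> \<psi> x = 0"
  shows "(\<integral>x. D x \<bullet> i \<partial>lborel) = 0"
proof -
  have Dz: "D x = 0" if "x \<notin> K" for x
    by (rule GDERIV_zero_outside[OF D, of "- K"]) (use that z K compact_imp_closed in auto)
  have "bounded (D ` K)" using K cD by (intro compact_imp_bounded compact_continuous_image) (auto intro: continuous_on_subset)
  then obtain M0 where M0: "\<And>x. x \<in> K \<Longrightarrow> norm (D x) \<le> M0" by (auto simp: bounded_iff)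
  define M where "M = \<bar>M0\<bar>"
  have M: "norm (D x) \<le> M" for x using M0[of x] Dz[of x] by (cases "x \<in> K") (auto simp: M_def)
  have lip: "\<bar>\<psi> y - \<psi> x\<bar> \<le> M * norm (y - x)" for x y
  proof -
    have "norm (\<psi> y - \<psi> x) \<le> M * norm (y - x)"
    proof (rule differentiable_bound[of UNIV])
      show "(\<psi> has_derivative (\<lambda>h. h \<bullet> D x)) (at x within UNIV)" for x using D[of x] by (simp add: gderiv_def)
      show "onorm (\<lambda>h. h \<bullet> D x) \<le> M" for x
      proof (rule onorm_bound)
        show "0 \<le> M" by (simp add: M_def)
        show "norm (h \<bullet> D x) \<le> M * norm h" for h
          using Cauchy_Schwarz_ineq2[of h "D x"] mult_left_mono[OF M[of x] norm_ge_zero[of h]] by (simp add: mult.commute)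
      qed
    qed auto
    then show ?thesis by simp
  qed
  obtain R where R: "\<And>x. x \<in> K \<Longrightarrow> norm x \<le> R" using compact_imp_bounded[OF K] by (auto simp: bounded_iff)
  have c\<psi>: "continuous_on UNIV \<psi>"
    using D by (auto simp: gderiv_def continuous_on_eq_continuous_at intro: has_derivative_continuous)
  have [measurable]: "\<psi> \<in> borel_measurable borel" "D \<in> borel_measurable borel"
    using c\<psi> cD by (auto intro: borel_measurable_continuous_onI)
  have \<psi>i: "integrable lborel \<psi>"
    by (rule integrable_compact_support[of UNIV _ K]) (use c\<psi> K z in auto)
  define t where "t n = inverse (real (Suc n))" for n
  have t: "0 < t n" "t n \<le> 1" for n by (auto simp: t_def field_simps)
  define f where "f n x = (\<psi> (x - (- t n *\<^sub>R i)) - \<psi> x) / t n" for n x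
  have [measurable]: "f n \<in> borel_measurable borel" for n unfolding f_def by measurable
  have f0: "(\<integral>x. f n x \<partial>lborel) = 0" for n
    unfolding f_def using integrable_lborel_translate[OF \<psi>i, of "- t n *\<^sub>R i"] \<psi>i
      integral_lborel_translate[of \<psi> "- t n *\<^sub>R i"] by simp
  have "(\<lambda>n. \<integral>x. f n x \<partial>lborel) \<longlonglongrightarrow> (\<integral>x. D x \<bullet> i \<partial>lborel)"
  proof (rule integral_dominated_convergence[where w = "\<lambda>x. indicator (cball 0 (R + norm i)) x * (M * norm i)"])
    show "integrable lborel (\<lambda>x::'a. indicator (cball 0 (R + norm i)) x * (M * norm i))"
      using emeasure_bounded_finite[OF bounded_cball, of "0::'a" "R + norm i"]
      by (intro integrable_mult_left integrable_real_indicator) auto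
    show "AE x in lborel. (\<lambda>n. f n x) \<longlonglongrightarrow> D x \<bullet> i"
    proof (rule AE_I2)
      fix x
      have "((\<lambda>\<tau>. \<psi> (x + \<tau> *\<^sub>R i)) has_derivative (\<lambda>\<tau>. (\<tau> *\<^sub>R i) \<bullet> D x)) (at 0)"
      proof (rule has_derivative_compose[where f = "\<lambda>\<tau>. x + \<tau> *\<^sub>R i"])
        show "((\<lambda>\<tau>. x + \<tau> *\<^sub>R i) has_derivative (\<lambda>\<tau>. \<tau> *\<^sub>R i)) (at 0)" by (auto intro!: derivative_eq_intros)
        show "(\<psi> has_derivative (\<lambda>h. h \<bullet> D x)) (at (x + 0 *\<^sub>R i))" using D[of x] by (simp add: gderiv_def)
      qed
      then have "DERIV (\<lambda>\<tau>. \<psi> (x + \<tau> *\<^sub>R i)) 0 :> (D x \<bullet> i)"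
        unfolding has_field_derivative_def
        by (rule has_derivative_eq_rhs) (auto simp: inner_commute)
      then have lim: "(\<lambda>\<tau>. (\<psi> (x + \<tau> *\<^sub>R i) - \<psi> x) / \<tau>) \<midarrow>0\<rightarrow> D x \<bullet> i"
        by (simp add: DERIV_def)
      have "filterlim t (at 0) sequentially"
      proof -
        have "t \<longlonglongrightarrow> 0" unfolding t_def by (rule LIMSEQ_inverse_real_of_nat)
        then show ?thesis unfolding filterlim_at using order_less_imp_not_eq2[OF t(1)] by simp
      qed
      then have "(\<lambda>n. (\<psi> (x + t n *\<^sub>R i) - \<psi> x) / t n) \<longlonglongrightarrow> D x \<bullet> i"
        by (rule filterlim_compose[OF lim])
      then show "(\<lambda>n. f n x) \<longlonglongrightarrow> D x \<bullet> i" by (simp add: f_def)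
    qed
    show "AE x in lborel. norm (f n x) \<le> indicator (cball 0 (R + norm i)) x * (M * norm i)" for n
    proof (rule AE_I2)
      fix x
      show "norm (f n x) \<le> indicator (cball 0 (R + norm i)) x * (M * norm i)"
      proof (cases "norm x \<le> R + norm i")
        case True
        have "\<bar>\<psi> (x - (- t n *\<^sub>R i)) - \<psi> x\<bar> \<le> t n * (M * norm i)"
          using lip[of "x - (- t n *\<^sub>R i)" x] t[of n] by (simp add: mult_ac)
        then show ?thesis using True t[of n] by (simp add: f_def abs_divide field_simps)
      next
        case False
        have "norm (t n *\<^sub>R i) \<le> 1 * norm i" using t[of n] by (simp add: mult_left_le_one_le)
        then have "\<not> norm (x + t n *\<^sub>R i) \<le> R" using False norm_diff_ineq[of x "t n *\<^sub>R i"] by linarith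
        moreover have "\<not> norm x \<le> R" using False norm_ge_zero[of i] by linarith
        ultimately have "x + t n *\<^sub>R i \<notin> K" "x \<notin> K" using R by blast+
        then show ?thesis using False z by (simp add: f_def)
      qed
    qed
  qed simp_all
  then show ?thesis by (simp add: f0 LIMSEQ_const_iff)
qed

lemma C1_cD:
  assumes "\<phi> \<in> C1_c \<Omega>"
  obtains C where "compact C" "C \<subseteq> \<Omega>" "\<And>x. x \<notin> C \<Longrightarrow> \<phi> x = 0" "\<And>x. x \<notin> C \<Longrightarrow> grad \<phi> x = 0"
    "\<And>x. GDERIV \<phi> x :> grad \<phi> x" "continuous_on UNIV (grad \<phi>)" "continuous_on UNIV \<phi>"
proof (rule that[of "closure {x. \<phi> x \<noteq> 0}"])
  show D: "GDERIV \<phi> x :> grad \<phi> x" for x using assms by (auto simp: C1_c_def)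
  show z: "x \<notin> closure {x. \<phi> x \<noteq> 0} \<Longrightarrow> \<phi> x = 0" for x using closure_subset[of "{x. \<phi> x \<noteq> 0}"] by auto
  show "grad \<phi> x = 0" if "x \<notin> closure {x. \<phi> x \<noteq> 0}" for x
  proof (rule GDERIV_zero_outside[OF D])
    show "open (- closure {x. \<phi> x \<noteq> 0})" by (rule open_Compl[OF closed_closure])
    show "x \<in> - closure {x. \<phi> x \<noteq> 0}" using that unfolding Compl_iff .
    show "\<phi> y = 0" if "y \<in> - closure {x. \<phi> x \<noteq> 0}" for y using that z unfolding Compl_iff by blast
  qed
  show "continuous_on UNIV \<phi>"
    using D by (auto simp: gderiv_def continuous_on_eq_continuous_at intro: has_derivative_continuous)
qed (use assms in \<open>auto simp: C1_c_def\<close>)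

lemma GDERIV_inner_left: "GDERIV (\<lambda>x. (x - c) \<bullet> i) x :> i"
  unfolding gderiv_def by (auto intro!: derivative_eq_intros)

lemma GDERIV_norm_sq: "GDERIV (\<lambda>x. (norm (x - c))\<^sup>2) x :> 2 *\<^sub>R (x - c)"
  unfolding gderiv_def power2_norm_eq_inner by (auto intro!: derivative_eq_intros simp: inner_commute)

text \<open>
  The field \<open>W(|x - c|\<^sup>2) (x - c)\<close> has divergence \<open>N W(\<tau>) + 2 \<tau> W'(\<tau>)\<close> at \<open>\<tau> = |x - c|\<^sup>2\<close>, where \<open>N\<close> is the
  dimension. The identity follows by integrating the divergence of \<open>\<phi>\<close> times the field, one
  coordinate at a time. Differentiability of \<open>W\<close> is asked for at the values taken on \<open>D\<close>
  only, which permits a singularity at a centre outside \<open>D\<close>.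
\<close>

lemma radial_field_weak_divergence:
  fixes c :: "'a::euclidean_space" and W W' :: "real \<Rightarrow> real"
  assumes D: "open D" and \<phi>: "\<phi> \<in> C1_c D"
    and W: "\<And>x. x \<in> D \<Longrightarrow> (W has_real_derivative W' ((norm (x - c))\<^sup>2)) (at ((norm (x - c))\<^sup>2))"
    and W': "continuous_on D (\<lambda>x. W' ((norm (x - c))\<^sup>2))"
  shows "(\<integral>x. - (W ((norm (x - c))\<^sup>2) *\<^sub>R (x - c)) \<bullet> grad \<phi> x \<partial>lborel)
       = (\<integral>x. (DIM('a) * W ((norm (x - c))\<^sup>2) + 2 * (norm (x - c))\<^sup>2 * W' ((norm (x - c))\<^sup>2)) * \<phi> x \<partial>lborel)"
proof -
  obtain C where C: "compact C" "C \<subseteq> D" "\<And>x. x \<notin> C \<Longrightarrow> \<phi> x = 0" "\<And>x. x \<notin> C \<Longrightarrow> grad \<phi> x = 0"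
    "\<And>x. GDERIV \<phi> x :> grad \<phi> x" "continuous_on UNIV (grad \<phi>)" "continuous_on UNIV \<phi>"
    by (rule C1_cD[OF \<phi>]) (rule that)
  define T where "T x = (norm (x - c))\<^sup>2" for x
  have cC: "closed C" using C(1) by (rule compact_imp_closed)
  have cT: "continuous_on D T" unfolding T_def by (intro continuous_intros)
  have cW: "continuous_on D (\<lambda>x. W (T x))"
  proof (rule continuous_at_imp_continuous_on, rule ballI)
    fix x assume x: "x \<in> D"
    have "isCont W (T x)" using DERIV_isCont[OF W[OF x]] by (simp add: T_def)
    moreover have "isCont T x" unfolding T_def by (intro continuous_intros)
    ultimately show "isCont (\<lambda>x. W (T x)) x" by (rule isCont_o2[rotated])
  qed
  have cW': "continuous_on D (\<lambda>x. W' (T x))" using W' unfolding T_def .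
  have cg: "continuous_on D (grad \<phi>)" "continuous_on D \<phi>" using C(6,7) continuous_on_subset by blast+
  define G where "G i x = (W (T x) * ((x - c) \<bullet> i)) *\<^sub>R grad \<phi> x + \<phi> x *\<^sub>R (W (T x) *\<^sub>R i + ((x - c) \<bullet> i) *\<^sub>R (W' (T x) *\<^sub>R (2 *\<^sub>R (x - c))))" for i x
  have cG: "continuous_on D (G i)" for i
    unfolding G_def by (intro continuous_intros cW cW' cg)
  have zG: "x \<notin> C \<Longrightarrow> G i x = 0" for i x using C(3)[of x] C(4)[of x] by (simp add: G_def)
  have int0: "(\<integral>x. G i x \<bullet> i \<partial>lborel) = 0" for i
  proof (rule integral_gradient_compact_support[where \<psi> = "\<lambda>x. (W (T x) * ((x - c) \<bullet> i)) * \<phi> x" and K = C])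
    show "continuous_on UNIV (G i)"
      by (rule continuous_on_extend_zero[OF D cG cC C(2) zG])
    fix x
    show "GDERIV (\<lambda>x. (W (T x) * ((x - c) \<bullet> i)) * \<phi> x) x :> G i x"
    proof (cases "x \<in> D")
      case True
      have "GDERIV (\<lambda>x. W (T x)) x :> W' (T x) *\<^sub>R (2 *\<^sub>R (x - c))"
        unfolding T_def using GDERIV_DERIV_compose[OF GDERIV_norm_sq W[OF True]] .
      from GDERIV_mult[OF GDERIV_mult[OF this GDERIV_inner_left[of c i]] C(5)]
      show ?thesis by (simp add: G_def algebra_simps)
    next
      case False
      then have x: "x \<in> - C" using C by auto
      have "((\<lambda>x. (W (T x) * ((x - c) \<bullet> i)) * \<phi> x) has_derivative (\<lambda>h. 0)) (at x)"
        by (rule has_derivative_transform_within_open[OF has_derivative_const _ x]) (use cC C in auto)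
      then show ?thesis using x zG by (simp add: gderiv_def)
    qed
  qed (use C in auto)
  have intG: "integrable lborel (\<lambda>x. G i x \<bullet> i)" for i
    by (rule integrable_compact_support[OF D _ C(1,2)]) (use zG cG in \<open>auto intro!: continuous_intros\<close>)
  have i1: "integrable lborel (\<lambda>x. W (T x) *\<^sub>R (x - c) \<bullet> grad \<phi> x)"
    by (rule integrable_compact_support[OF D _ C(1,2)]) (use C(4) in \<open>auto intro!: continuous_intros cW cg\<close>)
  have i2: "integrable lborel (\<lambda>x. (DIM('a) * W (T x) + 2 * T x * W' (T x)) * \<phi> x)"
    by (rule integrable_compact_support[OF D _ C(1,2)]) (use C(3) in \<open>auto intro!: continuous_intros cW cW' cT cg\<close>)
  have sum: "(\<Sum>i\<in>Basis. G i x \<bullet> i) = W (T x) *\<^sub>R (x - c) \<bullet> grad \<phi> x + (DIM('a) * W (T x) + 2 * T x * W' (T x)) * \<phi> x" for x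
  proof -
    have e: "(\<Sum>i\<in>Basis. ((x - c) \<bullet> i) * (y \<bullet> i)) = (x - c) \<bullet> y" for y by (rule euclidean_inner[symmetric])
    have "(\<Sum>i\<in>Basis. G i x \<bullet> i) = (\<Sum>i\<in>Basis. W (T x) * (((x - c) \<bullet> i) * (grad \<phi> x \<bullet> i)) + \<phi> x * W (T x)
        + 2 * \<phi> x * W' (T x) * (((x - c) \<bullet> i) * ((x - c) \<bullet> i)))"
      by (rule sum.cong) (auto simp: G_def inner_add_left algebra_simps)
    also have "\<dots> = W (T x) * ((x - c) \<bullet> grad \<phi> x) + DIM('a) * (\<phi> x * W (T x)) + 2 * \<phi> x * W' (T x) * ((x - c) \<bullet> (x - c))"
      by (simp only: sum.distrib sum_distrib_left[symmetric] e sum_constant) (simp add: mult_ac)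
    also have "(x - c) \<bullet> (x - c) = T x" by (simp add: T_def power2_norm_eq_inner)
    finally show ?thesis by (simp add: algebra_simps)
  qed
  have "0 = (\<integral>x. (\<Sum>i\<in>Basis. G i x \<bullet> i) \<partial>lborel)"
    using intG int0 by (subst Bochner_Integration.integral_sum) auto
  also have "\<dots> = (\<integral>x. W (T x) *\<^sub>R (x - c) \<bullet> grad \<phi> x \<partial>lborel) + (\<integral>x. (DIM('a) * W (T x) + 2 * T x * W' (T x)) * \<phi> x \<partial>lborel)"
    unfolding sum using i1 i2 by (rule Bochner_Integration.integral_add)
  finally show ?thesis
    unfolding T_def[symmetric] inner_minus_left Bochner_Integration.integral_minus by linarith
qed

lemma DERIV_sq_pos_part: "DERIV (\<lambda>t. (max 0 t)\<^sup>2) t :> 2 * max 0 (t::real)"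
proof -
  have "GDERIV (\<lambda>t. (max 0 t)\<^sup>2) t :> 2 * max 0 t"
    by (rule GDERIV_quadratic_remainder[of 1 _ _ _ 1]) (use sq_pos_part_taylor[of t] in \<open>auto simp: mult.commute\<close>)
  then show ?thesis by simp
qed

context pq_supersolution
begin

text \<open>
  Suppose that \<open>v > u\<close> somewhere. For small \<open>\<delta>\<close> and a \<open>C\<^sup>1\<close> function \<open>w\<close> close to \<open>u\<close>, the squared positive
  part of \<open>v - \<delta> - w\<close> is a test function with compact support in \<open>D\<close>, because \<open>v \<le> u\<close> on the boundary.
  Testing both relations with it bounds the integral of \<open>(u\<^bsup>s-1\<^esup> - k) \<phi>\<close> by that of
  \<open>(A(g) - A(\<nabla>v)) \<bullet> \<nabla>\<phi>\<close>, \<open>A\<close> being the flux. With \<open>g\<close> in place of \<open>\<nabla>w\<close> the latter would be at most zero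
  by monotonicity, and the difference is controlled by the weighted error of \<open>C1_approximation\<close>.
  The strict inequality \<open>k < u\<^bsup>s-1\<^esup>\<close> bounds the former from below by a positive constant that does not
  depend on \<open>w\<close>.
\<close>

lemma comparison_principle:
  assumes D: "open D" "bounded D" "closure D \<subseteq> \<Omega>"
    and v: "continuous_on (closure D) v" "\<And>x. x \<in> D \<Longrightarrow> GDERIV v x :> v' x" "continuous_on D v'"
    and F: "\<And>x. x \<in> D \<Longrightarrow> pq_flux p q (v' x) = F x" "continuous_on D F" "\<And>x. x \<in> D \<Longrightarrow> norm (F x) \<le> B"
    and div: "\<And>\<phi>. \<phi> \<in> C1_c D \<Longrightarrow> (\<integral>x. F x \<bullet> grad \<phi> x \<partial>lborel) = (\<integral>x. k x * \<phi> x \<partial>lborel)"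
    and k: "continuous_on D k" "\<And>x. x \<in> D \<Longrightarrow> k x < u x powr (s - 1)"
    and bdry: "\<And>x. x \<in> frontier D \<Longrightarrow> v x \<le> u x"
    and x0: "x0 \<in> D"
  shows "v x0 \<le> u x0"
proof (rule ccontr)
  assume "\<not> v x0 \<le> u x0"
  define \<delta> where "\<delta> = (v x0 - u x0) / 4"
  have \<delta>: "\<delta> > 0" using \<open>\<not> v x0 \<le> u x0\<close> by (simp add: \<delta>_def)
  have DO: "D \<subseteq> \<Omega>" "D \<subseteq> closure D" using D closure_subset by auto
  have cD: "compact (closure D)" using D by (simp add: compact_closure)
  have uD: "continuous_on D u" and uD': "continuous_on (closure D) u"
    using u_cont DO D by (auto intro: continuous_on_subset)
  have vD: "continuous_on D v" using v(1) DO by (auto intro: continuous_on_subset)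
  have usD: "continuous_on D (\<lambda>x. u x powr (s - 1))"
    using uD u_nonneg q_gt_1 q_less_p p_less_s by (intro continuous_on_powr' continuous_intros) auto
  obtain \<rho> where \<rho>: "\<rho> > 0" "cball x0 \<rho> \<subseteq> D" "\<And>x. x \<in> cball x0 \<rho> \<Longrightarrow> v x - u x > 3 * \<delta>"
  proof -
    have "open {x \<in> D. v x - u x > 3 * \<delta>}"
      using continuous_open_preimage[OF continuous_on_diff[OF vD uD] D(1), of "{3 * \<delta><..}"]
      by (simp add: vimage_def Int_def)
    moreover have "x0 \<in> {x \<in> D. v x - u x > 3 * \<delta>}" using x0 \<delta> by (simp add: \<delta>_def)
    ultimately obtain \<rho> where "\<rho> > 0" "cball x0 \<rho> \<subseteq> {x \<in> D. v x - u x > 3 * \<delta>}"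
      by (meson open_contains_cball)
    then show thesis by (intro that[of \<rho>]) auto
  qed
  \<comment> \<open>a lower bound, up to the factor \<open>\<delta>\<^sup>2\<close>, for the tested source term that is independent of \<open>w\<close>\<close>
  define c0 where "c0 = (\<integral>x. indicator (cball x0 \<rho>) x * (u x powr (s - 1) - k x) \<partial>lborel)"
  have c0: "c0 > 0"
  proof -
    have c: "continuous_on (cball x0 \<rho>) (\<lambda>x. u x powr (s - 1) - k x)"
      using \<rho>(2) by (intro continuous_on_diff) (auto intro: continuous_on_subset usD k)
    have "cball x0 \<rho> \<noteq> {}" using \<rho>(1) by simp
    then obtain y where y: "y \<in> cball x0 \<rho>"
        "\<forall>x\<in>cball x0 \<rho>. u y powr (s - 1) - k y \<le> u x powr (s - 1) - k x"
      using continuous_attains_inf[OF compact_cball _ c] by blast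
    have "measure lborel (cball x0 \<rho>) * (u y powr (s - 1) - k y)
        = (\<integral>x. indicator (cball x0 \<rho>) x * (u y powr (s - 1) - k y) \<partial>lborel)"
      by simp
    also have "\<dots> \<le> c0"
      unfolding c0_def
      by (intro integral_mono integrable_on_compact c) (use y in \<open>auto simp: indicator_def\<close>)
    finally have "measure lborel (cball x0 \<rho>) * (u y powr (s - 1) - k y) \<le> c0" .
    moreover have "0 < measure lborel (cball x0 \<rho>) * (u y powr (s - 1) - k y)"
      using y(1) \<rho> k(2)[of y] by (intro mult_pos_pos) (auto simp: content_cball_pos)
    ultimately show ?thesis by linarith
  qed
  obtain B0 where B0: "\<And>x. x \<in> closure D \<Longrightarrow> \<bar>v x\<bar> \<le> B0"
    using compact_imp_bounded[OF compact_continuous_image[OF v(1) cD]] by (auto simp: bounded_iff)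
  have B0': "B0 \<ge> 0" using B0[of x0] x0 DO by force
  have B': "B \<ge> 0" using F(3)[OF x0] norm_ge_zero order_trans by blast
  define L where "L = 2 * B0 * (2 + B)"
  have L: "L \<ge> 0" using B0' B' by (simp add: L_def)
  define e where "e = min \<delta> (\<delta>\<^sup>2 * c0 / (L + 1))"
  have e: "e > 0" using \<delta> c0 L by (simp add: e_def)
  obtain w w' where w: "\<And>x. GDERIV w x :> w' x" "continuous_on UNIV w'"
    "\<And>x. x \<in> closure D \<Longrightarrow> \<bar>w x - u x\<bar> < e"
    "integrable lborel (\<lambda>x. indicator (closure D) x * ((1 + norm (g x)) powr (p - 1) * norm (w' x - g x)))"
    "(\<integral>x. indicator (closure D) x * ((1 + norm (g x)) powr (p - 1) * norm (w' x - g x)) \<partial>lborel) < e"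
    by (rule C1_approximation[OF cD D(3) e]) (rule that)
  have wc: "continuous_on S w" for S
    using w(1) by (meson continuous_at_imp_continuous_on gderiv_def has_derivative_continuous)
  have wu: "\<bar>w x - u x\<bar> < \<delta>" if "x \<in> closure D" for x using w(3)[OF that] by (simp add: e_def)
  define h where "h x = v x - \<delta> - w x" for x
  have hc: "continuous_on (closure D) h" "continuous_on D h"
    unfolding h_def by (intro continuous_intros v vD wc)+
  define S where "S = {x \<in> closure D. 0 \<le> h x}"
  have Sc: "compact S"
  proof -
    have "closed S"
      using continuous_closed_preimage[OF hc(1) closed_closure, of "{0..}"] by (simp add: S_def vimage_def Int_def)
    moreover have "bounded S" by (rule bounded_subset[OF compact_imp_bounded[OF cD]]) (auto simp: S_def)
    ultimately show ?thesis by (simp add: compact_eq_bounded_closed)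
  qed
  have SD: "S \<subseteq> D"
  proof
    fix x assume x: "x \<in> S"
    show "x \<in> D"
    proof (rule ccontr)
      assume "x \<notin> D"
      then have "x \<in> frontier D" using x D(1) by (auto simp: S_def frontier_def interior_open)
      then have "v x \<le> u x" by (rule bdry)
      then show False using x wu[of x] by (auto simp: S_def h_def)
    qed
  qed
  define \<phi> where "\<phi> x = (if x \<in> D then (max 0 (h x))\<^sup>2 else 0)" for x
  define \<phi>' where "\<phi>' x = (if x \<in> D then (2 * max 0 (h x)) *\<^sub>R (v' x - w' x) else 0)" for x
  have z: "x \<notin> S \<Longrightarrow> \<phi> x = 0" "x \<notin> S \<Longrightarrow> \<phi>' x = 0" for x
    using DO by (auto simp: \<phi>_def \<phi>'_def S_def)
  have D\<phi>: "GDERIV \<phi> x :> \<phi>' x" for x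
  proof (cases "x \<in> D")
    case True
    have "GDERIV h x :> v' x - w' x"
      unfolding h_def using GDERIV_diff[OF GDERIV_diff[OF v(2)[OF True] GDERIV_const] w(1)] by simp
    then have "GDERIV (\<lambda>x. (max 0 (h x))\<^sup>2) x :> (2 * max 0 (h x)) *\<^sub>R (v' x - w' x)"
      by (rule GDERIV_DERIV_compose[OF _ DERIV_sq_pos_part])
    then show ?thesis
      unfolding gderiv_def using True
      by (auto simp: \<phi>'_def \<phi>_def intro: has_derivative_transform_within_open[OF _ D(1) True])
  next
    case False
    then have x: "x \<in> - S" using SD by auto
    have "(\<phi> has_derivative (\<lambda>h. 0)) (at x)"
      by (rule has_derivative_transform_within_open[OF has_derivative_const _ x]) (use Sc compact_imp_closed z in auto)
    then show ?thesis using x z by (simp add: gderiv_def)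
  qed
  have c\<phi>: "continuous_on D \<phi>" "continuous_on D \<phi>'"
    unfolding \<phi>_def \<phi>'_def using v(3) continuous_on_subset[OF w(2) subset_UNIV]
    by (auto intro!: continuous_intros hc cong: continuous_on_cong)
  have C\<phi>': "continuous_on UNIV \<phi>'"
    by (rule continuous_on_extend_zero[OF D(1) c\<phi>(2) compact_imp_closed[OF Sc] SD z(2)])
  have \<phi>D: "\<phi> \<in> C1_c D" and \<phi>O: "\<phi> \<in> C1_c \<Omega>" and g\<phi>: "grad \<phi> = \<phi>'"
    using SD DO by (auto intro!: C1_cI[OF D\<phi> C\<phi>' Sc _ z(1)])
  have \<phi>0: "0 \<le> \<phi> x" for x by (simp add: \<phi>_def)
  have [measurable]: "\<phi>' \<in> borel_measurable borel" using C\<phi>' by (rule borel_measurable_continuous_onI)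
  have i1: "integrable lborel (\<lambda>x. u x powr (s - 1) * \<phi> x)"
    by (rule integrable_compact_support[OF D(1) _ Sc SD]) (use z in \<open>auto intro!: continuous_intros usD c\<phi>\<close>)
  have i2: "integrable lborel (\<lambda>x. k x * \<phi> x)"
    by (rule integrable_compact_support[OF D(1) _ Sc SD]) (use z in \<open>auto intro!: continuous_intros k c\<phi>\<close>)
  have i3: "integrable lborel (\<lambda>x. F x \<bullet> \<phi>' x)"
    by (rule integrable_compact_support[OF D(1) _ Sc SD]) (use z in \<open>auto intro!: continuous_intros F c\<phi>\<close>)
  have i4: "integrable lborel (\<lambda>x. pq_flux p q (g x) \<bullet> \<phi>' x)"
  proof -
    obtain M where M: "\<And>x. x \<in> S \<Longrightarrow> norm (\<phi>' x) \<le> M"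
      using compact_imp_bounded[OF compact_continuous_image[OF continuous_on_subset[OF C\<phi>' subset_UNIV] Sc]]
      by (auto simp: bounded_iff)
    show ?thesis
    proof (rule Bochner_Integration.integrable_bound)
      show "integrable lborel (\<lambda>x. 2 * \<bar>M\<bar> * (indicator (closure D) x * (1 + norm (g x)) powr p))"
        by (intro integrable_mult_right weight_integrable cD D)
      show "AE x in lborel. norm (pq_flux p q (g x) \<bullet> \<phi>' x) \<le> norm (2 * \<bar>M\<bar> * (indicator (closure D) x * (1 + norm (g x)) powr p))"
      proof (rule AE_I2)
        fix x
        show "norm (pq_flux p q (g x) \<bullet> \<phi>' x) \<le> norm (2 * \<bar>M\<bar> * (indicator (closure D) x * (1 + norm (g x)) powr p))"
        proof (cases "x \<in> S")
          case True
          have "norm (pq_flux p q (g x) \<bullet> \<phi>' x) \<le> norm (pq_flux p q (g x)) * norm (\<phi>' x)"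
            using Cauchy_Schwarz_ineq2 by simp
          also have "\<dots> \<le> (2 * (1 + norm (g x)) powr (p - 1)) * \<bar>M\<bar>"
            using M[OF True] by (intro mult_mono norm_pq_flux_le q_gt_1 q_less_p) auto
          also have "\<dots> \<le> (2 * (1 + norm (g x)) powr p) * \<bar>M\<bar>"
            by (intro mult_right_mono mult_left_mono powr_mono) auto
          finally show ?thesis using True SD DO by (auto simp: mult_ac)
        next
          case False then show ?thesis using z by simp
        qed
      qed
    qed simp
  qed
  have pt: "(pq_flux p q (g x) - F x) \<bullet> \<phi>' x
     \<le> L * (indicator (closure D) x * ((1 + norm (g x)) powr (p - 1) * norm (w' x - g x)))" for x
  proof (cases "x \<in> S")
    case False then show ?thesis using z L by simp
  next
    case x: True
    then have xD: "x \<in> D" "x \<in> closure D" using SD DO by auto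
    define H where "H = 2 * max 0 (h x)"
    have H: "0 \<le> H" "H \<le> 2 * B0"
      using x wu[OF xD(2)] B0[OF xD(2)] u_nonneg[of x] \<delta> by (auto simp: H_def S_def h_def)
    have X1: "(1 + norm (g x)) powr (p - 1) \<ge> 1"
      using q_gt_1 q_less_p by (intro ge_one_powr_ge_zero) auto
    have "(pq_flux p q (g x) - F x) \<bullet> \<phi>' x
       = - (H * ((pq_flux p q (g x) - pq_flux p q (v' x)) \<bullet> (g x - v' x))) + H * ((pq_flux p q (g x) - F x) \<bullet> (g x - w' x))"
      using xD F(1)[of x] by (simp add: \<phi>'_def H_def algebra_simps)
    also have "\<dots> \<le> H * ((pq_flux p q (g x) - F x) \<bullet> (g x - w' x))"
      using mult_nonneg_nonneg[OF H(1) pq_flux_monotone[of p q "g x" "v' x"]] q_gt_1 q_less_p by simp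
    also have "\<dots> \<le> H * (norm (pq_flux p q (g x) - F x) * norm (g x - w' x))"
      using H norm_cauchy_schwarz by (intro mult_left_mono) auto
    also have "\<dots> \<le> 2 * B0 * (((2 + B) * (1 + norm (g x)) powr (p - 1)) * norm (g x - w' x))"
    proof (intro mult_mono[OF H(2)] mult_right_mono)
      have "norm (pq_flux p q (g x) - F x) \<le> 2 * (1 + norm (g x)) powr (p - 1) + B * 1"
        using norm_pq_flux_le[OF q_gt_1 q_less_p, of "g x"] F(3)[OF xD(1)] norm_triangle_ineq4[of "pq_flux p q (g x)" "F x"] by linarith
      also have "\<dots> \<le> 2 * (1 + norm (g x)) powr (p - 1) + B * (1 + norm (g x)) powr (p - 1)"
        using X1 B' by (intro add_left_mono mult_left_mono) auto
      finally show "norm (pq_flux p q (g x) - F x) \<le> (2 + B) * (1 + norm (g x)) powr (p - 1)" by (simp add: algebra_simps)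
    qed (use B0' in auto)
    also have "\<dots> = L * (indicator (closure D) x * ((1 + norm (g x)) powr (p - 1) * norm (w' x - g x)))"
      using xD by (simp add: L_def norm_minus_commute[of "w' x"] algebra_simps)
    finally show ?thesis .
  qed
  have "\<delta>\<^sup>2 * c0 \<le> (\<integral>x. u x powr (s - 1) * \<phi> x \<partial>lborel) - (\<integral>x. k x * \<phi> x \<partial>lborel)"
  proof -
    have "\<delta>\<^sup>2 * c0 = (\<integral>x. \<delta>\<^sup>2 * (indicator (cball x0 \<rho>) x * (u x powr (s - 1) - k x)) \<partial>lborel)"
      by (simp add: c0_def)
    also have "\<dots> \<le> (\<integral>x. u x powr (s - 1) * \<phi> x - k x * \<phi> x \<partial>lborel)"
    proof (rule integral_mono)
      show "integrable lborel (\<lambda>x. \<delta>\<^sup>2 * (indicator (cball x0 \<rho>) x * (u x powr (s - 1) - k x)))"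
        using \<rho>(2) by (intro integrable_mult_right integrable_on_compact continuous_on_diff) (auto intro: continuous_on_subset usD k)
      show "integrable lborel (\<lambda>x. u x powr (s - 1) * \<phi> x - k x * \<phi> x)" using i1 i2 by simp
      fix x
      show "\<delta>\<^sup>2 * (indicator (cball x0 \<rho>) x * (u x powr (s - 1) - k x)) \<le> u x powr (s - 1) * \<phi> x - k x * \<phi> x"
      proof (cases "x \<in> cball x0 \<rho>")
        case True
        then have xD: "x \<in> D" using \<rho> by auto
        then have "\<delta> \<le> h x" using \<rho>(3)[OF True] wu[of x] DO by (auto simp: h_def)
        then have "\<delta>\<^sup>2 \<le> \<phi> x" using xD \<delta> by (auto simp: \<phi>_def intro!: power_mono)
        then have "\<delta>\<^sup>2 * (u x powr (s - 1) - k x) \<le> \<phi> x * (u x powr (s - 1) - k x)"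
          using k(2)[OF xD] by (intro mult_right_mono) auto
        then show ?thesis using True by (simp add: algebra_simps)
      next
        case False
        have "0 \<le> (u x powr (s - 1) - k x) * \<phi> x"
          using k(2)[of x] \<phi>0[of x] z(1)[of x] SD by (cases "x \<in> S") (auto intro!: mult_nonneg_nonneg)
        then show ?thesis using False by (simp add: algebra_simps)
      qed
    qed
    also have "\<dots> = (\<integral>x. u x powr (s - 1) * \<phi> x \<partial>lborel) - (\<integral>x. k x * \<phi> x \<partial>lborel)"
      using i1 i2 by (rule Bochner_Integration.integral_diff)
    finally show ?thesis .
  qed
  also have "\<dots> \<le> (\<integral>x. pq_flux p q (g x) \<bullet> \<phi>' x \<partial>lborel) - (\<integral>x. F x \<bullet> \<phi>' x \<partial>lborel)"
    using supersolution[OF \<phi>O \<phi>0] div[OF \<phi>D] by (simp add: g\<phi>)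
  also have "\<dots> = (\<integral>x. (pq_flux p q (g x) - F x) \<bullet> \<phi>' x \<partial>lborel)"
    using i3 i4 by (simp add: inner_diff_left)
  also have "\<dots> \<le> (\<integral>x. L * (indicator (closure D) x * ((1 + norm (g x)) powr (p - 1) * norm (w' x - g x))) \<partial>lborel)"
    using i3 i4 w(4) by (intro integral_mono pt) (auto simp: inner_diff_left)
  also have "\<dots> \<le> L * e" using w(5) L by (simp add: mult_left_mono)
  also have "\<dots> < (L + 1) * e" using e by simp
  also have "\<dots> \<le> (L + 1) * (\<delta>\<^sup>2 * c0 / (L + 1))" using L by (intro mult_left_mono) (auto simp: e_def)
  also have "\<dots> = \<delta>\<^sup>2 * c0" using L by simp
  finally show False by simp
qed

end

section \<open>Radial barriers\<close>

text \<open>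
  The size of the flux of a vector of length \<open>t\<close>. As an odd function it is a bijection of the real line, so
  that continuity of its inverse follows from monotonicity.
\<close>

definition pq_profile :: "real \<Rightarrow> real \<Rightarrow> real \<Rightarrow> real" where
  "pq_profile p q t = sgn t * (\<bar>t\<bar> powr (p - 1) + \<bar>t\<bar> powr (q - 1))"

definition pq_inverse :: "real \<Rightarrow> real \<Rightarrow> real \<Rightarrow> real" where
  "pq_inverse p q = inv (pq_profile p q)"

context
  fixes p q :: real
  assumes pq: "1 < q" "q < p"
begin

lemma pq_profile_strict_mono: "strict_mono (pq_profile p q)"
proof (rule strict_monoI)
  have pos: "pq_profile p q x < pq_profile p q y" if "0 \<le> x" "x < y" for x y
    using powr_less_mono2[of "p-1" x y] powr_less_mono2[of "q-1" x y] that pq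
    by (cases "x = 0") (auto simp: pq_profile_def intro!: add_pos_pos)
  have odd: "pq_profile p q (- x) = - pq_profile p q x" for x by (simp add: pq_profile_def)
  have nn: "0 \<le> pq_profile p q x" if "0 \<le> x" for x using that by (simp add: pq_profile_def)
  fix x y :: real assume "x < y"
  consider "0 \<le> x" | "x < 0" "0 < y" | "y \<le> 0" by linarith
  then show "pq_profile p q x < pq_profile p q y"
  proof cases
    case 1 then show ?thesis using pos \<open>x < y\<close> by simp
  next
    case 2
    have "0 < pq_profile p q (- x)" using pos[of 0 "-x"] 2 by (simp add: pq_profile_def)
    then show ?thesis using nn[of y] 2 by (simp add: odd)
  next
    case 3 then show ?thesis using pos[of "-y" "-x"] \<open>x < y\<close> by (simp add: odd)
  qed
qed

lemma pq_profile_surj: "surj (pq_profile p q)"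
proof -
  have ex: "\<exists>t\<ge>0. pq_profile p q t = y" if y: "0 \<le> y" for y
  proof -
    have e: "pq_profile p q t = t powr (p - 1) + t powr (q - 1)" if "0 \<le> t" for t
      using that by (auto simp: pq_profile_def sgn_if)
    have "\<exists>t. 0 \<le> t \<and> t \<le> y powr (1 / (q - 1)) \<and> t powr (p - 1) + t powr (q - 1) = y"
    proof (rule IVT')
      show "0 powr (p - 1) + 0 powr (q - 1) \<le> y" using y by simp
      have "(y powr (1 / (q - 1))) powr (q - 1) = y" using y pq by (simp add: powr_powr)
      then show "y \<le> (y powr (1 / (q - 1))) powr (p - 1) + (y powr (1 / (q - 1))) powr (q - 1)" by simp
      show "continuous_on {0..y powr (1 / (q - 1))} (\<lambda>t. t powr (p - 1) + t powr (q - 1))"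
        using pq by (intro continuous_intros continuous_on_powr') auto
    qed simp
    then show ?thesis using e by auto
  qed
  have "\<exists>t. y = pq_profile p q t" for y
  proof (cases "0 \<le> y")
    case True then show ?thesis using ex by metis
  next
    case False
    then obtain t where "pq_profile p q t = - y" using ex[of "-y"] by auto
    then have "y = pq_profile p q (- t)" by (simp add: pq_profile_def)
    then show ?thesis ..
  qed
  then show ?thesis by (simp add: surj_def)
qed

lemma pq_profile_inverse [simp]: "pq_profile p q (pq_inverse p q y) = y"
  unfolding pq_inverse_def by (rule surj_f_inv_f[OF pq_profile_surj])

lemma pq_inverse_profile [simp]: "pq_inverse p q (pq_profile p q t) = t"
  unfolding pq_inverse_def
  by (rule inv_f_f[OF strict_mono_imp_inj_on[OF pq_profile_strict_mono]])

lemma pq_inverse_le_iff: "pq_inverse p q y \<le> t \<longleftrightarrow> y \<le> pq_profile p q t"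
  using strict_mono_less_eq[OF pq_profile_strict_mono, of "pq_inverse p q y" t] by simp

lemma pq_inverse_mono: "y \<le> z \<Longrightarrow> pq_inverse p q y \<le> pq_inverse p q z"
  by (simp add: pq_inverse_le_iff)

lemma isCont_pq_inverse: "isCont (pq_inverse p q) y"
proof -
  have "surj (pq_inverse p q)" by (metis pq_inverse_profile surjI)
  then have "continuous_on UNIV (pq_inverse p q)"
    by (intro continuous_onI_mono) (auto simp: pq_inverse_mono)
  then show ?thesis by (simp add: continuous_on_eq_continuous_at)
qed

lemma pq_inverse_0 [simp]: "pq_inverse p q 0 = 0"
  using pq_inverse_profile[of 0] by (simp add: pq_profile_def)

lemma pq_inverse_nonneg: "0 \<le> y \<Longrightarrow> 0 \<le> pq_inverse p q y"
  using pq_inverse_mono[of 0 y] by simp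

lemma pq_inverse_pos: "0 < y \<Longrightarrow> 0 < pq_inverse p q y"
  using pq_inverse_le_iff[of y 0] by (simp add: pq_profile_def not_le[symmetric])

lemma pq_profile_nonneg_eq: "0 \<le> t \<Longrightarrow> pq_profile p q t = t powr (p - 1) + t powr (q - 1)"
  by (auto simp: pq_profile_def sgn_if)

lemma pq_inverse_powr: "0 \<le> y \<Longrightarrow> pq_inverse p q y powr (p - 1) + pq_inverse p q y powr (q - 1) = y"
  using pq_profile_nonneg_eq[OF pq_inverse_nonneg, of y] by simp

lemma pq_inverse_upper:
  assumes "0 \<le> y"
  shows "pq_inverse p q y \<le> y powr (1 / (q - 1))"
proof -
  have "(y powr (1 / (q - 1))) powr (q - 1) = y" using assms pq by (simp add: powr_powr)
  then show ?thesis by (simp add: pq_inverse_le_iff pq_profile_nonneg_eq)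
qed

text \<open>Below the value \<open>2\<close> the inverse is at most \<open>1\<close>, so that the smaller power dominates.\<close>

lemma pq_inverse_lower:
  assumes "0 \<le> y" "y \<le> 2"
  shows "(y / 2) powr (1 / (q - 1)) \<le> pq_inverse p q y"
proof -
  define h where "h = pq_inverse p q y"
  have h: "0 \<le> h" "h \<le> 1" using assms by (auto simp: h_def pq_inverse_nonneg pq_inverse_le_iff pq_profile_def)
  have "h powr (p - 1) \<le> h powr (q - 1)" using h pq by (intro powr_mono') auto
  then have "y / 2 \<le> h powr (q - 1)" using pq_inverse_powr[OF assms(1)] by (simp add: h_def)
  then have "(y / 2) powr (1 / (q - 1)) \<le> (h powr (q - 1)) powr (1 / (q - 1))"
    using assms pq by (intro powr_mono2) auto
  also have "\<dots> = h" using h pq by (simp add: powr_powr)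
  finally show ?thesis by (simp add: h_def)
qed

end

lemma decreasing_antiderivative:
  fixes j :: "real \<Rightarrow> real"
  assumes "continuous_on {a..b} j"
  obtains f where "f R = 0" "\<And>t. a < t \<Longrightarrow> t < b \<Longrightarrow> (f has_real_derivative - j t) (at t)"
proof -
  obtain g where g: "\<And>t. t \<in> {a..b} \<Longrightarrow> (g has_vector_derivative j t) (at t within {a..b})"
    using antiderivative_continuous[OF assms] by metis
  show thesis
  proof (rule that[of "\<lambda>t. g R - g t"])
    fix t assume t: "a < t" "t < b"
    have "(g has_vector_derivative j t) (at t within {a<..<b})"
      by (rule has_vector_derivative_within_subset[OF g]) (use t in auto)
    then have "(g has_real_derivative j t) (at t)"
      using t by (simp add: has_real_derivative_iff_has_vector_derivative at_within_open[of t "{a<..<b}"])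
    then show "((\<lambda>t. g R - g t) has_real_derivative - j t) (at t)"
      by (auto intro!: derivative_eq_intros)
  qed simp
qed

lemma GDERIV_norm_diff: "x \<noteq> c \<Longrightarrow> GDERIV (\<lambda>x. norm (x - c)) x :> sgn (x - c)"
proof -
  assume "x \<noteq> c"
  then have "(norm has_derivative (\<lambda>h. h \<bullet> sgn (x - c))) (at (x - c))"
    using GDERIV_norm[of "x - c"] by (simp add: gderiv_def)
  moreover have "((\<lambda>x. x - c) has_derivative (\<lambda>h. h)) (at x)" by (auto intro!: derivative_eq_intros)
  ultimately show ?thesis unfolding gderiv_def by (rule has_derivative_compose[rotated])
qed

text \<open>
  The norm is not differentiable at the centre, but a vanishing derivative of \<open>f\<close> compensates.
\<close>

lemma GDERIV_radial_at_centre: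
  fixes c :: "'a::euclidean_space"
  assumes "(f has_real_derivative 0) (at 0)"
  shows "GDERIV (\<lambda>x. f (norm (x - c))) c :> 0"
proof -
  have "(\<lambda>t. (f (0 + t) - f 0) / t) \<midarrow>0\<rightarrow> 0" using assms by (simp add: DERIV_def)
  moreover have "filterlim (norm :: 'a \<Rightarrow> real) (at 0) (at 0)"
    unfolding filterlim_at by (auto intro!: tendsto_eq_intros simp: eventually_at_filter)
  ultimately have "(\<lambda>h::'a. (f (0 + norm h) - f 0) / norm h) \<midarrow>0\<rightarrow> 0" by (rule filterlim_compose)
  then have "(\<lambda>h::'a. norm ((f (0 + norm h) - f 0) / norm h)) \<midarrow>0\<rightarrow> 0" by (rule tendsto_norm_zero)
  then show ?thesis
    unfolding gderiv_def has_derivative_at by (simp add: bounded_linear_zero)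
qed

context pq_supersolution
begin

text \<open>The length of the gradient that carries a flux of given size.\<close>

abbreviation "slope \<equiv> pq_inverse p q"

text \<open>
  The field \<open>- W(|x - c|\<^sup>2) (x - c)\<close> is the flux of \<open>f(|x - c|)\<close> as soon as \<open>- f'(t)\<close> is the slope that carries
  a flux of size \<open>t W(t\<^sup>2)\<close>. Every choice of \<open>W\<close> thus gives a barrier whose image under the operator
  \<open>-\<Delta>\<^sub>p - \<Delta>\<^sub>q\<close> is explicit, although \<open>f\<close> itself is not. A negative \<open>a\<close> admits domains that contain the
  centre, where \<open>f'(0) = 0\<close>.
\<close>

lemma radial_comparison:
  fixes W W' f :: "real \<Rightarrow> real"
  assumes D: "open D" "bounded D" "closure D \<subseteq> \<Omega>"
    and I: "\<And>x. x \<in> closure D \<Longrightarrow> a < norm (x - c) \<and> norm (x - c) < b"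
    and W: "\<And>t. a < t \<Longrightarrow> t < b \<Longrightarrow> (W has_real_derivative W' (t\<^sup>2)) (at (t\<^sup>2))"
    and W': "continuous_on {a<..<b} (\<lambda>t. W' (t\<^sup>2))"
    and W0: "\<And>x. x \<in> D \<Longrightarrow> 0 \<le> W ((norm (x - c))\<^sup>2)"
    and f: "\<And>t. a < t \<Longrightarrow> t < b \<Longrightarrow> (f has_real_derivative - slope (\<bar>t\<bar> * W (t\<^sup>2))) (at t)"
    and k: "\<And>x. x \<in> D \<Longrightarrow> DIM('a) * W ((norm (x - c))\<^sup>2) + 2 * (norm (x - c))\<^sup>2 * W' ((norm (x - c))\<^sup>2) < u x powr (s - 1)"
    and bdry: "\<And>x. x \<in> frontier D \<Longrightarrow> f (norm (x - c)) \<le> u x"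
    and x: "x \<in> D"
  shows "f (norm (x - c)) \<le> u x"
proof -
  note inv = q_gt_1 q_less_p
  define j where "j t = slope (\<bar>t\<bar> * W (t\<^sup>2))" for t
  have DI: "a < norm (x - c)" "norm (x - c) < b" if "x \<in> D" for x
    using I[of x] that closure_subset[of D] by auto
  have cW: "isCont (\<lambda>t. W (t\<^sup>2)) t" if "a < t" "t < b" for t
    by (rule isCont_o2[of _ "\<lambda>t. t\<^sup>2" W]) (auto intro: DERIV_isCont[OF W[OF that]] continuous_intros)
  have cj: "isCont j t" if "a < t" "t < b" for t
    unfolding j_def
    by (rule isCont_o2[of _ "\<lambda>t. \<bar>t\<bar> * W (t\<^sup>2)" slope]) (auto intro!: isCont_pq_inverse[OF inv] continuous_intros cW that)
  define F where "F x = - (W ((norm (x - c))\<^sup>2) *\<^sub>R (x - c))" for x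
  define v' where "v' x = - (j (norm (x - c)) *\<^sub>R sgn (x - c))" for x
  have cF: "continuous_on (closure D) F"
  proof (rule continuous_at_imp_continuous_on, rule ballI)
    fix x assume "x \<in> closure D"
    then have "isCont (\<lambda>t. W (t\<^sup>2)) (norm (x - c))" using I cW by auto
    then have "isCont (\<lambda>x. W ((norm (x - c))\<^sup>2)) x"
      by (rule isCont_o2[rotated]) (intro continuous_intros)
    then show "isCont F x" unfolding F_def by (intro continuous_intros)
  qed
  have cD: "compact (closure D)" using D by (simp add: compact_closure)
  obtain B where B: "\<And>x. x \<in> closure D \<Longrightarrow> norm (F x) \<le> B"
    using compact_imp_bounded[OF compact_continuous_image[OF cF cD]] by (auto simp: bounded_iff)
  have Dv: "GDERIV (\<lambda>x. f (norm (x - c))) x :> v' x" if "x \<in> closure D" for x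
  proof (cases "x = c")
    case True
    then have "a < 0" "0 < b" using I[OF that] by auto
    from f[OF this] have "(f has_real_derivative 0) (at 0)" by (simp add: pq_inverse_0[OF inv])
    from GDERIV_radial_at_centre[OF this, of c] show ?thesis using True by (simp add: v'_def)
  next
    case False
    have "GDERIV (\<lambda>x. f (norm (x - c))) x :> (- j (norm (x - c))) *\<^sub>R sgn (x - c)"
      using GDERIV_DERIV_compose[OF GDERIV_norm_diff[OF False] f[of "norm (x - c)"]] I[OF that] by (simp add: j_def)
    then show ?thesis by (simp add: v'_def)
  qed
  have cv': "isCont v' x" if "x \<in> D" for x
  proof -
    have cjn: "isCont (\<lambda>x. j (norm (x - c))) x"
      by (rule isCont_o2[of _ "\<lambda>x. norm (x - c)" j]) (auto intro!: continuous_intros cj DI that)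
    show ?thesis
    proof (cases "x = c")
      case False
      then show ?thesis
        using cjn unfolding v'_def isCont_def
        by (intro tendsto_minus tendsto_scaleR tendsto_sgn tendsto_intros) auto
    next
      case True
      have j0: "j 0 = 0" by (simp add: j_def pq_inverse_0[OF inv])
      have "(\<lambda>x. j (norm (x - c))) \<midarrow>x\<rightarrow> 0" using cjn j0 True by (simp add: isCont_def)
      then have "(\<lambda>x. \<bar>j (norm (x - c))\<bar>) \<midarrow>x\<rightarrow> 0" by (rule tendsto_rabs_zero)
      moreover have "\<forall>\<^sub>F y in at x. norm (v' y) \<le> \<bar>j (norm (y - c))\<bar>"
        by (intro always_eventually) (auto simp: v'_def norm_sgn)
      ultimately have "v' \<midarrow>x\<rightarrow> 0" by (rule Lim_null_comparison[rotated])
      then show ?thesis using True by (simp add: isCont_def v'_def)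
    qed
  qed
  have flux: "pq_flux p q (v' x) = F x" if "x \<in> D" for x
  proof (cases "x = c")
    case True then show ?thesis by (simp add: v'_def F_def pq_flux_def laplace_flux_def)
  next
    case False
    define Y where "Y = norm (x - c) * W ((norm (x - c))\<^sup>2)"
    define h where "h = slope Y"
    have Y: "0 \<le> Y" using W0[OF that] by (simp add: Y_def)
    have h: "0 \<le> h" "h powr (p - 1) + h powr (q - 1) = Y"
      using pq_inverse_nonneg[OF inv Y] pq_inverse_powr[OF inv Y] by (auto simp: h_def)
    have v: "v' x = - (h *\<^sub>R sgn (x - c))" by (simp add: v'_def j_def h_def Y_def)
    have nv: "norm (v' x) = h" using h False by (simp add: v norm_sgn)
    have e: "h powr (r - 2) * h = h powr (r - 1)" for r
      using powr_mult_base[OF h(1), of "r - 2"] by (simp add: mult.commute)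
    have lf: "laplace_flux r (v' x) = - ((h powr (r - 1)) *\<^sub>R sgn (x - c))" for r
      unfolding laplace_flux_def nv by (simp add: v e)
    have "pq_flux p q (v' x) = - (Y *\<^sub>R sgn (x - c))"
      unfolding pq_flux_def lf h(2)[symmetric] by (simp add: scaleR_left_distrib)
    also have "\<dots> = F x" using False by (simp add: Y_def F_def sgn_div_norm)
    finally show ?thesis .
  qed
  define T where "T x = (norm (x - c))\<^sup>2" for x
  have cT: "continuous_on D (\<lambda>x. W' (T x))" "continuous_on D (\<lambda>x. W (T x))"
  proof -
    show "continuous_on D (\<lambda>x. W' (T x))"
      unfolding T_def by (rule continuous_on_compose2[OF W']) (auto intro!: continuous_intros DI)
    show "continuous_on D (\<lambda>x. W (T x))"
    proof (rule continuous_at_imp_continuous_on, rule ballI)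
      fix x assume "x \<in> D"
      then have "isCont (\<lambda>t. W (t\<^sup>2)) (norm (x - c))" using DI cW by auto
      then show "isCont (\<lambda>x. W (T x)) x"
        unfolding T_def by (rule isCont_o2[rotated]) (intro continuous_intros)
    qed
  qed
  show ?thesis
  proof (rule comparison_principle[OF D _ _ _ flux _ _ _ _ _ _ x,
      where v = "\<lambda>x. f (norm (x - c))" and B = B and k = "\<lambda>x. DIM('a) * W (T x) + 2 * T x * W' (T x)"])
    show "continuous_on (closure D) (\<lambda>x. f (norm (x - c)))"
      by (intro continuous_at_imp_continuous_on ballI has_derivative_continuous[OF Dv[unfolded gderiv_def]])
    show "GDERIV (\<lambda>x. f (norm (x - c))) x :> v' x" if "x \<in> D" for x
      using Dv that closure_subset by blast
    show "continuous_on D v'" by (intro continuous_at_imp_continuous_on ballI cv')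
    show "continuous_on D F" by (rule continuous_on_subset[OF cF closure_subset])
    show "norm (F x) \<le> B" if "x \<in> D" for x using B that closure_subset by blast
    show "(\<integral>x. F x \<bullet> grad \<phi> x \<partial>lborel) = (\<integral>x. (DIM('a) * W (T x) + 2 * T x * W' (T x)) * \<phi> x \<partial>lborel)" if "\<phi> \<in> C1_c D" for \<phi>
      unfolding F_def T_def
      by (rule radial_field_weak_divergence[OF D(1) that]) (use W DI cT in \<open>auto simp: T_def\<close>)
    show "continuous_on D (\<lambda>x. DIM('a) * W (T x) + 2 * T x * W' (T x))"
      by (intro continuous_intros cT) (auto simp: T_def intro!: continuous_intros)
    show "DIM('a) * W (T x) + 2 * T x * W' (T x) < u x powr (s - 1)" if "x \<in> D" for x
      using k[OF that] by (simp add: T_def)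
  qed (use bdry in auto)
qed

text \<open>
  The barrier vanishes on the outer sphere, where \<open>u\<close> is nonnegative, so only the inner sphere imposes
  a condition.
\<close>

lemma annulus_comparison:
  fixes W W' :: "real \<Rightarrow> real"
  assumes r: "0 < a" "a < b" and sub: "\<And>x. a \<le> norm (x - c) \<Longrightarrow> norm (x - c) \<le> b \<Longrightarrow> x \<in> \<Omega>"
    and W: "\<And>\<tau>. 0 < \<tau> \<Longrightarrow> (W has_real_derivative W' \<tau>) (at \<tau>)"
    and W': "continuous_on {0<..} W'"
    and W0: "\<And>t. a \<le> t \<Longrightarrow> 0 \<le> W (t\<^sup>2)"
    and k: "\<And>x. a < norm (x - c) \<Longrightarrow> DIM('a) * W ((norm (x - c))\<^sup>2) + 2 * (norm (x - c))\<^sup>2 * W' ((norm (x - c))\<^sup>2) < u x powr (s - 1)"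
  shows "\<exists>f. f b = 0 \<and> (\<forall>t\<in>{a..b}. (f has_real_derivative - slope (t * W (t\<^sup>2))) (at t)) \<and>
    ((\<forall>x. norm (x - c) = a \<longrightarrow> f a \<le> u x) \<longrightarrow> (\<forall>x. a < norm (x - c) \<and> norm (x - c) < b \<longrightarrow> f (norm (x - c)) \<le> u x))"
proof -
  have cj: "continuous_on {a/2..b+1} (\<lambda>t. slope (\<bar>t\<bar> * W (t\<^sup>2)))"
  proof (rule continuous_at_imp_continuous_on, rule ballI)
    fix t assume "t \<in> {a/2..b+1}"
    then have "0 < t\<^sup>2" using r by auto
    then have "isCont (\<lambda>t. W (t\<^sup>2)) t"
      by (intro isCont_o2[of _ "\<lambda>t. t\<^sup>2" W] DERIV_isCont[OF W] continuous_intros)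
    then have "isCont (\<lambda>t. \<bar>t\<bar> * W (t\<^sup>2)) t" by (intro continuous_intros)
    then show "isCont (\<lambda>t. slope (\<bar>t\<bar> * W (t\<^sup>2))) t"
      by (rule isCont_o2[OF _ isCont_pq_inverse[OF q_gt_1 q_less_p]])
  qed
  obtain f where f: "f b = 0" "\<And>t. a/2 < t \<Longrightarrow> t < b+1 \<Longrightarrow> (f has_real_derivative - slope (\<bar>t\<bar> * W (t\<^sup>2))) (at t)"
    using decreasing_antiderivative[OF cj, of b] by blast
  define D where "D = {x. a < norm (x - c) \<and> norm (x - c) < b}"
  have oD: "open D"
    unfolding D_def by (intro open_Collect_conj open_Collect_less continuous_intros)
  have bD: "bounded D"
    by (rule bounded_subset[OF bounded_cball[of c b]]) (auto simp: D_def dist_norm norm_minus_commute)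
  have clD: "closure D \<subseteq> {x. a \<le> norm (x - c) \<and> norm (x - c) \<le> b}"
    by (intro closure_minimal closed_Collect_conj closed_Collect_le continuous_intros) (auto simp: D_def)
  show ?thesis
  proof (intro exI[of _ f] conjI ballI impI allI)
    show "f b = 0" by (rule f)
    show "(f has_real_derivative - slope (t * W (t\<^sup>2))) (at t)" if "t \<in> {a..b}" for t
      using f(2)[of t] that r by simp
    fix x assume inner: "\<forall>x. norm (x - c) = a \<longrightarrow> f a \<le> u x" and "a < norm (x - c) \<and> norm (x - c) < b"
    then have x: "a < norm (x - c)" "norm (x - c) < b" by auto
    show "f (norm (x - c)) \<le> u x"
    proof (rule radial_comparison[OF oD bD, where a = "a/2" and b = "b+1" and W = W and W' = W'])
      show "closure D \<subseteq> \<Omega>" using clD sub by auto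
      show "a/2 < norm (x - c) \<and> norm (x - c) < b + 1" if "x \<in> closure D" for x
        using clD that r by force
      show "(W has_real_derivative W' (t\<^sup>2)) (at (t\<^sup>2))" if "a/2 < t" "t < b+1" for t
        using that r by (intro W) auto
      show "continuous_on {a/2<..<b+1} (\<lambda>t. W' (t\<^sup>2))"
        using r by (intro continuous_on_compose2[OF W'] continuous_intros) auto
      show "(f has_real_derivative - slope (\<bar>t\<bar> * W (t\<^sup>2))) (at t)" if "a/2 < t" "t < b+1" for t
        using f(2)[OF that] .
      show "f (norm (y - c)) \<le> u y" if "y \<in> frontier D" for y
      proof -
        have y: "y \<in> closure D" "y \<notin> D" using that oD by (auto simp: frontier_def interior_open)
        then consider "norm (y - c) = a" | "norm (y - c) = b" using clD by (force simp: D_def)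
        then show ?thesis
        proof cases
          case 1 then show ?thesis using inner by simp
        next
          case 2 then show ?thesis using f u_nonneg by simp
        qed
      qed
    qed (use x k W0 in \<open>auto simp: D_def\<close>)
  qed
qed

end

section \<open>Positivity and pointwise bounds\<close>

lemma antiderivative_lower_bound:
  fixes f :: "real \<Rightarrow> real"
  assumes "a \<le> b" and f: "\<And>t. a \<le> t \<Longrightarrow> t \<le> b \<Longrightarrow> (f has_real_derivative - j t) (at t)"
    and "\<And>t. a \<le> t \<Longrightarrow> t \<le> b \<Longrightarrow> J \<le> j t"
  shows "f b + J * (b - a) \<le> f a"
proof -
  have "f b + J * b \<le> f a + J * a"
  proof (rule DERIV_nonpos_imp_nonincreasing[OF assms(1)])
    fix t assume t: "a \<le> t" "t \<le> b"
    have "((\<lambda>t. f t + J * t) has_real_derivative (- j t + J)) (at t)"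
      by (auto intro!: derivative_eq_intros f t)
    then show "\<exists>y. ((\<lambda>t. f t + J * t) has_real_derivative y) (at t) \<and> y \<le> 0"
      using assms(3)[OF t] by (intro exI[of _ "- j t + J"]) auto
  qed
  then show ?thesis by (simp add: algebra_simps)
qed

lemma antiderivative_upper_bound:
  fixes f g :: "real \<Rightarrow> real"
  assumes "a \<le> b" and f: "\<And>t. a \<le> t \<Longrightarrow> t \<le> b \<Longrightarrow> (f has_real_derivative - j t) (at t)"
    and g: "\<And>t. a \<le> t \<Longrightarrow> t \<le> b \<Longrightarrow> (g has_real_derivative - i t) (at t)"
    and "\<And>t. a \<le> t \<Longrightarrow> t \<le> b \<Longrightarrow> j t \<le> i t"
  shows "f a - f b \<le> g a - g b"
proof -
  have "f a - g a \<le> f b - g b"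
  proof (rule DERIV_nonneg_imp_nondecreasing[OF assms(1)])
    fix t assume t: "a \<le> t" "t \<le> b"
    have "((\<lambda>t. f t - g t) has_real_derivative (- j t - - i t)) (at t)"
      by (intro DERIV_diff f g t)
    then show "\<exists>y. ((\<lambda>t. f t - g t) has_real_derivative y) (at t) \<and> 0 \<le> y"
      using assms(4)[OF t] by (intro exI[of _ "- j t - - i t"]) auto
  qed
  then show ?thesis by simp
qed

lemma square_powr: "0 < t \<Longrightarrow> (t\<^sup>2) powr e = t powr (2 * e)" for t :: real
  by (simp add: powr_powr flip: powr_numeral)

context pq_supersolution
begin

text \<open>
  For \<open>W(\<tau>) = K \<tau>\<^bsup>-N\<^esup>\<close> the divergence term is \<open>- N K \<tau>\<^bsup>-N\<^esup>\<close>, hence negative. The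
  barrier is positive inside the outer sphere, and a small \<open>K\<close> puts it below \<open>u\<close> on a small inner
  sphere, where \<open>u\<close> stays above \<open>u(c) / 2\<close>.
\<close>

lemma positivity_spreads:
  assumes sub: "cball c \<rho> \<subseteq> \<Omega>" and uc: "0 < u c" and x: "x \<in> ball c \<rho>"
  shows "0 < u x"
proof -
  note inv = q_gt_1 q_less_p
  have \<rho>: "\<rho> > 0" using x zero_le_dist[of c x] by (simp del: zero_le_dist)
  define m where "m = u c / 2"
  have m: "m > 0" using uc by (simp add: m_def)
  have "isCont u c"
    using u_cont open_Omega sub \<rho> by (auto simp: continuous_on_eq_continuous_at subset_iff)
  then obtain d where d: "d > 0" "\<And>y. dist y c < d \<Longrightarrow> dist (u y) (u c) < m"
    using m unfolding continuous_at_eps_delta by blast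
  define a where "a = min (d/2) (\<rho>/2)"
  have a: "a > 0" "a < \<rho>" "a < d" using d \<rho> by (auto simp: a_def)
  have um: "m < u y" if "norm (y - c) \<le> a" for y
    using d(2)[of y] that a by (auto simp: dist_norm m_def abs_if split: if_splits)
  show ?thesis
  proof (cases "norm (x - c) \<le> a")
    case True then show ?thesis using um[OF True] m by simp
  next
    case False
    define n where "n = real DIM('a)"
    have n: "n \<ge> 1" by (simp add: n_def Suc_leI)
    \<comment> \<open>with this \<open>K\<close> the slope is at most \<open>m / \<rho>\<close> on the annulus, so that the barrier drops by at most \<open>m\<close>\<close>
    define K where "K = pq_profile p q (m / \<rho>) / a powr (1 - 2 * n)"
    have "0 < pq_profile p q (m / \<rho>)" using m \<rho> by (simp add: pq_profile_def add_pos_pos)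
    then have K: "K > 0" using a by (simp add: K_def)
    define W where "W \<tau> = K * \<tau> powr (- n)" for \<tau>
    have Wt: "t * W (t\<^sup>2) = K * t powr (1 - 2 * n)" if "0 < t" for t
      using that by (simp add: W_def square_powr powr_diff powr_minus field_simps)
    have "\<exists>f. f (\<rho>) = 0 \<and> (\<forall>t\<in>{a..\<rho>}. (f has_real_derivative - slope (t * W (t\<^sup>2))) (at t)) \<and>
      ((\<forall>x. norm (x - c) = a \<longrightarrow> f a \<le> u x) \<longrightarrow> (\<forall>x. a < norm (x - c) \<and> norm (x - c) < \<rho> \<longrightarrow> f (norm (x - c)) \<le> u x))"
    proof (rule annulus_comparison[of a \<rho> c W "\<lambda>\<tau>. K * (- n * \<tau> powr (- n - 1))"])
      show "x \<in> \<Omega>" if "norm (x - c) \<le> \<rho>" for x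
        using sub that by (auto simp: dist_norm norm_minus_commute)
      show "(W has_real_derivative K * (- n * \<tau> powr (- n - 1))) (at \<tau>)" if "0 < \<tau>" for \<tau>
        unfolding W_def using that by (auto intro!: derivative_eq_intros)
      show "continuous_on {0<..} (\<lambda>\<tau>. K * (- n * \<tau> powr (- n - 1)))"
        by (intro continuous_intros) auto
      show "0 \<le> W (t\<^sup>2)" for t using K by (simp add: W_def)
      fix x assume "a < norm (x - c)"
      then have T: "0 < (norm (x - c))\<^sup>2" using a by (intro zero_less_power) linarith
      define T where "T = (norm (x - c))\<^sup>2"
      have "DIM('a) * W T + 2 * T * (K * (- n * T powr (- n - 1))) = - (n * (K * T powr (- n)))"
        using T unfolding T_def[symmetric] by (simp add: W_def n_def powr_diff field_simps)
      also have "\<dots> < 0" using n K T unfolding T_def[symmetric] by simp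
      also have "\<dots> \<le> u x powr (s - 1)" by simp
      finally show "DIM('a) * W ((norm (x - c))\<^sup>2) + 2 * (norm (x - c))\<^sup>2 * (K * (- n * ((norm (x - c))\<^sup>2) powr (- n - 1))) < u x powr (s - 1)"
        by (simp only: T_def)
    qed (use a in auto)
    then obtain f where f: "f (\<rho>) = 0" "\<forall>t\<in>{a..\<rho>}. (f has_real_derivative - slope (t * W (t\<^sup>2))) (at t)"
        "(\<forall>x. norm (x - c) = a \<longrightarrow> f a \<le> u x) \<longrightarrow> (\<forall>x. a < norm (x - c) \<and> norm (x - c) < \<rho> \<longrightarrow> f (norm (x - c)) \<le> u x)"
      by blast
    have f': "(f has_real_derivative - slope (t * W (t\<^sup>2))) (at t)" if "a \<le> t" "t \<le> \<rho>" for t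
      using f(2) that by simp
    have j: "slope (t * W (t\<^sup>2)) \<le> m / \<rho>" if "a \<le> t" for t
    proof -
      have "t powr (1 - 2 * n) \<le> a powr (1 - 2 * n)" using that a n by (intro powr_mono2') auto
      then have "K * t powr (1 - 2 * n) \<le> pq_profile p q (m / \<rho>)"
        using K a by (simp add: K_def field_simps)
      then show ?thesis using that a by (simp add: Wt pq_inverse_le_iff[OF inv])
    qed
    have "f a - f \<rho> \<le> - (m / \<rho>) * a - - (m / \<rho>) * \<rho>"
      by (rule antiderivative_upper_bound[OF _ f', where i = "\<lambda>_. m / \<rho>"])
         (use a j in \<open>auto intro!: derivative_eq_intros\<close>)
    also have "\<dots> \<le> m" using a \<rho> m by (simp add: field_simps)
    finally have fa: "f a \<le> m" using f(1) by simp
    define t where "t = norm (x - c)"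
    have t: "a < t" "t < \<rho>" using False x by (auto simp: t_def dist_norm norm_minus_commute)
    have "f \<rho> < f t"
    proof (rule DERIV_neg_imp_decreasing[OF t(2)])
      fix y assume y: "t \<le> y" "y \<le> \<rho>"
      have "0 < slope (y * W (y\<^sup>2))" using y t a K by (intro pq_inverse_pos[OF inv]) (simp add: Wt)
      then show "\<exists>z. (f has_real_derivative z) (at y) \<and> z < 0"
        using f'[of y] y t by (intro exI[of _ "- slope (y * W (y\<^sup>2))"]) auto
    qed
    moreover have "f t \<le> u x"
    proof -
      have "f a \<le> u y" if "norm (y - c) = a" for y using um[of y] fa that by simp
      then show ?thesis using f(3) t by (simp add: t_def)
    qed
    ultimately show ?thesis using f(1) by simp
  qed
qed

text \<open>
  The zeros of \<open>u\<close> form an open set, because positivity at a point close to a zero would spread to it.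
  A connected set is not the union of two disjoint nonempty open sets.
\<close>

lemma positive_everywhere:
  assumes con: "connected \<Omega>" and x1: "0 < u x1" and x: "x \<in> \<Omega>"
  shows "0 < u x"
proof (rule ccontr)
  assume nx: "\<not> 0 < u x"
  define P where "P = {x \<in> \<Omega>. 0 < u x}"
  define Q where "Q = {x \<in> \<Omega>. u x = 0}"
  have "open P"
    using continuous_open_preimage[OF u_cont open_Omega, of "{0<..}"] by (simp add: P_def vimage_def Int_def)
  moreover have "open Q"
    unfolding open_contains_ball
  proof
    fix z assume z: "z \<in> Q"
    then obtain e where e: "e > 0" "cball z e \<subseteq> \<Omega>"
      using open_Omega by (auto simp: Q_def open_contains_cball)
    have "y \<in> Q" if y: "y \<in> ball z (e/2)" for y
    proof -
      have "cball y (e/2) \<subseteq> cball z e"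
        using y by (intro cball_subset_cball_iff[THEN iffD2]) (auto simp: dist_commute)
      then have "\<not> 0 < u y"
        using positivity_spreads[of y "e/2" z] y z e by (auto simp: Q_def dist_commute)
      moreover have "y \<in> \<Omega>" using y e by (auto simp: subset_iff)
      ultimately show ?thesis using u_nonneg[of y] by (simp add: Q_def)
    qed
    then show "\<exists>e>0. ball z e \<subseteq> Q" using e by (intro exI[of _ "e/2"]) auto
  qed
  moreover have "\<Omega> \<subseteq> P \<union> Q" using u_nonneg by (auto simp: P_def Q_def order.order_iff_strict)
  moreover have "P \<inter> Q \<inter> \<Omega> = {}" by (auto simp: P_def Q_def)
  moreover have "x1 \<in> P \<inter> \<Omega>" using x1 u_outside[of x1] by (auto simp: P_def)
  moreover have "x \<in> Q \<inter> \<Omega>" using nx x u_nonneg[of x] by (auto simp: Q_def)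
  ultimately show False using connectedD[OF con, of P Q] by blast
qed

text \<open>
  For \<open>W(\<tau>) = K \<tau>\<^bsup>-N/2\<^esup> l(\<tau>)\<close> the divergence term is \<open>2 K \<tau>\<^bsup>1-N/2\<^esup> l'(\<tau>)\<close>; constant \<open>l\<close> corresponds to the
  fundamental solution, and \<open>l\<close> is a perturbation of it. The bound on the growth of \<open>l\<close> makes the
  slope integrable at infinity, with exponent \<open>\<beta> > 1\<close>. Hence \<open>K\<close> can be chosen independently of the
  outer radius so that the barrier stays below \<open>u\<close> on the sphere of radius \<open>R\<close>. The estimate at \<open>x\<close> comes from the
  outer radius \<open>2|x|\<close>: between \<open>|x|\<close> and \<open>2|x|\<close> the barrier drops by at least \<open>|x|\<close> times a lower bound
  for the slope, and for small flux the slope is comparable to the power \<open>1/(q-1)\<close> of the flux.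
\<close>

lemma exterior_lower_bound:
  fixes l l' lam :: "real \<Rightarrow> real" and n :: real
  defines "n \<equiv> real DIM('a)"
  assumes R: "1 \<le> R" and sub: "\<And>x. R \<le> norm x \<Longrightarrow> x \<in> \<Omega>" and pos: "\<And>x. R \<le> norm x \<Longrightarrow> 0 < u x"
    and l: "\<And>\<tau>. 0 < \<tau> \<Longrightarrow> (l has_real_derivative l' \<tau>) (at \<tau>)" and l': "continuous_on {0<..} l'"
    and l0: "\<And>\<tau>. 1 \<le> \<tau> \<Longrightarrow> 0 \<le> l \<tau>" and lC: "\<And>\<tau>. 1 \<le> \<tau> \<Longrightarrow> l \<tau> \<le> C * \<tau> powr \<delta>"
    and C: "0 < C" and \<delta>: "q - 1 < n - 1 - 2 * \<delta>"
    and lam: "\<And>r t. R \<le> r \<Longrightarrow> r \<le> t \<Longrightarrow> 0 \<le> lam r \<and> lam r \<le> l (t\<^sup>2)"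
    and K0: "0 < K0" and k: "\<And>K x. 0 < K \<Longrightarrow> K \<le> K0 \<Longrightarrow> R < norm x \<Longrightarrow>
       2 * K * ((norm x)\<^sup>2) powr (1 - n/2) * l' ((norm x)\<^sup>2) < u x powr (s - 1)"
  shows "\<exists>c>0. \<forall>x. R < norm x \<longrightarrow> c * lam (norm x) powr (1/(q-1)) * norm x powr (1 - (n-1)/(q-1)) \<le> u x"
proof -
  note inv = q_gt_1 q_less_p
  define \<beta> where "\<beta> = (n - 1 - 2 * \<delta>) / (q - 1)"
  have \<beta>: "\<beta> > 1" using \<delta> q_gt_1 by (simp add: \<beta>_def)
  have n1: "n \<ge> 1" by (simp add: n_def Suc_leI)
  obtain m0 where m0: "m0 > 0" "\<And>x. norm x = R \<Longrightarrow> m0 \<le> u x"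
  proof (cases "sphere (0::'a) R = {}")
    case True then show thesis by (intro that[of 1]) auto
  next
    case False
    have "continuous_on (sphere 0 R) u" using sub by (intro continuous_on_subset[OF u_cont]) auto
    then obtain z where "z \<in> sphere 0 R" "\<forall>x\<in>sphere 0 R. u z \<le> u x"
      using continuous_attains_inf[OF compact_sphere False] by blast
    then show thesis using pos[of z] by (intro that[of "u z"]) auto
  qed
  \<comment> \<open>the last two bounds keep the flux below \<open>1\<close> and the barrier below \<open>m0\<close> on the inner sphere\<close>
  define K where "K = min K0 (min (1 / C) ((m0 * (\<beta> - 1)) powr (q - 1) / C))"
  have K: "0 < K" "K \<le> K0" "K * C \<le> 1" "K * C \<le> (m0 * (\<beta> - 1)) powr (q - 1)"
    using K0 C m0 \<beta> by (auto simp: K_def min_def field_simps)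
  define W where "W \<tau> = K * (\<tau> powr (- n/2) * l \<tau>)" for \<tau>
  define W' where "W' \<tau> = K * (- n/2 * \<tau> powr (- n/2 - 1) * l \<tau> + \<tau> powr (- n/2) * l' \<tau>)" for \<tau>
  have Wt: "t * W (t\<^sup>2) = K * (t powr (1 - n) * l (t\<^sup>2))" if "0 < t" for t
    using that by (simp add: W_def square_powr powr_diff powr_minus field_simps)
  define c where "c = (K * 2 powr (- n)) powr (1 / (q - 1))"
  have c: "c > 0" using K by (simp add: c_def)
  show ?thesis
  proof (intro exI[of _ c] conjI c allI impI)
    fix x :: 'a assume Rx: "R < norm x"
    define r where "r = norm x"
    have r: "R < r" "0 < r" "1 \<le> r" using Rx R by (auto simp: r_def)
    have "\<exists>f. f (2 * r) = 0 \<and> (\<forall>t\<in>{R..2 * r}. (f has_real_derivative - slope (t * W (t\<^sup>2))) (at t)) \<and>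
      ((\<forall>x. norm (x - 0) = R \<longrightarrow> f R \<le> u x) \<longrightarrow> (\<forall>x. R < norm (x - 0) \<and> norm (x - 0) < 2 * r \<longrightarrow> f (norm (x - 0)) \<le> u x))"
    proof (rule annulus_comparison[of R "2 * r" 0 W W'])
      show "x \<in> \<Omega>" if "R \<le> norm (x - 0)" for x using sub that by simp
      show "(W has_real_derivative W' \<tau>) (at \<tau>)" if "0 < \<tau>" for \<tau>
        unfolding W_def W'_def using that by (auto intro!: derivative_eq_intros l)
      have "continuous_on {0<..} l" by (intro continuous_at_imp_continuous_on ballI DERIV_isCont[OF l]) auto
      then show "continuous_on {0<..} W'" unfolding W'_def by (intro continuous_intros l') auto
      show "0 \<le> W (t\<^sup>2)" if "R \<le> t" for t
        using K l0[of "t\<^sup>2"] that R by (simp add: W_def)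
      fix y :: 'a assume y: "R < norm (y - 0)"
      define T where "T = (norm y)\<^sup>2"
      have T: "T > 0" using y R unfolding T_def by (intro zero_less_power) auto
      have "DIM('a) * W T + 2 * T * W' T = 2 * K * T powr (1 - n/2) * l' T"
      proof -
        have e: "T powr (- n/2 - 1) = T powr (- n/2) / T" "T powr (1 - n/2) = T * T powr (- n/2)"
          using T powr_add[of T 1 "- n/2"] by (simp_all add: powr_diff)
        show ?thesis
          unfolding W_def W'_def n_def[symmetric] e using T by (simp add: field_simps)
      qed
      then show "DIM('a) * W ((norm (y - 0))\<^sup>2) + 2 * (norm (y - 0))\<^sup>2 * W' ((norm (y - 0))\<^sup>2) < u y powr (s - 1)"
        using k[OF K(1,2), of y] y by (simp add: T_def)
    qed (use r R in auto)
    then obtain f where f: "f (2 * r) = 0" "\<forall>t\<in>{R..2 * r}. (f has_real_derivative - slope (t * W (t\<^sup>2))) (at t)"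
        "(\<forall>x. norm (x - 0) = R \<longrightarrow> f R \<le> u x) \<longrightarrow> (\<forall>x. R < norm (x - 0) \<and> norm (x - 0) < 2 * r \<longrightarrow> f (norm (x - 0)) \<le> u x)"
      by blast
    have f': "(f has_real_derivative - slope (t * W (t\<^sup>2))) (at t)" if "R \<le> t" "t \<le> 2 * r" for t
      using f(2) that by simp
    have fR: "f R \<le> m0"
    proof -
      define J where "J = (K * C) powr (1 / (q - 1))"
      have J: "0 \<le> J" "J \<le> m0 * (\<beta> - 1)"
      proof -
        have "J \<le> ((m0 * (\<beta> - 1)) powr (q - 1)) powr (1 / (q - 1))"
          unfolding J_def using K C q_gt_1 by (intro powr_mono2) auto
        also have "\<dots> = m0 * (\<beta> - 1)" using m0 \<beta> q_gt_1 by (simp add: powr_powr)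
        finally show "J \<le> m0 * (\<beta> - 1)" .
      qed (simp add: J_def)
      have jle: "slope (t * W (t\<^sup>2)) \<le> J * t powr (- \<beta>)" if t: "R \<le> t" for t
      proof -
        have t1: "1 \<le> t" using t R by simp
        have t2: "1 \<le> t\<^sup>2" using t1 by simp
        have Y0: "0 \<le> t * W (t\<^sup>2)" using t1 K l0[OF t2] by (simp add: Wt)
        have "t * W (t\<^sup>2) \<le> K * (t powr (1 - n) * (C * (t\<^sup>2) powr \<delta>))"
          using t1 lC[OF t2] K by (auto simp: Wt intro!: mult_left_mono)
        also have "\<dots> = (K * C) * t powr (1 - n + 2 * \<delta>)"
          using t1 by (simp add: square_powr powr_add mult_ac)
        finally have Y1: "t * W (t\<^sup>2) \<le> (K * C) * t powr (1 - n + 2 * \<delta>)" .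
        have "slope (t * W (t\<^sup>2)) \<le> (t * W (t\<^sup>2)) powr (1 / (q - 1))" by (rule pq_inverse_upper[OF inv Y0])
        also have "\<dots> \<le> ((K * C) * t powr (1 - n + 2 * \<delta>)) powr (1 / (q - 1))"
          using Y0 Y1 q_gt_1 by (intro powr_mono2) auto
        also have "\<dots> = J * t powr ((1 - n + 2 * \<delta>) * (1 / (q - 1)))"
          by (simp add: powr_mult powr_powr J_def)
        also have "(1 - n + 2 * \<delta>) * (1 / (q - 1)) = - \<beta>"
          using q_gt_1 by (simp add: \<beta>_def field_simps)
        finally show ?thesis .
      qed
      have "f R - f (2 * r) \<le> J / (\<beta> - 1) * R powr (1 - \<beta>) - J / (\<beta> - 1) * (2 * r) powr (1 - \<beta>)"
      proof (rule antiderivative_upper_bound[OF _ f', where i = "\<lambda>t. J * t powr (- \<beta>)"])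
        fix t assume "R \<le> t"
        then have "0 < t" using R by simp
        then have "((\<lambda>t. J / (\<beta> - 1) * t powr (1 - \<beta>)) has_real_derivative J / (\<beta> - 1) * ((1 - \<beta>) * t powr (1 - \<beta> - 1))) (at t)"
          by (intro DERIV_cmult has_real_derivative_powr)
        also have "J / (\<beta> - 1) * ((1 - \<beta>) * t powr (1 - \<beta> - 1)) = - (J * t powr (- \<beta>))"
        proof -
          have "\<beta> - 1 \<noteq> 0" using \<beta> by simp
          then show ?thesis by (simp add: divide_simps) (simp add: algebra_simps)
        qed
        finally show "((\<lambda>t. J / (\<beta> - 1) * t powr (1 - \<beta>)) has_real_derivative - (J * t powr (- \<beta>))) (at t)" .
      qed (use r jle in auto)
      also have "\<dots> \<le> J / (\<beta> - 1) * R powr (1 - \<beta>)" using J \<beta> by simp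
      also have "\<dots> \<le> J / (\<beta> - 1) * 1"
        using J \<beta> R powr_mono2'[of "1 - \<beta>" 1 R] by (intro mult_left_mono) auto
      also have "\<dots> \<le> m0" using J \<beta> by (simp add: field_simps)
      finally show ?thesis using f(1) by simp
    qed
    have fu: "f r \<le> u x"
    proof -
      have "f R \<le> u y" if "norm (y - 0) = R" for y using fR m0(2)[of y] that by simp
      then show ?thesis using f(3) r by (simp add: r_def)
    qed
    define Y where "Y = K * ((2 * r) powr (1 - n) * lam r)"
    have lamr: "0 \<le> lam r" using lam[of r r] r by simp
    have Y0: "0 \<le> Y" using K lamr by (simp add: Y_def)
    have "Y \<le> 1"
    proof -
      have "Y \<le> K * (r powr (1 - n) * (C * (r\<^sup>2) powr \<delta>))"
        unfolding Y_def using K lamr r n1 lam[of r r] lC[of "r\<^sup>2"]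
        by (intro mult_left_mono mult_mono powr_mono2') auto
      also have "\<dots> = (K * C) * r powr (1 - n + 2 * \<delta>)"
        using r by (simp add: square_powr powr_add mult_ac)
      also have "\<dots> \<le> 1 * 1"
      proof (rule mult_mono)
        show "r powr (1 - n + 2 * \<delta>) \<le> 1"
          using r \<delta> q_gt_1 powr_mono2'[of "1 - n + 2 * \<delta>" 1 r] by simp
      qed (use K C in auto)
      finally show ?thesis by simp
    qed
    have "f (2 * r) + slope Y * (2 * r - r) \<le> f r"
    proof (rule antiderivative_lower_bound[OF _ f'])
      fix t assume t: "r \<le> t" "t \<le> 2 * r"
      have "Y \<le> K * (t powr (1 - n) * l (t\<^sup>2))"
        unfolding Y_def using K t r n1 lamr lam[of r t]
        by (intro mult_left_mono mult_mono powr_mono2') auto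
      also have "\<dots> = t * W (t\<^sup>2)" using t r by (simp add: Wt)
      finally show "slope Y \<le> slope (t * W (t\<^sup>2))" by (rule pq_inverse_mono[OF inv])
    qed (use r in auto)
    then have "slope Y * r \<le> u x" using f(1) fu by simp
    moreover have "(Y / 2) powr (1 / (q - 1)) * r \<le> slope Y * r"
      using pq_inverse_lower[OF inv Y0] \<open>Y \<le> 1\<close> r by (intro mult_right_mono) auto
    moreover have "(Y / 2) powr (1 / (q - 1)) * r = c * lam r powr (1/(q-1)) * r powr (1 - (n-1)/(q-1))"
    proof -
      have "Y / 2 = (K * 2 powr (- n)) * (lam r * r powr (1 - n))"
        using r by (simp add: Y_def powr_mult powr_diff powr_minus field_simps)
      then have "(Y / 2) powr (1 / (q - 1)) * r = c * (lam r powr (1/(q-1)) * (r powr ((1 - n) / (q - 1)) * r))"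
        by (simp add: powr_mult powr_powr c_def)
      also have "r powr ((1 - n) / (q - 1)) * r = r powr (1 - (n-1)/(q-1))"
      proof -
        have "1 - (n-1)/(q-1) = (1 - n) / (q - 1) + 1" by (simp add: diff_divide_distrib)
        then show ?thesis using r by (simp only: powr_add powr_one)
      qed
      finally show ?thesis by simp
    qed
    ultimately show "c * lam (norm x) powr (1/(q-1)) * norm x powr (1 - (n-1)/(q-1)) \<le> u x"
      by (simp add: r_def)
  qed
qed

text \<open>
  A source that grows faster than \<open>m\<^bsup>p-1\<^esup>\<close> forces the minimum \<open>m\<close> over a large ball to be small. For \<open>W(\<tau>) = A (r\<^sup>2 + \<tau>)\<^bsup>-N\<^esup>\<close> the
  divergence term is \<open>N A (r\<^sup>2 + \<tau>)\<^bsup>-N-1\<^esup> (r\<^sup>2 - \<tau>)\<close>. It is positive in the inner ball only, where \<open>u \<ge> m\<close>, and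
  \<open>A\<close> is chosen so that it is at most half of \<open>m\<^bsup>s-1\<^esup>\<close>. The barrier that vanishes at radius \<open>2r\<close> drops
  between \<open>r\<close> and \<open>2r\<close> by at least \<open>r\<close> times the slope for a flux of order \<open>m\<^bsup>s-1\<^esup> r\<close>, and this drop is
  at most \<open>m\<close>.
\<close>

lemma ball_minimum_estimate:
  fixes n :: real
  defines "n \<equiv> real DIM('a)"
  assumes r: "0 < r" and sub: "cball y (2 * r) \<subseteq> \<Omega>" and pos: "\<And>x. x \<in> ball y (2 * r) \<Longrightarrow> 0 < u x"
    and z: "z \<in> cball y r" and min: "\<And>x. x \<in> cball y r \<Longrightarrow> u z \<le> u x"
  shows "5 powr (- n) / (2 * n) * (u z powr (s - 1) * r) \<le> (u z / r) powr (p - 1) + (u z / r) powr (q - 1)"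
proof -
  note inv = q_gt_1 q_less_p
  have n1: "n \<ge> 1" by (simp add: n_def Suc_leI)
  define m where "m = u z"
  have m: "m > 0" unfolding m_def using z r by (intro pos) auto
  define A where "A = m powr (s - 1) * (r\<^sup>2) powr n / (2 * n)"
  have A: "A > 0" using m r n1 by (simp add: A_def)
  define W where "W \<tau> = A * (r\<^sup>2 + \<tau>) powr (- n)" for \<tau>
  define W' where "W' \<tau> = A * (- n * (r\<^sup>2 + \<tau>) powr (- n - 1))" for \<tau>
  have r2: "0 < r\<^sup>2 + t\<^sup>2" for t :: real using r by (simp add: add_pos_nonneg)
  have W: "(W has_real_derivative W' (t\<^sup>2)) (at (t\<^sup>2))" for t
    unfolding W_def W'_def using r2[of t] by (auto intro!: derivative_eq_intros)
  have W0: "0 \<le> W \<tau>" for \<tau> using A by (simp add: W_def)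
  have cj: "continuous_on {-1..2 * r + 1} (\<lambda>t. slope (\<bar>t\<bar> * W (t\<^sup>2)))"
  proof (rule continuous_at_imp_continuous_on, rule ballI)
    fix t :: real
    have "isCont (\<lambda>t. W (t\<^sup>2)) t"
      by (intro isCont_o2[of _ "\<lambda>t. t\<^sup>2" W] DERIV_isCont[OF W] continuous_intros)
    then have "isCont (\<lambda>t. \<bar>t\<bar> * W (t\<^sup>2)) t" by (intro continuous_intros)
    then show "isCont (\<lambda>t. slope (\<bar>t\<bar> * W (t\<^sup>2))) t"
      by (rule isCont_o2[OF _ isCont_pq_inverse[OF inv]])
  qed
  obtain f where f: "f (2 * r) = 0" "\<And>t. -1 < t \<Longrightarrow> t < 2 * r + 1 \<Longrightarrow> (f has_real_derivative - slope (\<bar>t\<bar> * W (t\<^sup>2))) (at t)"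
    using decreasing_antiderivative[OF cj, of "2 * r"] by blast
  have "f (norm (z - y)) \<le> u z"
  proof (rule radial_comparison[of "ball y (2 * r)" "-1" y "2 * r + 1" W W'])
    show "closure (ball y (2 * r)) \<subseteq> \<Omega>" using sub r by simp
    show "-1 < norm (x - y) \<and> norm (x - y) < 2 * r + 1" if "x \<in> closure (ball y (2 * r))" for x
      using that r norm_ge_zero[of "x - y"] by (auto simp: dist_norm norm_minus_commute simp del: norm_ge_zero)
    show "continuous_on {- 1<..<2 * r + 1} (\<lambda>t. W' (t\<^sup>2))"
      unfolding W'_def using r2 by (intro continuous_intros) (auto simp: less_imp_neq)
    show "DIM('a) * W ((norm (x - y))\<^sup>2) + 2 * (norm (x - y))\<^sup>2 * W' ((norm (x - y))\<^sup>2) < u x powr (s - 1)"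
      if x: "x \<in> ball y (2 * r)" for x
    proof -
      define T where "T = (norm (x - y))\<^sup>2"
      define E where "E = (r\<^sup>2 + T) powr (- n)"
      have T: "0 \<le> T" "0 < r\<^sup>2 + T" using r2 by (auto simp: T_def)
      have "n * W T + 2 * T * W' T = n * A * E * ((r\<^sup>2 - T) / (r\<^sup>2 + T))"
        using T by (simp add: W_def W'_def E_def powr_diff field_simps)
      also have "\<dots> < u x powr (s - 1)"
      proof (cases "T \<le> r\<^sup>2")
        case True
        then have "norm (x - y) \<le> r" using r unfolding T_def by (simp add: power_mono_iff)
        then have "m \<le> u x" unfolding m_def by (intro min) (auto simp: dist_norm norm_minus_commute)
        have "n * A * E * ((r\<^sup>2 - T) / (r\<^sup>2 + T)) \<le> n * A * E * 1"
          using T A n1 by (intro mult_left_mono) (auto simp: E_def)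
        also have "\<dots> \<le> n * A * (r\<^sup>2) powr (- n)"
          using T A n1 r unfolding E_def by (auto intro!: mult_left_mono powr_mono2')
        also have "\<dots> = m powr (s - 1) / 2"
          using r n1 by (simp add: A_def powr_minus field_simps)
        also have "\<dots> < m powr (s - 1)" using m by simp
        also have "\<dots> \<le> u x powr (s - 1)"
          using \<open>m \<le> u x\<close> m q_gt_1 q_less_p p_less_s by (intro powr_mono2) auto
        finally show ?thesis .
      next
        case False
        then have "n * A * E * ((r\<^sup>2 - T) / (r\<^sup>2 + T)) \<le> 0"
          using T A n1 by (intro mult_nonneg_nonpos) (auto simp: E_def divide_nonpos_pos)
        also have "\<dots> < u x powr (s - 1)" using pos[OF x] by simp
        finally show ?thesis .
      qed
      finally show ?thesis by (simp add: T_def n_def)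
    qed
    show "f (norm (x - y)) \<le> u x" if "x \<in> frontier (ball y (2 * r))" for x
      using that r f(1) u_nonneg[of x] by (auto simp: dist_norm norm_minus_commute)
  qed (use W W0 f z r in auto)
  moreover have "f r + 0 * (r - norm (z - y)) \<le> f (norm (z - y))"
  proof (rule antiderivative_lower_bound[where j = "\<lambda>t. slope (\<bar>t\<bar> * W (t\<^sup>2))"])
    show "norm (z - y) \<le> r" using z by (auto simp: dist_norm norm_minus_commute)
    fix t assume "norm (z - y) \<le> t" "t \<le> r"
    moreover have "0 \<le> norm (z - y)" by simp
    ultimately have "-1 < t" "t < 2 * r + 1" using r by linarith+
    then show "(f has_real_derivative - slope (\<bar>t\<bar> * W (t\<^sup>2))) (at t)" by (rule f(2))
    show "0 \<le> slope (\<bar>t\<bar> * W (t\<^sup>2))" using W0 by (intro pq_inverse_nonneg[OF inv]) auto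
  qed
  moreover define Y where "Y = A * (5 * r\<^sup>2) powr (- n) * r"
  have "f (2 * r) + slope Y * (2 * r - r) \<le> f r"
  proof (rule antiderivative_lower_bound[where j = "\<lambda>t. slope (\<bar>t\<bar> * W (t\<^sup>2))"])
    fix t assume t: "r \<le> t" "t \<le> 2 * r"
    then show "(f has_real_derivative - slope (\<bar>t\<bar> * W (t\<^sup>2))) (at t)" using r by (intro f(2)) auto
    have "t\<^sup>2 \<le> (2 * r)\<^sup>2" using t r by (intro power_mono) auto
    then have "(5 * r\<^sup>2) powr (- n) \<le> (r\<^sup>2 + t\<^sup>2) powr (- n)"
      using r2[of t] n1 by (intro powr_mono2') (auto simp: power_mult_distrib)
    then have "Y \<le> \<bar>t\<bar> * W (t\<^sup>2)"
      unfolding Y_def W_def using t r A by (simp add: mult.commute) (intro mult_mono; simp)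
    then show "slope Y \<le> slope (\<bar>t\<bar> * W (t\<^sup>2))" by (rule pq_inverse_mono[OF inv])
  qed (use r in auto)
  ultimately have "slope Y * r \<le> m" using f(1) by (simp add: m_def)
  then have "slope Y \<le> m / r" using r by (simp add: field_simps)
  then have "Y \<le> (m / r) powr (p - 1) + (m / r) powr (q - 1)"
    using m r by (simp add: pq_inverse_le_iff[OF inv] pq_profile_nonneg_eq[OF inv])
  moreover have "Y = 5 powr (- n) / (2 * n) * (m powr (s - 1) * r)"
    using r n1 by (simp add: Y_def A_def powr_mult powr_minus field_simps)
  ultimately show ?thesis by (simp add: m_def)
qed

end

section \<open>Nonexistence\<close>

context pq_supersolution
begin

text \<open>
  Put \<open>\<gamma> = (N - q)/(q - 1)\<close>. The bound on \<open>s\<close> says that \<open>\<gamma> (s - 1) \<le> N\<close>, equivalently \<open>\<gamma> (s - q) \<le> q\<close>. The choice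
  \<open>l(\<tau>) = 1 + 1/\<tau>\<close> gives \<open>u \<ge> c |x|\<^bsup>-\<gamma>\<^esup>\<close>, hence \<open>u\<^bsup>s-1\<^esup> \<ge> c' |x|\<^bsup>-N\<^esup>\<close>. This source is strong enough to
  admit \<open>l(\<tau>) = 1 + ln \<tau>\<close>, which multiplies the lower bound by a power of \<open>ln |x|\<close>. The improvement is
  what excludes the critical \<open>s\<close>: on a ball of radius \<open>r\<close> at distance \<open>3r\<close> from the origin the
  minimum now exceeds every multiple of \<open>r\<^bsup>-\<gamma>\<^esup>\<close>, and the ball estimate fails for large \<open>r\<close>.
\<close>

lemma no_positive_exterior_supersolution:
  fixes n :: real
  defines "n \<equiv> real DIM('a)"
  assumes qn: "q < n" and sle: "s \<le> q * (n - 1) / (n - q)"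
    and R: "1 \<le> R" and sub: "\<And>x. R \<le> norm x \<Longrightarrow> x \<in> \<Omega>" and pos: "\<And>x. R \<le> norm x \<Longrightarrow> 0 < u x"
  shows False
proof -
  define \<gamma> where "\<gamma> = (n - q) / (q - 1)"
  have \<gamma>: "\<gamma> > 0" using qn q_gt_1 by (simp add: \<gamma>_def)
  have \<gamma>': "1 - (n - 1) / (q - 1) = - \<gamma>" using q_gt_1 by (simp add: \<gamma>_def field_simps)
  have \<gamma>s: "\<gamma> * (s - 1) \<le> n"
  proof -
    have "s - 1 \<le> n * (q - 1) / (n - q)" using sle qn by (simp add: field_simps)
    then have "\<gamma> * (s - 1) \<le> \<gamma> * (n * (q - 1) / (n - q))" using \<gamma> by (intro mult_left_mono) auto
    also have "\<dots> = n" using qn q_gt_1 by (simp add: \<gamma>_def)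
    finally show ?thesis .
  qed
  have \<gamma>q: "\<gamma> * (s - q) \<le> q"
  proof -
    have "\<gamma> * (q - 1) = n - q" using q_gt_1 by (simp add: \<gamma>_def)
    then show ?thesis using \<gamma>s by (simp add: algebra_simps)
  qed
  have \<gamma>p: "\<gamma> * (s - p) \<le> p"
  proof -
    have "\<gamma> * (s - p) \<le> \<gamma> * (s - q)" using \<gamma> q_less_p by (intro mult_left_mono) auto
    then show ?thesis using \<gamma>q q_less_p by linarith
  qed
  have "\<exists>c>0. \<forall>x. R < norm x \<longrightarrow> c * 1 powr (1/(q-1)) * norm x powr (1 - (n-1)/(q-1)) \<le> u x"
    unfolding n_def
  proof (rule exterior_lower_bound[OF R sub pos, where l = "\<lambda>\<tau>. 1 + 1 / \<tau>" and l' = "\<lambda>\<tau>. - (1 / \<tau>\<^sup>2)"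
        and C = 2 and \<delta> = 0 and ?K0.0 = 1 and lam = "\<lambda>_. 1"])
    show "((\<lambda>\<tau>. 1 + 1 / \<tau>) has_real_derivative - (1 / \<tau>\<^sup>2)) (at \<tau>)" if "0 < \<tau>" for \<tau> :: real
      using that by (auto intro!: derivative_eq_intros simp: power2_eq_square)
    show "continuous_on {0<..} (\<lambda>\<tau>::real. - (1 / \<tau>\<^sup>2))" by (intro continuous_intros) auto
    show "q - 1 < real DIM('a) - 1 - 2 * 0" using qn by (simp add: n_def)
    fix K :: real and x :: 'a
    assume K: "0 < K" and x: "R < norm x"
    then have "0 < norm x" using R by linarith
    then have "2 * K * ((norm x)\<^sup>2) powr (1 - real DIM('a)/2) * - (1 / ((norm x)\<^sup>2)\<^sup>2) < 0"
      using K by (simp add: mult_less_0_iff)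
    also have "0 \<le> u x powr (s - 1)" by simp
    finally show "2 * K * ((norm x)\<^sup>2) powr (1 - real DIM('a)/2) * - (1 / ((norm x)\<^sup>2)\<^sup>2) < u x powr (s - 1)" .
  qed auto
  then obtain c1 where c1: "c1 > 0" "\<And>x. R < norm x \<Longrightarrow> c1 * norm x powr (- \<gamma>) \<le> u x"
    unfolding \<gamma>' by auto
  \<comment> \<open>any \<open>\<delta> < (n - q) / 2\<close> keeps the slope integrable at infinity\<close>
  define \<delta> where "\<delta> = (n - q) / 4"
  have \<delta>: "\<delta> > 0" using qn by (simp add: \<delta>_def)
  have "\<exists>c>0. \<forall>x. R < norm x \<longrightarrow> c * (1 + ln ((norm x)\<^sup>2)) powr (1/(q-1)) * norm x powr (1 - (n-1)/(q-1)) \<le> u x"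
    unfolding n_def
  proof (rule exterior_lower_bound[OF R sub pos, where l = "\<lambda>\<tau>. 1 + ln \<tau>" and l' = "\<lambda>\<tau>. 1 / \<tau>"
        and C = "1 + 1 / \<delta>" and \<delta> = \<delta> and ?K0.0 = "c1 powr (s - 1) / 4" and lam = "\<lambda>r. 1 + ln (r\<^sup>2)"])
    show "((\<lambda>\<tau>. 1 + ln \<tau>) has_real_derivative 1 / \<tau>) (at \<tau>)" if "0 < \<tau>" for \<tau> :: real
      using that by (auto intro!: derivative_eq_intros)
    show "continuous_on {0<..} (\<lambda>\<tau>::real. 1 / \<tau>)" by (intro continuous_intros) auto
    show "q - 1 < real DIM('a) - 1 - 2 * \<delta>" using qn by (simp add: n_def \<delta>_def field_simps)
    show "1 + ln \<tau> \<le> (1 + 1 / \<delta>) * \<tau> powr \<delta>" if "1 \<le> \<tau>" for \<tau> :: real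
    proof -
      have "1 \<le> \<tau> powr \<delta>" using that \<delta> by (intro ge_one_powr_ge_zero) auto
      moreover have "ln \<tau> \<le> \<tau> powr \<delta> / \<delta>" by (rule ln_powr_bound[OF that \<delta>])
      ultimately show ?thesis by (simp add: algebra_simps)
    qed
    show "0 \<le> 1 + ln (r\<^sup>2) \<and> 1 + ln (r\<^sup>2) \<le> 1 + ln (t\<^sup>2)" if "R \<le> r" "r \<le> t" for r t
    proof -
      have "1 \<le> r" using that R by simp
      then have "1 \<le> r\<^sup>2" "r\<^sup>2 \<le> t\<^sup>2" using that by (auto intro: power_mono)
      then show ?thesis using ln_le_cancel_iff[of "r\<^sup>2" "t\<^sup>2"] ln_ge_zero[of "r\<^sup>2"] by linarith
    qed
    fix K :: real and x :: 'a
    assume K: "0 < K" "K \<le> c1 powr (s - 1) / 4" and x: "R < norm x"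
    define r where "r = norm x"
    have r: "1 \<le> r" using x R by (simp add: r_def)
    have "2 * K * (r\<^sup>2) powr (1 - real DIM('a)/2) * (1 / r\<^sup>2) = 2 * K * r powr (- n)"
    proof -
      have "(r\<^sup>2) powr (1 - n/2) * (1 / r\<^sup>2) = (r\<^sup>2) powr (1 - n/2) * (r\<^sup>2) powr (- 1)"
        using r by (simp add: powr_minus_divide)
      also have "\<dots> = (r\<^sup>2) powr (1 - n/2 + - 1)" by (rule powr_add[symmetric])
      also have "1 - n/2 + - 1 = - n/2" by simp
      also have "(r\<^sup>2) powr (- n/2) = r powr (- n)" using r by (simp add: square_powr)
      finally show ?thesis unfolding n_def by (simp only: mult.assoc)
    qed
    also have "\<dots> \<le> c1 powr (s - 1) / 2 * r powr (- n)" using K by (intro mult_right_mono) auto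
    also have "\<dots> < c1 powr (s - 1) * r powr (- n)" using c1 r by simp
    also have "\<dots> \<le> c1 powr (s - 1) * r powr (- (\<gamma> * (s - 1)))"
      using r \<gamma>s by (intro mult_left_mono powr_mono) auto
    also have "\<dots> = (c1 * r powr (- \<gamma>)) powr (s - 1)" using r by (simp add: powr_mult powr_powr)
    also have "\<dots> \<le> u x powr (s - 1)"
      using c1 c1(2)[OF x] q_gt_1 q_less_p p_less_s by (intro powr_mono2) (auto simp: r_def)
    finally show "2 * K * ((norm x)\<^sup>2) powr (1 - real DIM('a)/2) * (1 / (norm x)\<^sup>2) < u x powr (s - 1)"
      by (simp only: r_def)
  qed (use \<delta> c1 in \<open>auto intro!: add_pos_pos\<close>)
  then obtain c2 where c2: "c2 > 0"
    "\<And>x. R < norm x \<Longrightarrow> c2 * (1 + ln ((norm x)\<^sup>2)) powr (1/(q-1)) * norm x powr (- \<gamma>) \<le> u x"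
    unfolding \<gamma>' by auto
  have n1: "n \<ge> 1" by (simp add: n_def Suc_leI)
  define \<kappa> where "\<kappa> = 5 powr (- n) / (2 * n)"
  have \<kappa>: "\<kappa> > 0" using n1 by (simp add: \<kappa>_def)
  \<comment> \<open>\<open>\<Lambda>\<close> is so large that both powers on the right of the ball estimate are at most a third of the left side\<close>
  define \<Lambda> where "\<Lambda> = max ((3 / \<kappa>) powr (1 / (s - p))) ((3 / \<kappa>) powr (1 / (s - q)))"
  have \<Lambda>0: "\<Lambda> > 0" using \<kappa> by (simp add: \<Lambda>_def less_max_iff_disj)
  have \<Lambda>: "3 / \<kappa> \<le> \<Lambda> powr (s - e)" if "e = p \<or> e = q" for e
  proof -
    have se: "0 < s - e" using that q_less_p p_less_s by auto
    have "(3 / \<kappa>) powr (1 / (s - e)) \<le> \<Lambda>" using that by (auto simp: \<Lambda>_def)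
    then have "((3 / \<kappa>) powr (1 / (s - e))) powr (s - e) \<le> \<Lambda> powr (s - e)"
      using se by (intro powr_mono2) auto
    then show ?thesis using se \<kappa> by (simp add: powr_powr)
  qed
  \<comment> \<open>the factor \<open>4\<close> accounts for minimum points at distance up to \<open>4r\<close> from the origin\<close>
  define X where "X = (\<Lambda> * 4 powr \<gamma> / c2) powr (q - 1)"
  define r where "r = max R (exp X)"
  have r: "R \<le> r" "1 \<le> r" "0 < r" using R by (auto simp: r_def)
  have X0: "0 \<le> X" by (simp add: X_def)
  have lnr: "X \<le> 1 + ln (r\<^sup>2)"
  proof -
    have "ln (exp X) \<le> ln r" using r by (subst ln_le_cancel_iff) (auto simp: r_def)
    then show ?thesis using X0 r by (simp add: ln_realpow)
  qed
  obtain y :: 'a where y: "norm y = 3 * r" using r vector_choose_size[of "3 * r"] by auto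
  have nx: "norm y - dist y x \<le> norm x" "norm x \<le> norm y + dist y x" for x
    using norm_triangle_ineq2[of y x] norm_triangle_ineq2[of x y] by (auto simp: dist_norm norm_minus_commute)
  have sub2: "cball y (2 * r) \<subseteq> \<Omega>"
  proof
    fix x assume "x \<in> cball y (2 * r)"
    then show "x \<in> \<Omega>" using nx[of x] y r by (intro sub) auto
  qed
  have "continuous_on (cball y r) u"
    by (rule continuous_on_subset[OF u_cont]) (use sub2 r in auto)
  then obtain z where z: "z \<in> cball y r" "\<forall>x\<in>cball y r. u z \<le> u x"
    using continuous_attains_inf[OF compact_cball, of y r u] r by auto
  define m where "m = u z"
  have zn: "2 * r \<le> norm z" "norm z \<le> 4 * r" using nx[of z] z y by auto
  have Rz: "R < norm z" using zn r by linarith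
  have mlow: "\<Lambda> * r powr (- \<gamma>) \<le> m"
  proof -
    have "(\<Lambda> * 4 powr \<gamma> / c2) = X powr (1 / (q - 1))"
      using \<Lambda>0 c2 q_gt_1 by (simp add: X_def powr_powr)
    also have "\<dots> \<le> (1 + ln ((norm z)\<^sup>2)) powr (1 / (q - 1))"
    proof -
      have "ln (r\<^sup>2) \<le> ln ((norm z)\<^sup>2)" using zn r by (subst ln_le_cancel_iff) (auto intro!: power_mono)
      then show ?thesis using lnr X0 q_gt_1 by (intro powr_mono2) auto
    qed
    finally have "\<Lambda> * 4 powr \<gamma> \<le> c2 * (1 + ln ((norm z)\<^sup>2)) powr (1 / (q - 1))"
      using c2 by (simp add: field_simps)
    then have "\<Lambda> * 4 powr \<gamma> * (4 * r) powr (- \<gamma>) \<le> c2 * (1 + ln ((norm z)\<^sup>2)) powr (1 / (q - 1)) * norm z powr (- \<gamma>)"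
      by (rule mult_mono) (use zn r \<gamma> c2(1) in \<open>auto intro!: powr_mono2'\<close>)
    also have "\<dots> \<le> m" unfolding m_def by (rule c2(2)[OF Rz])
    also have "\<Lambda> * 4 powr \<gamma> * (4 * r) powr (- \<gamma>) = \<Lambda> * r powr (- \<gamma>)"
      using r by (simp add: powr_mult powr_minus field_simps)
    finally show ?thesis .
  qed
  have m0: "m > 0" using mlow \<Lambda>0 r by (smt (verit) mult_pos_pos powr_gt_zero)
  have small: "(m / r) powr (e - 1) \<le> \<kappa> / 3 * (m powr (s - 1) * r)" if e: "e = p \<or> e = q" for e
  proof -
    have se: "0 < s - e" using e q_less_p p_less_s by auto
    have "\<Lambda> powr (s - e) \<le> \<Lambda> powr (s - e) * r powr (e - \<gamma> * (s - e))"
      using e \<gamma>p \<gamma>q r by (auto intro!: ge_one_powr_ge_zero simp: mult_le_cancel_left1)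
    also have "\<dots> = (\<Lambda> * r powr (- \<gamma>)) powr (s - e) * r powr e"
    proof -
      have "r powr (e - \<gamma> * (s - e)) = r powr (- \<gamma> * (s - e)) * r powr e"
        unfolding powr_add[symmetric] by (simp add: algebra_simps)
      then show ?thesis by (simp only: powr_mult powr_powr mult.assoc)
    qed
    also have "\<dots> \<le> m powr (s - e) * r powr e"
      using mlow se \<Lambda>0 by (intro mult_right_mono powr_mono2) auto
    finally have "3 / \<kappa> \<le> m powr (s - e) * r powr e" using \<Lambda>[OF e] by linarith
    then have "1 \<le> \<kappa> / 3 * (m powr (s - e) * r powr e)" using \<kappa> by (simp add: field_simps)
    then have "(m / r) powr (e - 1) * 1 \<le> (m / r) powr (e - 1) * (\<kappa> / 3 * (m powr (s - e) * r powr e))"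
      by (intro mult_left_mono) auto
    also have "\<dots> = \<kappa> / 3 * ((m powr (e - 1) * m powr (s - e)) * (r powr e / r powr (e - 1)))"
      using m0 r by (simp add: powr_divide mult_ac)
    also have "m powr (e - 1) * m powr (s - e) = m powr (s - 1)" by (simp flip: powr_add)
    also have "r powr e / r powr (e - 1) = r" using r by (simp flip: powr_diff)
    finally show ?thesis by simp
  qed
  have "\<kappa> * (m powr (s - 1) * r) \<le> (m / r) powr (p - 1) + (m / r) powr (q - 1)"
    unfolding \<kappa>_def m_def n_def
  proof (rule ball_minimum_estimate[OF r(3) sub2 _ z(1)])
    fix x assume "x \<in> ball y (2 * r)"
    then show "0 < u x" using nx[of x] y r by (intro pos) auto
  qed (use z in auto)
  also have "\<dots> \<le> \<kappa> / 3 * (m powr (s - 1) * r) + \<kappa> / 3 * (m powr (s - 1) * r)"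
    by (intro add_mono small) auto
  finally have "\<kappa> / 3 * (m powr (s - 1) * r) \<le> 0" by (simp add: field_simps)
  moreover have "0 < \<kappa> / 3 * (m powr (s - 1) * r)" using \<kappa> m0 r by simp
  ultimately show False by simp
qed

end

lemma integral_lebesgue_on_open:
  fixes f F :: "'a::euclidean_space \<Rightarrow> real"
  assumes O: "open \<Omega>" and f: "f \<in> borel_measurable (lebesgue_on \<Omega>)" and F: "F \<in> borel_measurable borel"
    and ae: "AE x in lborel. x \<in> \<Omega> \<longrightarrow> f x = F x" and z: "\<And>x. x \<notin> \<Omega> \<Longrightarrow> F x = 0"
  shows "(\<integral>x. f x \<partial>lebesgue_on \<Omega>) = (\<integral>x. F x \<partial>lborel)"
proof -
  have S: "\<Omega> \<inter> space lebesgue \<in> sets lebesgue" using O by simp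
  have "(\<integral>x. f x \<partial>lebesgue_on \<Omega>) = (\<integral>x. indicator \<Omega> x *\<^sub>R f x \<partial>lebesgue)"
    by (rule integral_restrict_space[OF S])
  also have "\<dots> = (\<integral>x. F x \<partial>lebesgue)"
  proof (rule integral_cong_AE)
    show "(\<lambda>x. indicator \<Omega> x *\<^sub>R f x) \<in> borel_measurable lebesgue"
      using f borel_measurable_restrict_space_iff[OF S, of f] by simp
    show "F \<in> borel_measurable lebesgue" using F by (simp add: measurable_completion)
    show "AE x in lebesgue. indicator \<Omega> x *\<^sub>R f x = F x"
      using AE_completion[OF ae] by eventually_elim (use z in \<open>auto simp: indicator_def\<close>)
  qed
  also have "\<dots> = (\<integral>x. F x \<partial>lborel)" by (rule integral_completion) (use F in simp)
  finally show ?thesis .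
qed

lemma borel_representative:
  fixes g :: "'a::euclidean_space \<Rightarrow> 'b::euclidean_space"
  assumes O: "open \<Omega>" and g: "g \<in> borel_measurable (lebesgue_on \<Omega>)"
  obtains g' where "g' \<in> borel_measurable borel" "AE x in lborel. x \<in> \<Omega> \<longrightarrow> g x = g' x"
proof -
  have S: "\<Omega> \<inter> space lebesgue \<in> sets lebesgue" using O by simp
  have g0: "(\<lambda>x. indicator \<Omega> x *\<^sub>R g x) \<in> borel_measurable lebesgue"
    using g borel_measurable_restrict_space_iff[OF S, of g] by simp
  have "\<forall>i\<in>Basis. \<exists>h\<in>borel_measurable lborel. AE x in lborel. (indicator \<Omega> x *\<^sub>R g x) \<bullet> i = h x"
    by (intro ballI completion_ex_borel_measurable_real borel_measurable_inner g0 borel_measurable_const)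
  then obtain h where h: "\<And>i. i \<in> Basis \<Longrightarrow> h i \<in> borel_measurable lborel"
    "\<And>i. i \<in> Basis \<Longrightarrow> AE x in lborel. (indicator \<Omega> x *\<^sub>R g x) \<bullet> i = h i x" by metis
  show thesis
  proof (rule that[of "\<lambda>x. \<Sum>i\<in>Basis. h i x *\<^sub>R i"])
    show "(\<lambda>x. \<Sum>i\<in>Basis. h i x *\<^sub>R i) \<in> borel_measurable borel"
      using h(1) by (intro borel_measurable_sum borel_measurable_scaleR) auto
    have "AE x in lborel. \<forall>i\<in>Basis. (indicator \<Omega> x *\<^sub>R g x) \<bullet> i = h i x"
      using h(2) by (intro AE_finite_allI) auto
    then show "AE x in lborel. x \<in> \<Omega> \<longrightarrow> g x = (\<Sum>i\<in>Basis. h i x *\<^sub>R i)"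
    proof eventually_elim
      case (elim x)
      show ?case
      proof
        assume "x \<in> \<Omega>"
        then have "(\<Sum>i\<in>Basis. h i x *\<^sub>R i) = (\<Sum>i\<in>Basis. (g x \<bullet> i) *\<^sub>R i)"
          using elim by (intro sum.cong) (auto simp: indicator_def)
        then show "g x = (\<Sum>i\<in>Basis. h i x *\<^sub>R i)" by (simp add: euclidean_representation)
      qed
    qed
  qed
qed

lemma norm_laplace_flux_le:
  assumes "1 < r" "r \<le> p"
  shows "norm (laplace_flux r v) \<le> (1 + norm v) powr p"
proof -
  have "norm v powr (r - 1) \<le> (1 + norm v) powr (r - 1)" using assms by (intro powr_mono2) auto
  also have "\<dots> \<le> (1 + norm v) powr p" using assms by (intro powr_mono) auto
  finally show ?thesis by (simp add: norm_laplace_flux)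
qed

text \<open>
  A Borel function that agrees with the given weak gradient almost everywhere changes none of the
  integrals over \<open>\<Omega>\<close>, and these become integrals over the whole space since test functions vanish
  outside \<open>\<Omega>\<close>. Local integrability of \<open>|g|\<^sup>p\<close> makes both flux integrals converge, so they may be
  added.
\<close>

lemma nonneg_solution_imp_pq_supersolution:
  fixes \<Omega> :: "'a::euclidean_space set"
  assumes O: "open \<Omega>" and e: "1 < q" "q < p" "p < s" and sol: "nonneg_solution p q s \<Omega> u"
  obtains g where "pq_supersolution \<Omega> p q s (\<lambda>x. if x \<in> \<Omega> then u x else 0) g"
proof -
  define U where "U x = (if x \<in> \<Omega> then u x else 0)" for x
  have Ueq: "x \<in> \<Omega> \<Longrightarrow> U x = u x" "x \<notin> \<Omega> \<Longrightarrow> U x = 0" for x by (auto simp: U_def)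
  have uc: "continuous_on \<Omega> u" and u0: "\<And>x. x \<in> \<Omega> \<Longrightarrow> 0 \<le> u x"
    using sol by (auto simp: nonneg_solution_def)
  obtain g where g: "g \<in> Lp_loc p \<Omega>" "weak_gradient \<Omega> u g"
    "\<And>\<phi>. \<phi> \<in> C1_c \<Omega> \<Longrightarrow> (\<And>x. 0 \<le> \<phi> x) \<Longrightarrow>
       (\<integral>x. u x powr (s - 1) * \<phi> x \<partial>lebesgue_on \<Omega>) \<le>
       (\<integral>x. laplace_flux p (g x) \<bullet> grad \<phi> x \<partial>lebesgue_on \<Omega>) + (\<integral>x. laplace_flux q (g x) \<bullet> grad \<phi> x \<partial>lebesgue_on \<Omega>)"
    using sol by (auto simp: nonneg_solution_def)
  have gm [measurable]: "g \<in> borel_measurable (lebesgue_on \<Omega>)" using g(1) by (simp add: Lp_loc_def)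
  obtain g' where g' [measurable]: "g' \<in> borel_measurable borel" and ae: "AE x in lborel. x \<in> \<Omega> \<longrightarrow> g x = g' x"
    using borel_representative[OF O gm] by blast
  have um [measurable]: "u \<in> borel_measurable (lebesgue_on \<Omega>)"
    using O uc by (intro continuous_imp_measurable_on_sets_lebesgue) auto
  have Um [measurable]: "U \<in> borel_measurable borel"
    unfolding U_def using uc O by (intro borel_measurable_continuous_on_if) auto
  have Ob [measurable]: "\<Omega> \<in> sets borel" using O by simp
  have gp: "integrable lborel (\<lambda>x. indicator K x * norm (g' x) powr p)" if K: "compact K" "K \<subseteq> \<Omega>" for K
  proof -
    have Kb [measurable]: "K \<in> sets borel" using K by (auto intro: borel_compact)
    have S: "K \<inter> space lebesgue \<in> sets lebesgue" using Kb by simp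
    have "integrable (lebesgue_on K) (\<lambda>x. norm (g x) powr p)" using g(1) K by (simp add: Lp_loc_def)
    then have i: "integrable lebesgue (\<lambda>x. indicator K x *\<^sub>R norm (g x) powr p)"
      by (simp add: integrable_restrict_space[OF S])
    have "integrable lebesgue (\<lambda>x. indicator K x * norm (g' x) powr p)"
    proof (rule integrable_cong_AE_imp[OF i])
      show "(\<lambda>x. indicator K x * norm (g' x) powr p) \<in> borel_measurable lebesgue"
        by (intro measurable_completion) measurable
      show "AE x in lebesgue. indicator K x *\<^sub>R norm (g x) powr p = indicator K x * norm (g' x) powr p"
        using AE_completion[OF ae] by eventually_elim (use K in \<open>auto simp: indicator_def\<close>)
    qed
    then show ?thesis by (subst (asm) integrable_completion) auto
  qed
  have "pq_supersolution \<Omega> p q s U g'"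
  proof (unfold_locales)
    show "continuous_on \<Omega> U" using uc by (simp add: U_def cong: continuous_on_cong)
    show "0 \<le> U x" for x using u0 by (simp add: U_def)
    show "U x = 0" if "x \<notin> \<Omega>" for x using that by (simp add: U_def)
  next
    fix \<phi> and i :: 'a assume \<phi>: "\<phi> \<in> C1_c \<Omega>" and i: "i \<in> Basis"
    obtain C where C: "compact C" "C \<subseteq> \<Omega>" "\<And>x. x \<notin> C \<Longrightarrow> \<phi> x = 0" "\<And>x. x \<notin> C \<Longrightarrow> grad \<phi> x = 0"
      "\<And>x. GDERIV \<phi> x :> grad \<phi> x" "continuous_on UNIV (grad \<phi>)" "continuous_on UNIV \<phi>"
      by (rule C1_cD[OF \<phi>]) (rule that)
    have z: "\<phi> x = 0" "grad \<phi> x = 0" if "x \<notin> \<Omega>" for x using C(2) C(3,4)[of x] that by auto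
    have [measurable]: "\<phi> \<in> borel_measurable borel" "grad \<phi> \<in> borel_measurable borel"
      using C(6,7) by (auto intro: borel_measurable_continuous_onI)
    have [measurable]: "\<phi> \<in> borel_measurable (lebesgue_on \<Omega>)" "grad \<phi> \<in> borel_measurable (lebesgue_on \<Omega>)"
      by (auto intro!: measurable_restrict_space1 measurable_completion)
    have "(\<integral>x. u x * (grad \<phi> x \<bullet> i) \<partial>lebesgue_on \<Omega>) = - (\<integral>x. (g x \<bullet> i) * \<phi> x \<partial>lebesgue_on \<Omega>)"
      using g(2) \<phi> i by (simp add: weak_gradient_def)
    also have "(\<integral>x. u x * (grad \<phi> x \<bullet> i) \<partial>lebesgue_on \<Omega>) = (\<integral>x. U x * (grad \<phi> x \<bullet> i) \<partial>lborel)"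
      by (rule integral_lebesgue_on_open[OF O]) (auto simp: Ueq z)
    also have "(\<integral>x. (g x \<bullet> i) * \<phi> x \<partial>lebesgue_on \<Omega>) = (\<integral>x. (g' x \<bullet> i) * \<phi> x \<partial>lborel)"
      by (rule integral_lebesgue_on_open[OF O]) (use ae in \<open>auto simp: z\<close>)
    finally show "(\<integral>x. U x * (grad \<phi> x \<bullet> i) \<partial>lborel) = - (\<integral>x. (g' x \<bullet> i) * \<phi> x \<partial>lborel)" .
  next
    fix \<phi> :: "'a \<Rightarrow> real" assume \<phi>: "\<phi> \<in> C1_c \<Omega>" and \<phi>0: "\<And>x. 0 \<le> \<phi> x"
    obtain C where C: "compact C" "C \<subseteq> \<Omega>" "\<And>x. x \<notin> C \<Longrightarrow> \<phi> x = 0" "\<And>x. x \<notin> C \<Longrightarrow> grad \<phi> x = 0"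
      "\<And>x. GDERIV \<phi> x :> grad \<phi> x" "continuous_on UNIV (grad \<phi>)" "continuous_on UNIV \<phi>"
      by (rule C1_cD[OF \<phi>]) (rule that)
    have z: "\<phi> x = 0" "grad \<phi> x = 0" if "x \<notin> \<Omega>" for x using C(2) C(3,4)[of x] that by auto
    have [measurable]: "\<phi> \<in> borel_measurable borel" "grad \<phi> \<in> borel_measurable borel"
      using C(6,7) by (auto intro: borel_measurable_continuous_onI)
    have [measurable]: "\<phi> \<in> borel_measurable (lebesgue_on \<Omega>)" "grad \<phi> \<in> borel_measurable (lebesgue_on \<Omega>)"
      by (auto intro!: measurable_restrict_space1 measurable_completion)
    have fl [measurable]: "laplace_flux r \<in> borel_measurable (borel :: 'a measure)" for r
      unfolding laplace_flux_def by measurable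
    have conv: "(\<integral>x. laplace_flux r (g x) \<bullet> grad \<phi> x \<partial>lebesgue_on \<Omega>) = (\<integral>x. laplace_flux r (g' x) \<bullet> grad \<phi> x \<partial>lborel)" for r
      by (rule integral_lebesgue_on_open[OF O]) (use ae in \<open>auto simp: z\<close>)
    have int: "integrable lborel (\<lambda>x. laplace_flux r (g' x) \<bullet> grad \<phi> x)" if r: "1 < r" "r \<le> p" for r
    proof -
      obtain M where M: "\<And>x. x \<in> C \<Longrightarrow> norm (grad \<phi> x) \<le> M"
        using compact_imp_bounded[OF compact_continuous_image[OF continuous_on_subset[OF C(6) subset_UNIV] C(1)]]
        by (auto simp: bounded_iff)
      have "integrable lborel (\<lambda>x. \<bar>M\<bar> * (indicator C x * (1 + norm (g' x)) powr p))"
        using integrable_one_plus_norm_powr[OF g' C(1) _ gp[OF C(1,2)]] e by simp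
      then show ?thesis
      proof (rule Bochner_Integration.integrable_bound)
        show "AE x in lborel. norm (laplace_flux r (g' x) \<bullet> grad \<phi> x) \<le> norm (\<bar>M\<bar> * (indicator C x * (1 + norm (g' x)) powr p))"
        proof (rule AE_I2)
          fix x
          show "norm (laplace_flux r (g' x) \<bullet> grad \<phi> x) \<le> norm (\<bar>M\<bar> * (indicator C x * (1 + norm (g' x)) powr p))"
          proof (cases "x \<in> C")
            case True
            have "norm (laplace_flux r (g' x) \<bullet> grad \<phi> x) \<le> norm (laplace_flux r (g' x)) * norm (grad \<phi> x)"
              using Cauchy_Schwarz_ineq2 by simp
            also have "\<dots> \<le> (1 + norm (g' x)) powr p * \<bar>M\<bar>"
              using M[OF True] r by (intro mult_mono norm_laplace_flux_le) auto
            finally show ?thesis using True by (simp add: mult.commute)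
          next
            case False then show ?thesis using C(4) by simp
          qed
        qed
      qed simp
    qed
    have "(\<integral>x. U x powr (s - 1) * \<phi> x \<partial>lborel) = (\<integral>x. u x powr (s - 1) * \<phi> x \<partial>lebesgue_on \<Omega>)"
      by (rule integral_lebesgue_on_open[OF O, symmetric]) (auto simp: Ueq z)
    also have "\<dots> \<le> (\<integral>x. laplace_flux p (g' x) \<bullet> grad \<phi> x \<partial>lborel) + (\<integral>x. laplace_flux q (g' x) \<bullet> grad \<phi> x \<partial>lborel)"
      using g(3)[OF \<phi> \<phi>0] by (simp add: conv)
    also have "\<dots> = (\<integral>x. pq_flux p q (g' x) \<bullet> grad \<phi> x \<partial>lborel)"
      using int[of p] int[of q] e by (simp add: pq_flux_def inner_add_left)
    finally show "(\<integral>x. U x powr (s - 1) * \<phi> x \<partial>lborel) \<le> (\<integral>x. pq_flux p q (g' x) \<bullet> grad \<phi> x \<partial>lborel)" .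
  qed (use O e g' gp in auto)
  then show thesis unfolding U_def by (rule that)
qed

theorem theorem1p4:
  fixes \<Omega> :: "(real ^ 'n) set"
    and p q s :: real
    and u :: "real ^ 'n \<Rightarrow> real"
  assumes "exterior_domain \<Omega>"
    and "q < real CARD('n)"
    and "1 < q" and "q < p" and "p < s"
    and "s \<le> q * (real CARD('n) - 1) / (real CARD('n) - q)"
    and "nonneg_solution p q s \<Omega> u"
  shows "\<forall>x\<in>\<Omega>. u x = 0"
proof (rule ccontr)
  have O: "open \<Omega>" and con: "connected \<Omega>" using assms(1) by (auto simp: exterior_domain_def)
  obtain R0 where R0: "R0 > 0" "{x. norm x > R0} \<subseteq> \<Omega>" using assms(1) by (auto simp: exterior_domain_def)
  define U where "U x = (if x \<in> \<Omega> then u x else 0)" for x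
  obtain g where "pq_supersolution \<Omega> p q s U g"
    unfolding U_def using nonneg_solution_imp_pq_supersolution[OF O assms(3,4,5,7)] by blast
  then interpret pq_supersolution \<Omega> p q s U g .
  assume "\<not> (\<forall>x\<in>\<Omega>. u x = 0)"
  then obtain x1 where "x1 \<in> \<Omega>" "u x1 \<noteq> 0" by blast
  then have "0 < U x1" using u_nonneg[of x1] by (simp add: U_def)
  then have pos: "0 < U x" if "x \<in> \<Omega>" for x using positive_everywhere[OF con _ that] by blast
  have sub: "x \<in> \<Omega>" if "R0 + 1 \<le> norm x" for x using R0 that by auto
  show False
    by (rule no_positive_exterior_supersolution[of "R0 + 1"]) (use assms R0 sub pos in auto)
qed

end
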